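(* For a group $G$, the following properties are equivalent. (1) $G$ has the fixed-point property for cones. (2) $G$ has the translate property. (3) $G$ has the abstract translate property. (4) For every non-zero bounded function $f\geq 0$ on $G$, there is an integral on $G$ normalised for $f$. (5) $G$ satisfies the $f$-Reiter property for every $0\neq f\in \ell^\infty(G)$.
   Context: Groups are abstract (discrete) groups; all vector spaces are real; topological vector spaces are assumed locally convex and Hausdorff. For a function $f$ on $G$ and $g\in G$, $(gf)(x)=f(g^{-1}x)$. $\ell^\infty(G)$ is the space of bounded real functions on $G$ with the pointwise order. A convex cone $C\subseteq E$ is a subset with $C+C\subseteq C$ and $\mathbf{R}_+C\subseteq C$; it is proper if $C\cap(-C)=\{0\}$. It defines an order on $E$ ($x\leq y$ iff $y-x\in C$). The topological dual $E'$ carries the dual pre-order: $\lambda\geq 0$ iff $\lambda(c)\geq0$ for all $c\in C$. $C$ is weakly complete if it is complete for the uniform structure induced by the weak topology $\sigma(E,E')$. A representation of $G$ on a vector space $E$ is an action by linear maps, assumed continuous if $E$ has a topology and order-preserving if $E$ has a (pre-)order. A $G$-representation on a cone $C\subseteq E$ means a representation on the topological vector space $E$ by continuous linear maps preserving $C$. The dual $E'$ has the dual $G$-representation $(g\varphi)(x)=\varphi(g^{-1}x)$. The representation is of locally bounded type if there is $x\neq 0$ in $C$ whose orbit $Gx$ is bounded in the sense of topological vector spaces (absorbed by every neighbourhood of zero). In a (pre-)ordered vector space with a $G$-representation, an element $\varphi$ $G$-dominates $\lambda$ if there exist $g_1,\ldots,g_n\in G$ with $\pm\lambda\leq\sum_i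 g_i\varphi$. The representation on $C\subseteq E$ is of cobounded type if there is $\varphi\in E'$ which $G$-dominates every $\lambda\in E'$. $G$ has the fixed-point property for cones if every $G$-representation of locally bounded cobounded type on any weakly complete proper convex cone $C$ has a non-zero fixed point in $C$. A non-zero bounded function $f\geq0$ on $G$ satisfies the translate property if for all $n$, $t_1,\dots,t_n\in\mathbf{R}$ and $g_1,\dots,g_n\in G$: $\sum_i t_i g_i f\geq 0$ implies $\sum_i t_i\geq0$. $G$ has the translate property if this holds for all such $f$. $G$ has the abstract translate property if the following holds: for every $G$-representation on an ordered vector space $(V,\leq)$ and every $v\geq0$ in $V$ for which there is a positive linear form $\delta\colon V\to\mathbf{R}$ with $\delta(v)\neq0$ which is bounded on the orbit $Gv$, one has, for all $t_i\in\mathbf{R}$ and $g_i\in G$: $\sum_{i=1}^n t_i g_i v\geq0$ implies $\sum_{i=1}^n t_i\geq0$. For a bounded non-zero $f\geq0$ on $G$, $\ell^\infty(G;f)$ is the ordered vector space (with $G$-action) of functions on $G$ that are $G$-dominated by $f$. An integral on $G$ normalised for $f$ is a $G$-invariant positive linear form $\mu$ on $\ell^\infty(G;f)$ with $\mu(f)=1$. $G$ has the $f$-Reiter property if for every finite set $S\subseteq G$ and every $\epsilon>0$ there is a finitely supported function $u$ on $G$ with $\|(su-u)\cdot f\|_1<\epsilon\|u\cdot f\|_1$ for all $s\in S$, where $\|\cdot\|_1$ is the $\ell^1$-norm and $\cdot$ is the pointwise product. *)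

theory Defs
  imports
    "HOL-Analysis.Analysis"
    "HOL-Algebra.Group_Action"
    "HOL-Library.Function_Algebras"
begin

section \<open>Real vector spaces\<close>

instantiation "fun" :: (type, real_vector) real_vector
begin

definition scaleR_fun :: "real \<Rightarrow> ('a \<Rightarrow> 'b) \<Rightarrow> 'a \<Rightarrow> 'b"
  where "scaleR_fun c f = (\<lambda>x. c *\<^sub>R f x)"

instance
  by standard (simp_all add: scaleR_fun_def fun_eq_iff scaleR_add_right scaleR_add_left)

end

lemma scaleR_fun_apply [simp]: "(c *\<^sub>R f) x = c *\<^sub>R f x"
  by (simp add: scaleR_fun_def)

text \<open>
  Vector spaces are linear subspaces of a type of class \<^class>\<open>real_vector\<close>. This makes it
  possible to quantify over all spaces inside a definition; the ambient type plays the role of a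
  universe. A map on a subspace is an HOL function whose values off the subspace are irrelevant.
\<close>

definition linear_on :: "'a::real_vector set \<Rightarrow> ('a \<Rightarrow> 'b::real_vector) \<Rightarrow> bool" where
  "linear_on V f \<longleftrightarrow>
     (\<forall>x\<in>V. \<forall>y\<in>V. f (x + y) = f x + f y) \<and> (\<forall>c. \<forall>x\<in>V. f (c *\<^sub>R x) = c *\<^sub>R f x)"

definition ordered_vector_space_on ::
    "'v::real_vector set \<Rightarrow> ('v \<Rightarrow> 'v \<Rightarrow> bool) \<Rightarrow> bool" where
  "ordered_vector_space_on V leq \<longleftrightarrow>
     subspace V \<and>
     (\<forall>x\<in>V. leq x x) \<and>
     (\<forall>x\<in>V. \<forall>y\<in>V. \<forall>z\<in>V. leq x y \<longrightarrow> leq y z \<longrightarrow> leq x z) \<and>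
     (\<forall>x\<in>V. \<forall>y\<in>V. leq x y \<longrightarrow> leq y x \<longrightarrow> x = y) \<and>
     (\<forall>x\<in>V. \<forall>y\<in>V. \<forall>z\<in>V. leq x y \<longrightarrow> leq (x + z) (y + z)) \<and>
     (\<forall>x\<in>V. \<forall>y\<in>V. \<forall>c\<ge>0. leq x y \<longrightarrow> leq (c *\<^sub>R x) (c *\<^sub>R y))"

text \<open>Locally convex Hausdorff topological vector spaces.\<close>

definition lc_tvs_on :: "'e::real_vector set \<Rightarrow> 'e topology \<Rightarrow> bool" where
  "lc_tvs_on E T \<longleftrightarrow>
     subspace E \<and> topspace T = E \<and>
     continuous_map (prod_topology T T) T (\<lambda>(x, y). x + y) \<and>
     continuous_map (prod_topology euclideanreal T) T (\<lambda>(c, x). c *\<^sub>R x) \<and>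
     neighbourhood_base_of convex T \<and>
     Hausdorff_space T"

definition top_dual :: "'e::real_vector set \<Rightarrow> 'e topology \<Rightarrow> ('e \<Rightarrow> real) set" where
  "top_dual E T = {\<phi>. linear_on E \<phi> \<and> continuous_map T euclideanreal \<phi>}"

definition weak_topology :: "'e::real_vector set \<Rightarrow> 'e topology \<Rightarrow> 'e topology" where
  "weak_topology E T =
     topology_generated_by {{x \<in> E. \<phi> x \<in> U} |\<phi> U. \<phi> \<in> top_dual E T \<and> open U}"

text \<open>
  The uniform structure of a vector space topology: the entourages are the supersets of
  \<open>{(x, y). y - x \<in> N}\<close> for neighbourhoods \<open>N\<close> of \<open>0\<close>.
\<close>

definition tvs_uniformity :: "'e::real_vector topology \<Rightarrow> ('e \<times> 'e) filter" where
  "tvs_uniformity T = filtercomap (\<lambda>(x, y). y - x) (nhdsin T 0)"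

text \<open>Completeness of a subset: every Cauchy filter on it converges to one of its points.\<close>

definition tvs_complete :: "'e::real_vector topology \<Rightarrow> 'e set \<Rightarrow> bool" where
  "tvs_complete T C \<longleftrightarrow>
     (\<forall>F. F \<noteq> bot \<longrightarrow> F \<le> principal C \<longrightarrow> F \<times>\<^sub>F F \<le> tvs_uniformity T \<longrightarrow>
        (\<exists>x\<in>C. limitin T (\<lambda>y. y) x F))"

definition tvs_bounded :: "'e::real_vector topology \<Rightarrow> 'e set \<Rightarrow> bool" where
  "tvs_bounded T B \<longleftrightarrow>
     (\<forall>U. openin T U \<and> 0 \<in> U \<longrightarrow> (\<exists>r>0. \<forall>c. \<bar>c\<bar> \<ge> r \<longrightarrow> B \<subseteq> (\<lambda>x. c *\<^sub>R x) ` U))"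

definition proper_convex_cone :: "'e::real_vector set \<Rightarrow> bool" where
  "proper_convex_cone C \<longleftrightarrow> convex_cone C \<and> C \<inter> uminus ` C = {0}"

definition weakly_complete :: "'e::real_vector set \<Rightarrow> 'e topology \<Rightarrow> 'e set \<Rightarrow> bool" where
  "weakly_complete E T C \<longleftrightarrow> tvs_complete (weak_topology E T) C"


section \<open>Representations\<close>

definition linear_rep ::
    "('g, 'm) monoid_scheme \<Rightarrow> 'v::real_vector set \<Rightarrow> ('g \<Rightarrow> 'v \<Rightarrow> 'v) \<Rightarrow> bool" where
  "linear_rep G V \<rho> \<longleftrightarrow> group_action G V \<rho> \<and> (\<forall>g\<in>carrier G. linear_on V (\<rho> g))"

definition ordered_rep ::
    "('g, 'm) monoid_scheme \<Rightarrow> 'v::real_vector set \<Rightarrow> ('v \<Rightarrow> 'v \<Rightarrow> bool) \<Rightarrow> ('g \<Rightarrow> 'v \<Rightarrow> 'v) \<Rightarrow> bool"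
  where
  "ordered_rep G V leq \<rho> \<longleftrightarrow>
     linear_rep G V \<rho> \<and>
     (\<forall>g\<in>carrier G. \<forall>x\<in>V. \<forall>y\<in>V. leq x y \<longrightarrow> leq (\<rho> g x) (\<rho> g y))"

definition cone_rep ::
    "('g, 'm) monoid_scheme \<Rightarrow> 'e::real_vector set \<Rightarrow> 'e topology \<Rightarrow> 'e set \<Rightarrow> ('g \<Rightarrow> 'e \<Rightarrow> 'e) \<Rightarrow> bool"
  where
  "cone_rep G E T C \<rho> \<longleftrightarrow>
     linear_rep G E \<rho> \<and>
     (\<forall>g\<in>carrier G. continuous_map T T (\<rho> g) \<and> \<rho> g ` C \<subseteq> C)"

text \<open>
  Domination is defined for an arbitrary action \<open>act\<close> and pre-order \<open>leq\<close>, so that it applies to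
  functions on the group as well as to the dual of a representation.
\<close>

definition G_dominates ::
    "('g, 'm) monoid_scheme \<Rightarrow> ('v::ab_group_add \<Rightarrow> 'v \<Rightarrow> bool) \<Rightarrow> ('g \<Rightarrow> 'v \<Rightarrow> 'v) \<Rightarrow> 'v \<Rightarrow> 'v \<Rightarrow> bool"
  where
  "G_dominates G leq act \<phi> \<psi> \<longleftrightarrow>
     (\<exists>(n::nat) g. (\<forall>i<n. g i \<in> carrier G) \<and>
        leq \<psi> (\<Sum>i<n. act (g i) \<phi>) \<and> leq (- \<psi>) (\<Sum>i<n. act (g i) \<phi>))"

definition dual_le :: "'e set \<Rightarrow> ('e \<Rightarrow> real) \<Rightarrow> ('e \<Rightarrow> real) \<Rightarrow> bool" where
  "dual_le C \<phi> \<psi> \<longleftrightarrow> (\<forall>c\<in>C. \<phi> c \<le> \<psi> c)"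

definition dual_act ::
    "('g, 'm) monoid_scheme \<Rightarrow> ('g \<Rightarrow> 'e \<Rightarrow> 'e) \<Rightarrow> 'g \<Rightarrow> ('e \<Rightarrow> real) \<Rightarrow> 'e \<Rightarrow> real" where
  "dual_act G \<rho> g \<phi> = (\<lambda>x. \<phi> (\<rho> (inv\<^bsub>G\<^esub> g) x))"

definition locally_bounded_type ::
    "('g, 'm) monoid_scheme \<Rightarrow> 'e::real_vector topology \<Rightarrow> 'e set \<Rightarrow> ('g \<Rightarrow> 'e \<Rightarrow> 'e) \<Rightarrow> bool" where
  "locally_bounded_type G T C \<rho> \<longleftrightarrow> (\<exists>x\<in>C. x \<noteq> 0 \<and> tvs_bounded T (orbit G \<rho> x))"

definition cobounded_type ::
    "('g, 'm) monoid_scheme \<Rightarrow> 'e::real_vector set \<Rightarrow> 'e topology \<Rightarrow> 'e set \<Rightarrow> ('g \<Rightarrow> 'e \<Rightarrow> 'e) \<Rightarrow> bool"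
  where
  "cobounded_type G E T C \<rho> \<longleftrightarrow>
     (\<exists>\<phi>\<in>top_dual E T. \<forall>\<psi>\<in>top_dual E T. G_dominates G (dual_le C) (dual_act G \<rho>) \<phi> \<psi>)"

text \<open>
  The next two properties quantify over the spaces inside the universe given by the type argument.
  Their unrestricted forms ask for them at every universe. For the equivalence with a property of
  \<open>G\<close> alone, one direction therefore concerns arbitrary type variables, and for the other
  direction a single universe, built from functions on \<open>G\<close>, is enough.
\<close>

definition fixed_point_property_for_cones ::
    "'e::real_vector itself \<Rightarrow> ('g, 'm) monoid_scheme \<Rightarrow> bool" where
  "fixed_point_property_for_cones (_ :: 'e itself) G \<longleftrightarrow>
     (\<forall>(E :: 'e set) T C \<rho>.
        lc_tvs_on E T \<and> C \<subseteq> E \<and> proper_convex_cone C \<and> weakly_complete E T C \<and>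
        cone_rep G E T C \<rho> \<and> locally_bounded_type G T C \<rho> \<and> cobounded_type G E T C \<rho> \<longrightarrow>
        (\<exists>x\<in>C. x \<noteq> 0 \<and> (\<forall>g\<in>carrier G. \<rho> g x = x)))"

definition abstract_translate_property ::
    "'v::real_vector itself \<Rightarrow> ('g, 'm) monoid_scheme \<Rightarrow> bool" where
  "abstract_translate_property (_ :: 'v itself) G \<longleftrightarrow>
     (\<forall>(V :: 'v set) leq \<rho> v.
        ordered_vector_space_on V leq \<and> ordered_rep G V leq \<rho> \<and> v \<in> V \<and> leq 0 v \<and>
        (\<exists>\<delta> :: 'v \<Rightarrow> real. linear_on V \<delta> \<and> (\<forall>x\<in>V. leq 0 x \<longrightarrow> 0 \<le> \<delta> x) \<and>
           \<delta> v \<noteq> 0 \<and> bounded (\<delta> ` orbit G \<rho> v)) \<longrightarrow>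
        (\<forall>(n::nat) (t :: nat \<Rightarrow> real) g.
           (\<forall>i<n. g i \<in> carrier G) \<and> leq 0 (\<Sum>i<n. t i *\<^sub>R \<rho> (g i) v) \<longrightarrow> 0 \<le> (\<Sum>i<n. t i)))"


section \<open>Functions on a group\<close>

text \<open>
  Functions on \<open>G\<close> are represented by functions vanishing off \<open>carrier G\<close>, so that the pointwise
  operations and the pointwise order of the function type are the ones of functions on \<open>G\<close>.
\<close>

definition functions_on :: "('g, 'm) monoid_scheme \<Rightarrow> ('g \<Rightarrow> real) set" where
  "functions_on G = {f. \<forall>x. x \<notin> carrier G \<longrightarrow> f x = 0}"

definition l_infty :: "('g, 'm) monoid_scheme \<Rightarrow> ('g \<Rightarrow> real) set" where
  "l_infty G = {f \<in> functions_on G. bounded (f ` carrier G)}"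

definition translate :: "('g, 'm) monoid_scheme \<Rightarrow> 'g \<Rightarrow> ('g \<Rightarrow> real) \<Rightarrow> 'g \<Rightarrow> real" where
  "translate G g f = (\<lambda>x. if x \<in> carrier G then f (inv\<^bsub>G\<^esub> g \<otimes>\<^bsub>G\<^esub> x) else 0)"

definition translate_property_for :: "('g, 'm) monoid_scheme \<Rightarrow> ('g \<Rightarrow> real) \<Rightarrow> bool" where
  "translate_property_for G f \<longleftrightarrow>
     (\<forall>(n::nat) (t :: nat \<Rightarrow> real) g.
        (\<forall>i<n. g i \<in> carrier G) \<and> 0 \<le> (\<Sum>i<n. t i *\<^sub>R translate G (g i) f) \<longrightarrow>
        0 \<le> (\<Sum>i<n. t i))"

definition translate_property :: "('g, 'm) monoid_scheme \<Rightarrow> bool" where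
  "translate_property G \<longleftrightarrow>
     (\<forall>f\<in>l_infty G. f \<noteq> 0 \<and> 0 \<le> f \<longrightarrow> translate_property_for G f)"

definition l_infty_dominated :: "('g, 'm) monoid_scheme \<Rightarrow> ('g \<Rightarrow> real) \<Rightarrow> ('g \<Rightarrow> real) set" where
  "l_infty_dominated G f = {h \<in> functions_on G. G_dominates G (\<le>) (translate G) f h}"

definition normalised_integral ::
    "('g, 'm) monoid_scheme \<Rightarrow> ('g \<Rightarrow> real) \<Rightarrow> (('g \<Rightarrow> real) \<Rightarrow> real) \<Rightarrow> bool" where
  "normalised_integral G f \<mu> \<longleftrightarrow>
     linear_on (l_infty_dominated G f) \<mu> \<and>
     (\<forall>h\<in>l_infty_dominated G f. 0 \<le> h \<longrightarrow> 0 \<le> \<mu> h) \<and>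
     (\<forall>g\<in>carrier G. \<forall>h\<in>l_infty_dominated G f. \<mu> (translate G g h) = \<mu> h) \<and>
     \<mu> f = 1"

definition l1_norm :: "('g, 'm) monoid_scheme \<Rightarrow> ('g \<Rightarrow> real) \<Rightarrow> real" where
  "l1_norm G h = (\<Sum>\<^sub>\<infinity>x\<in>carrier G. \<bar>h x\<bar>)"

definition reiter_property :: "('g, 'm) monoid_scheme \<Rightarrow> ('g \<Rightarrow> real) \<Rightarrow> bool" where
  "reiter_property G f \<longleftrightarrow>
     (\<forall>S \<epsilon>. finite S \<and> S \<subseteq> carrier G \<and> \<epsilon> > 0 \<longrightarrow>
        (\<exists>u\<in>functions_on G. finite {x. u x \<noteq> 0} \<and>
           (\<forall>s\<in>S. l1_norm G ((translate G s u - u) * f) < \<epsilon> * l1_norm G (u * f))))"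

end

theory Submission
  imports Defs
begin

text \<open>
  Four of the five properties are linked in a cycle: fixed points for cones, integrals, the
  translate property, the Reiter property, and back to fixed points. The abstract translate
  property is tied to the translate property directly, by looking at a positive functional along
  an orbit (\<open>abstract_of_translate_property\<close>) and, conversely, by evaluating functions at a point.

  From fixed points to integrals (\<open>integral_of_fixed_point_property\<close>): the positive linear forms
  on the functions dominated by \<open>f\<close> make up a weakly complete cone for the topology of pointwise
  convergence. Evaluation at a point of \<open>G\<close> has a bounded orbit, evaluation at \<open>f\<close> dominates the
  dual, and a non-zero fixed point is an integral up to scaling. An integral applied to
  \<open>\<Sum>i. t i g i f \<ge> 0\<close> gives \<open>\<Sum>i. t i \<ge> 0\<close>, which is the translate property.

  From the translate property to the Reiter property there are three ideas. First, \<open>G\<close> is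
  amenable. If the \<open>\<ell>\<^sup>2\<close> norms of a random walk \<open>p n\<close> with averaging operator \<open>P\<close> decayed
  geometrically, then for some \<open>l > 1\<close> the Green function \<open>F = \<Sum>n. l ^ n p n\<close> would be bounded and
  would satisfy \<open>F - l P F = p 0 \<ge> 0\<close>, a combination of translates of \<open>F\<close> with coefficient sum
  \<open>1 - l < 0\<close>. Hence the norms nearly stagnate at some time, and there the square of \<open>p n\<close> is
  almost invariant in \<open>\<ell>\<^sup>1\<close> (\<open>Reiter_of_translate_property\<close>). Second, the translate property for
  \<open>f\<close> is dual to the statement that for every finite set of translates of \<open>f\<close> there is a finitely
  supported \<open>u \<ge> 0\<close> whose pairing with each of them is nearly \<open>1\<close>
  (\<open>almost_normalised_functional\<close>). Third, convolving an almost invariant \<open>v\<close> with such a \<open>u\<close>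
  gives a function that is almost invariant for the norm weighted by \<open>f\<close>
  (\<open>weighted_Reiter_of_translate_property\<close>).

  From the Reiter property to fixed points (\<open>fixed_point_of_Reiter\<close>): let the orbit of \<open>x0\<close> be
  bounded, let \<open>\<phi>\<close> be a dominating functional and put \<open>f g = \<phi> (\<rho> g x0)\<close>. Almost
  invariant weights \<open>u\<close> for this \<open>f\<close> define points \<open>(\<Sum>g. u g \<rho> g x0) / \<Sum>g. u g f g\<close> of the cone on
  which every functional is bounded and almost invariant. Along an ultrafilter they are weakly
  Cauchy, and their limit is fixed because functionals separate points; it is non-zero because
  \<open>\<phi>\<close> has the value \<open>1\<close> at it.
\<close>

section \<open>The Hahn-Banach theorem\<close>

text \<open>
  Homogeneity is required only as an inequality, which is easier to check for infima; equality
  follows, see \<open>sublinear_scaleR\<close>.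
\<close>
definition sublinear :: "('a::real_vector \<Rightarrow> real) \<Rightarrow> bool" where
  "sublinear p \<longleftrightarrow> (\<forall>x y. p (x + y) \<le> p x + p y) \<and> (\<forall>c\<ge>0. \<forall>x. p (c *\<^sub>R x) \<le> c * p x)"

lemma sublinear_add: "sublinear p \<Longrightarrow> p (x + y) \<le> p x + p y"
  and sublinear_scaleR_le: "sublinear p \<Longrightarrow> 0 \<le> c \<Longrightarrow> p (c *\<^sub>R x) \<le> c * p x"
  by (auto simp: sublinear_def)

lemma sublinear_zero:
  assumes "sublinear p" shows "p 0 = 0"
  using sublinear_add[OF assms, of 0 0] sublinear_scaleR_le[OF assms, of 0 0] by simp

lemma sublinear_scaleR:
  assumes "sublinear p" "0 \<le> c" shows "p (c *\<^sub>R x) = c * p x"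
proof (cases "c = 0")
  case False
  then have "p x \<le> inverse c * p (c *\<^sub>R x)"
    using sublinear_scaleR_le[OF assms(1), of "inverse c" "c *\<^sub>R x"] assms(2) by simp
  then have "c * p x \<le> p (c *\<^sub>R x)"
    using False assms(2) by (simp add: field_simps)
  then show ?thesis
    using sublinear_scaleR_le[OF assms, of x] by simp
qed (simp add: sublinear_zero[OF assms(1)])

lemma sublinear_ge_uminus:
  assumes "sublinear p" shows "- p (- x) \<le> p x"
  using sublinear_add[OF assms, of x "- x"] by (simp add: sublinear_zero[OF assms])

text \<open>
  The largest sublinear functional below \<open>q\<close> whose value at \<open>- y\<close> is at most \<open>- q y\<close>. It serves
  twice: it shows that a minimal sublinear functional is additive, and it forces the value of a
  functional at a prescribed vector.
\<close>
definition tilt :: "('a::real_vector \<Rightarrow> real) \<Rightarrow> 'a \<Rightarrow> 'a \<Rightarrow> real" where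
  "tilt q y x = (INF t\<in>{0..}. q (x + t *\<^sub>R y) - t * q y)"

lemma tilt_le:
  assumes q: "sublinear q" and "0 \<le> t"
  shows "tilt q y x \<le> q (x + t *\<^sub>R y) - t * q y"
  unfolding tilt_def
proof (rule cINF_lower)
  show "bdd_below ((\<lambda>t. q (x + t *\<^sub>R y) - t * q y) ` {0..})"
  proof (rule bdd_belowI2)
    fix t :: real assume "t \<in> {0..}"
    then have "t * q y = q ((x + t *\<^sub>R y) + (- x))"
      using sublinear_scaleR[OF q] by simp
    also have "\<dots> \<le> q (x + t *\<^sub>R y) + q (- x)"
      by (rule sublinear_add[OF q])
    finally show "- q (- x) \<le> q (x + t *\<^sub>R y) - t * q y" by simp
  qed
qed (use assms in auto)

lemma tilt_greatest:
  assumes "\<And>t. 0 \<le> t \<Longrightarrow> c \<le> q (x + t *\<^sub>R y) - t * q y"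
  shows "c \<le> tilt q y x"
  unfolding tilt_def by (rule cINF_greatest) (use assms in auto)

lemma tilt_below: "sublinear q \<Longrightarrow> tilt q y x \<le> q x"
  using tilt_le[of q 0 y x] by simp

lemma tilt_uminus: "sublinear q \<Longrightarrow> tilt q y (- y) \<le> - q y"
  using tilt_le[of q 1 y "- y"] by (simp add: sublinear_zero)

lemma sublinear_tilt:
  assumes q: "sublinear q" shows "sublinear (tilt q y)"
  unfolding sublinear_def
proof (intro conjI allI impI)
  fix a b
  have "tilt q y (a + b) - tilt q y b \<le> tilt q y a"
  proof (rule tilt_greatest)
    fix s :: real assume s: "0 \<le> s"
    have "tilt q y (a + b) - (q (a + s *\<^sub>R y) - s * q y) \<le> tilt q y b"
    proof (rule tilt_greatest)
      fix t :: real assume t: "0 \<le> t"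
      have "tilt q y (a + b) \<le> q (a + b + (s + t) *\<^sub>R y) - (s + t) * q y"
        by (rule tilt_le[OF q]) (use s t in simp)
      also have "a + b + (s + t) *\<^sub>R y = (a + s *\<^sub>R y) + (b + t *\<^sub>R y)"
        by (simp add: scaleR_add_left)
      also have "q \<dots> \<le> q (a + s *\<^sub>R y) + q (b + t *\<^sub>R y)"
        by (rule sublinear_add[OF q])
      finally show "tilt q y (a + b) - (q (a + s *\<^sub>R y) - s * q y) \<le> q (b + t *\<^sub>R y) - t * q y"
        by (simp add: algebra_simps)
    qed
    then show "tilt q y (a + b) - tilt q y b \<le> q (a + s *\<^sub>R y) - s * q y" by simp
  qed
  then show "tilt q y (a + b) \<le> tilt q y a + tilt q y b" by simp
next
  fix c :: real and a assume c: "0 \<le> c"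
  show "tilt q y (c *\<^sub>R a) \<le> c * tilt q y a"
  proof (cases "c = 0")
    case True
    then show ?thesis using tilt_le[OF q, of 0 y 0] by (simp add: sublinear_zero[OF q])
  next
    case False
    have "tilt q y (c *\<^sub>R a) / c \<le> tilt q y a"
    proof (rule tilt_greatest)
      fix t :: real assume t: "0 \<le> t"
      have "tilt q y (c *\<^sub>R a) \<le> q (c *\<^sub>R a + (c * t) *\<^sub>R y) - (c * t) * q y"
        by (rule tilt_le[OF q]) (use c t in simp)
      also have "q (c *\<^sub>R a + (c * t) *\<^sub>R y) = c * q (a + t *\<^sub>R y)"
        using sublinear_scaleR[OF q c, of "a + t *\<^sub>R y"] by (simp add: scaleR_add_right)
      finally show "tilt q y (c *\<^sub>R a) / c \<le> q (a + t *\<^sub>R y) - t * q y"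
        using c False by (simp add: field_simps)
    qed
    then show ?thesis using c False by (simp add: field_simps)
  qed
qed

text \<open>
  Zorn's lemma. The pointwise infimum of a chain is finite because every member is bounded below
  by \<open>\<lambda>x. - p (- x)\<close>, and it is subadditive because two members of a chain can be replaced by the
  smaller of them.
\<close>
lemma minimal_sublinear_below:
  fixes p :: "'a::real_vector \<Rightarrow> real"
  assumes p: "sublinear p"
  obtains q where "sublinear q" "q \<le> p" "\<And>q'. sublinear q' \<Longrightarrow> q' \<le> q \<Longrightarrow> q' = q"
proof -
  let ?A = "{q. sublinear q \<and> q \<le> p}" and ?P = "\<lambda>q q' :: 'a \<Rightarrow> real. q' \<le> q"
  have "\<exists>m\<in>?A. \<forall>a\<in>?A. ?P m a \<longrightarrow> a = m"
  proof (rule predicate_Zorn)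
    show "partial_order_on ?A (relation_of ?P ?A)"
      by (rule partial_order_on_relation_ofI) auto
    fix C assume C: "C \<in> Chains (relation_of ?P ?A)"
    then have mem: "sublinear q \<and> q \<le> p" if "q \<in> C" for q
      using that by (auto simp: Chains_def relation_of_def)
    have chain: "q \<le> q' \<or> q' \<le> q" if "q \<in> C" "q' \<in> C" for q q'
      using that C by (auto simp: Chains_def relation_of_def)
    show "\<exists>u\<in>?A. \<forall>a\<in>C. ?P a u"
    proof (cases "C = {}")
      case False
      define c where "c x = (INF q\<in>C. q x)" for x
      have lower: "c x \<le> q x" if q: "q \<in> C" for q x
        unfolding c_def
      proof (rule cINF_lower)
        show "bdd_below ((\<lambda>q. q x) ` C)"
        proof (rule bdd_belowI2)
          fix q assume "q \<in> C"
          then show "- p (- x) \<le> q x"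
            using mem[of q] sublinear_ge_uminus[of q x] by (smt (verit) le_funD)
        qed
      qed (rule q)
      have greatest: "d \<le> c x" if "\<And>q. q \<in> C \<Longrightarrow> d \<le> q x" for d x
        unfolding c_def by (rule cINF_greatest[OF False]) (use that in auto)
      have "sublinear c"
        unfolding sublinear_def
      proof (intro conjI allI impI)
        fix x y
        have "c (x + y) - c y \<le> c x"
        proof (rule greatest)
          fix q assume q: "q \<in> C"
          have "c (x + y) - q x \<le> c y"
          proof (rule greatest)
            fix q' assume q': "q' \<in> C"
            consider "q \<le> q'" | "q' \<le> q" using chain[OF q q'] by blast
            then show "c (x + y) - q x \<le> q' y"
            proof cases
              case 1
              then show ?thesis
                using lower[OF q, of "x + y"] sublinear_add[of q x y] mem[OF q] le_funD[OF 1, of y]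
                by linarith
            next
              case 2
              then show ?thesis
                using lower[OF q', of "x + y"] sublinear_add[of q' x y] mem[OF q'] le_funD[OF 2, of x]
                by linarith
            qed
          qed
          then show "c (x + y) - c y \<le> q x" by simp
        qed
        then show "c (x + y) \<le> c x + c y" by simp
      next
        fix r :: real and x assume r: "0 \<le> r"
        obtain q where q: "q \<in> C" using False by blast
        show "c (r *\<^sub>R x) \<le> r * c x"
        proof (cases "r = 0")
          case True
          then show ?thesis using lower[OF q, of 0] sublinear_zero[of q] mem[OF q] by simp
        next
          case False
          have "c (r *\<^sub>R x) / r \<le> c x"
          proof (rule greatest)
            fix q assume q: "q \<in> C"
            show "c (r *\<^sub>R x) / r \<le> q x"
              using lower[OF q, of "r *\<^sub>R x"] sublinear_scaleR[of q r x] mem[OF q] r False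
              by (simp add: field_simps)
          qed
          then show ?thesis using r False by (simp add: field_simps)
        qed
      qed
      moreover have "c \<le> p"
        using False lower mem by (metis (no_types, lifting) equals0I le_fun_def order_trans)
      ultimately show ?thesis
        using lower by (intro bexI[of _ c]) (auto simp: le_fun_def)
    qed (use p in auto)
  qed
  then obtain q where "sublinear q" "q \<le> p" "\<forall>a\<in>?A. a \<le> q \<longrightarrow> a = q" by auto
  then show ?thesis
    by (metis (mono_tags, lifting) mem_Collect_eq order_trans that)
qed

text \<open>
  A minimal sublinear functional \<open>q\<close> equals all its tilts, so \<open>q x \<le> q (x + y) - q y\<close>; together
  with subadditivity this makes it linear. Starting from the tilt of \<open>p\<close> at \<open>z\<close> instead of \<open>p\<close>
  fixes the value at \<open>z\<close>.
\<close>
theorem Hahn_Banach: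
  fixes p :: "'a::real_vector \<Rightarrow> real"
  assumes p: "sublinear p"
  obtains l where "linear l" "\<And>x. l x \<le> p x" "l z = p z"
proof -
  obtain q where q: "sublinear q" "q \<le> tilt p z"
    and min: "\<And>q'. sublinear q' \<Longrightarrow> q' \<le> q \<Longrightarrow> q' = q"
    using minimal_sublinear_below[OF sublinear_tilt[OF p]] by metis
  have le: "q x \<le> p x" for x
    using q(2) tilt_below[OF p, of z x] by (meson le_funD order_trans)
  have tilt_q: "tilt q y = q" for y
    by (rule min) (auto simp: sublinear_tilt q le_fun_def tilt_below)
  have super: "q x + q y \<le> q (x + y)" for x y
    using tilt_le[OF q(1), of 1 y x] by (simp add: tilt_q)
  have add: "q (x + y) = q x + q y" for x y
    using super[of x y] sublinear_add[OF q(1), of x y] by simp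
  have neg: "q (- x) = - q x" for x
    using add[of x "- x"] by (simp add: sublinear_zero[OF q(1)])
  have "linear q"
  proof (rule linearI)
    fix r :: real and x
    show "q (r *\<^sub>R x) = r *\<^sub>R q x"
    proof (cases "0 \<le> r")
      case False
      then have "q ((- r) *\<^sub>R x) = - r * q x" by (intro sublinear_scaleR[OF q(1)]) simp
      then show ?thesis by (simp add: neg)
    qed (simp add: sublinear_scaleR[OF q(1)])
  qed (rule add)
  moreover have "q z = p z"
    using le[of z] le_funD[OF q(2), of "- z"] tilt_uminus[OF p, of z] by (simp add: neg)
  ultimately show ?thesis using le that by blast
qed

section \<open>Ultrafilters\<close>

text \<open>
  A minimal proper filter below \<open>F\<close> decides every predicate \<open>P\<close>: if it does not contain the
  complement of \<open>P\<close>, then restricting it to \<open>P\<close> leaves it proper, hence unchanged.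
\<close>
lemma ultrafilter_below:
  fixes F :: "'a filter"
  assumes "F \<noteq> bot"
  obtains U where "U \<le> F" "U \<noteq> bot" "\<And>P. eventually P U \<or> eventually (\<lambda>x. \<not> P x) U"
proof -
  let ?A = "{U. U \<le> F \<and> U \<noteq> bot}" and ?P = "\<lambda>U V :: 'a filter. V \<le> U"
  have "\<exists>m\<in>?A. \<forall>a\<in>?A. ?P m a \<longrightarrow> a = m"
  proof (rule predicate_Zorn)
    show "partial_order_on ?A (relation_of ?P ?A)"
      by (rule partial_order_on_relation_ofI) auto
    fix C assume C: "C \<in> Chains (relation_of ?P ?A)"
    then have mem: "U \<le> F \<and> U \<noteq> bot" if "U \<in> C" for U
      using that by (auto simp: Chains_def relation_of_def)
    have chain: "U \<le> V \<or> V \<le> U" if "U \<in> C" "V \<in> C" for U V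
      using that C by (auto simp: Chains_def relation_of_def)
    show "\<exists>u\<in>?A. \<forall>a\<in>C. ?P a u"
    proof (cases "C = {}")
      case False
      have "Inf X \<in> C" if "finite X" "X \<noteq> {}" "X \<subseteq> C" for X
        using that
      proof (induction X rule: finite_ne_induct)
        case (insert x X)
        then have "Inf X \<in> C" "x \<in> C" by auto
        then have "inf x (Inf X) \<in> C" using chain[of x "Inf X"] by (metis inf.absorb1 inf.absorb2)
          then show ?case by simp
      qed simp
      then have *: "Inf X \<noteq> bot" if "finite X" "X \<noteq> {}" "X \<subseteq> C" for X
        using that mem by blast
      have "Inf X \<noteq> bot" if "X \<subseteq> C" "finite X" for X
      proof (cases "X = {}")
        case True
        have "(top_class.top :: 'a filter) \<noteq> bot"
          using assms by (metis bot.extremum_uniqueI top_greatest)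
        then show ?thesis using True by simp
      qed (use * that in blast)
      then have "Inf C \<noteq> bot" by (rule Inf_filter_not_bot)
      moreover have "Inf C \<le> F"
        using False mem by (meson Inf_lower2 all_not_in_conv)
      ultimately show ?thesis by (metis (mono_tags, lifting) Inf_lower mem_Collect_eq)
    qed (use assms in auto)
  qed
  then obtain U where U: "U \<le> F" "U \<noteq> bot" and min: "\<And>V. V \<le> F \<Longrightarrow> V \<noteq> bot \<Longrightarrow> V \<le> U \<Longrightarrow> V = U"
    by (metis (mono_tags, lifting) mem_Collect_eq)
  have "eventually P U \<or> eventually (\<lambda>x. \<not> P x) U" for P
  proof (rule disjCI)
    assume *: "\<not> eventually (\<lambda>x. \<not> P x) U"
    have "inf U (principal {x. P x}) \<noteq> bot"
      using * unfolding trivial_limit_def eventually_inf_principal by simp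
    moreover have "inf U (principal {x. P x}) \<le> F"
      using U(1) by (rule le_infI1)
    ultimately have "inf U (principal {x. P x}) = U"
      using min inf_le1 by blast
    then have "U \<le> principal {x. P x}" by (metis inf_le2)
    then show "eventually P U" by (simp add: le_principal)
  qed
  then show ?thesis by (rule that[OF U])
qed

text \<open>
  Compactness of an interval gives a cluster point, and a cluster point of an ultrafilter is a
  limit.
\<close>
lemma ultrafilter_bounded_convergent:
  fixes a :: "'a \<Rightarrow> real"
  assumes U: "U \<noteq> bot" "\<And>P. eventually P U \<or> eventually (\<lambda>x. \<not> P x) U"
    and b: "eventually (\<lambda>x. \<bar>a x\<bar> \<le> M) U"
  obtains l where "(a \<longlongrightarrow> l) U"
proof -
  have "eventually (\<lambda>y. y \<in> {-M..M}) (filtermap a U)"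
    using b by (auto simp: eventually_filtermap elim!: eventually_mono)
  moreover have "filtermap a U \<noteq> bot" using U(1) by (simp add: filtermap_bot_iff)
  ultimately obtain l where l: "inf (nhds l) (filtermap a U) \<noteq> bot"
    using compact_Icc[of "-M" M] unfolding compact_filter by blast
  have "(a \<longlongrightarrow> l) U"
    unfolding tendsto_def
  proof (intro allI impI, rule ccontr)
    fix S assume S: "open S" "l \<in> S" and "\<not> eventually (\<lambda>x. a x \<in> S) U"
    then have "eventually (\<lambda>x. a x \<notin> S) U" using U(2) by blast
    then have "eventually (\<lambda>y. y \<notin> S) (filtermap a U)" by (simp add: eventually_filtermap)
    moreover have "eventually (\<lambda>y. y \<in> S) (nhds l)" using S by (rule eventually_nhds_in_open)
    ultimately have "eventually (\<lambda>y. False) (inf (nhds l) (filtermap a U))"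
      unfolding eventually_inf by blast
    then show False using l by (simp add: trivial_limit_def)
  qed
  then show ?thesis by (rule that)
qed

section \<open>Separation in finitely many coordinates\<close>

lemma sum_fun_apply [simp]: "sum f I x = (\<Sum>i\<in>I. f i x)" for f :: "'i \<Rightarrow> 'a \<Rightarrow> real"
  by (induction I rule: infinite_finite_induct) auto

text \<open>
  The bipolar theorem in \<open>\<real>\<^sup>B\<close> for finite \<open>B\<close>: a point at which every functional that is
  nonnegative on the cone \<open>K\<close> is nonnegative lies in the closure of \<open>K\<close>. The sublinear functional
  \<open>p\<close> of the proof is the \<open>\<ell>\<^sup>1\<close> distance to \<open>- K\<close>. A linear functional below it is nonnegative on
  \<open>K\<close> and sees only the coordinates in \<open>B\<close>; if it takes the value \<open>p (- a)\<close> at \<open>- a\<close>, the duality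
  hypothesis forces \<open>p (- a) \<le> 0\<close>.
\<close>
lemma cone_approximation:
  fixes K :: "('b \<Rightarrow> real) set"
  assumes B: "finite B" and zero: "0 \<in> K"
    and add: "\<And>k k'. k \<in> K \<Longrightarrow> k' \<in> K \<Longrightarrow> k + k' \<in> K"
    and scale: "\<And>c k. 0 \<le> c \<Longrightarrow> k \<in> K \<Longrightarrow> c *\<^sub>R k \<in> K"
    and dual: "\<And>t. (\<And>k. k \<in> K \<Longrightarrow> 0 \<le> (\<Sum>x\<in>B. t x * k x)) \<Longrightarrow> 0 \<le> (\<Sum>x\<in>B. t x * a x)"
    and "0 < \<delta>"
  obtains k where "k \<in> K" "(\<Sum>x\<in>B. \<bar>k x - a x\<bar>) < \<delta>"
proof -
  define p where "p b = (INF k\<in>K. \<Sum>x\<in>B. \<bar>b x + k x\<bar>)" for b :: "'b \<Rightarrow> real"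
  have lower: "p b \<le> (\<Sum>x\<in>B. \<bar>b x + k x\<bar>)" if "k \<in> K" for b k
    unfolding p_def by (rule cINF_lower) (use that in \<open>auto intro!: bdd_belowI2[of _ 0] sum_nonneg\<close>)
  have greatest: "d \<le> p b" if "\<And>k. k \<in> K \<Longrightarrow> d \<le> (\<Sum>x\<in>B. \<bar>b x + k x\<bar>)" for b d
    unfolding p_def by (rule cINF_greatest) (use that zero in auto)
  have "sublinear p"
    unfolding sublinear_def
  proof (intro conjI allI impI)
    fix b b'
    have "p (b + b') - p b' \<le> p b"
    proof (rule greatest)
      fix k assume k: "k \<in> K"
      have "p (b + b') - (\<Sum>x\<in>B. \<bar>b x + k x\<bar>) \<le> p b'"
      proof (rule greatest)
        fix k' assume k': "k' \<in> K"
        have "p (b + b') \<le> (\<Sum>x\<in>B. \<bar>(b + b') x + (k + k') x\<bar>)"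
          by (rule lower[OF add[OF k k']])
        also have "\<dots> \<le> (\<Sum>x\<in>B. \<bar>b x + k x\<bar> + \<bar>b' x + k' x\<bar>)"
          by (rule sum_mono) auto
        finally show "p (b + b') - (\<Sum>x\<in>B. \<bar>b x + k x\<bar>) \<le> (\<Sum>x\<in>B. \<bar>b' x + k' x\<bar>)"
          by (simp add: sum.distrib)
      qed
      then show "p (b + b') - p b' \<le> (\<Sum>x\<in>B. \<bar>b x + k x\<bar>)" by simp
    qed
    then show "p (b + b') \<le> p b + p b'" by simp
  next
    fix c :: real and b assume c: "0 \<le> c"
    show "p (c *\<^sub>R b) \<le> c * p b"
    proof (cases "c = 0")
      case True
      then show ?thesis using lower[OF zero, of "0 *\<^sub>R b"] by simp
    next
      case False
      have "p (c *\<^sub>R b) / c \<le> p b"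
      proof (rule greatest)
        fix k assume k: "k \<in> K"
        have "p (c *\<^sub>R b) \<le> (\<Sum>x\<in>B. \<bar>(c *\<^sub>R b) x + (c *\<^sub>R k) x\<bar>)"
          by (rule lower[OF scale[OF c k]])
        also have "\<dots> = (\<Sum>x\<in>B. c * \<bar>b x + k x\<bar>)"
          using c by (intro sum.cong) (auto simp: abs_mult simp flip: distrib_left)
        finally show "p (c *\<^sub>R b) / c \<le> (\<Sum>x\<in>B. \<bar>b x + k x\<bar>)"
          using c False by (simp add: field_simps flip: sum_distrib_left)
      qed
      then show ?thesis using c False by (simp add: field_simps)
    qed
  qed
  then obtain l where l: "linear l" "\<And>b. l b \<le> p b" "l (- a) = p (- a)"
    using Hahn_Banach by blast
  have le: "l b \<le> (\<Sum>x\<in>B. \<bar>b x\<bar>)" for b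
    using l(2)[of b] lower[OF zero, of b] by simp
  define e where "e x = (\<lambda>y. if y = x then 1 else 0 :: real)" for x :: 'b
  have rep: "l b = (\<Sum>x\<in>B. l (e x) * b x)" for b
  proof -
    let ?c = "b - (\<Sum>x\<in>B. b x *\<^sub>R e x)"
    have "?c y = 0" if "y \<in> B" for y
    proof -
      have "(\<Sum>x\<in>B. b x *\<^sub>R e x) y = (\<Sum>x\<in>B. if x = y then b x else 0)"
        unfolding sum_fun_apply by (rule sum.cong) (auto simp: e_def)
      then show ?thesis using B that by simp
    qed
    then have "l ?c \<le> 0" "l (- ?c) \<le> 0"
      using le[of ?c] le[of "- ?c"] by auto
    then have "l ?c = 0" using linear_neg[OF l(1), of ?c] by simp
    then show ?thesis
      by (simp add: linear_diff[OF l(1)] linear_sum[OF l(1)] linear_cmul[OF l(1)] mult.commute)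
  qed
  have "0 \<le> l a"
    unfolding rep[of a]
  proof (rule dual)
    fix k assume k: "k \<in> K"
    have "l (- k) \<le> 0" using l(2)[of "- k"] lower[OF k, of "- k"] by simp
    then show "0 \<le> (\<Sum>x\<in>B. l (e x) * k x)"
      using rep[of k] linear_neg[OF l(1), of k] by simp
  qed
  then have "p (- a) < \<delta>"
    using l(3) linear_neg[OF l(1), of a] \<open>0 < \<delta>\<close> by simp
  then obtain k where "k \<in> K" "(\<Sum>x\<in>B. \<bar>(- a) x + k x\<bar>) < \<delta>"
    unfolding p_def using zero by (subst (asm) cINF_less_iff) (auto intro!: bdd_belowI2[of _ 0] sum_nonneg)
  then show ?thesis by (intro that[of k]) (auto simp: algebra_simps)
qed

section \<open>Finitely supported functions and translation\<close>

definition finitely_supported :: "('g, 'm) monoid_scheme \<Rightarrow> ('g \<Rightarrow> real) set" where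
  "finitely_supported G = {u \<in> functions_on G. finite {x. u x \<noteq> 0}}"

definition pairing :: "('g \<Rightarrow> real) \<Rightarrow> ('g \<Rightarrow> real) \<Rightarrow> real" where
  "pairing u h = (\<Sum>x | u x \<noteq> 0. u x * h x)"

lemma pairing_superset:
  assumes "finite A" "{x. u x \<noteq> 0} \<subseteq> A"
  shows "pairing u h = (\<Sum>x\<in>A. u x * h x)"
  unfolding pairing_def by (rule sum.mono_neutral_left) (use assms in auto)

lemma finite_support: "u \<in> finitely_supported G \<Longrightarrow> finite {x. u x \<noteq> 0}"
  by (simp add: finitely_supported_def)

lemma support_subset: "u \<in> finitely_supported G \<Longrightarrow> {x. u x \<noteq> 0} \<subseteq> carrier G"
  by (auto simp: finitely_supported_def functions_on_def)

lemma finitely_supportedI: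
  "finite A \<Longrightarrow> A \<subseteq> carrier G \<Longrightarrow> (\<And>x. x \<notin> A \<Longrightarrow> u x = 0) \<Longrightarrow> u \<in> finitely_supported G"
  unfolding finitely_supported_def functions_on_def
  by (auto intro: finite_subset[of _ A])

lemma finitely_supported_pointwise:
  assumes "u \<in> finitely_supported G" "v \<in> finitely_supported G"
    and "\<And>x. u x = 0 \<Longrightarrow> v x = 0 \<Longrightarrow> w x = 0"
  shows "w \<in> finitely_supported G"
  by (rule finitely_supportedI[of "{x. u x \<noteq> 0} \<union> {x. v x \<noteq> 0}"])
    (use assms in \<open>auto simp: finitely_supported_def functions_on_def\<close>)

lemma finitely_supported_zero [simp]: "0 \<in> finitely_supported G"
  by (rule finitely_supportedI[of "{}"]) auto

lemma finitely_supported_add [intro]: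
  "u \<in> finitely_supported G \<Longrightarrow> v \<in> finitely_supported G \<Longrightarrow> u + v \<in> finitely_supported G"
  by (rule finitely_supported_pointwise[of u G v]) auto

lemma finitely_supported_diff [intro]:
  "u \<in> finitely_supported G \<Longrightarrow> v \<in> finitely_supported G \<Longrightarrow> u - v \<in> finitely_supported G"
  by (rule finitely_supported_pointwise[of u G v]) auto

lemma finitely_supported_scaleR [intro]:
  "u \<in> finitely_supported G \<Longrightarrow> c *\<^sub>R u \<in> finitely_supported G"
  by (rule finitely_supported_pointwise[of u G u]) auto

lemma finitely_supported_abs [intro]:
  "u \<in> finitely_supported G \<Longrightarrow> (\<lambda>x. \<bar>u x\<bar>) \<in> finitely_supported G"
  by (rule finitely_supported_pointwise[of u G u]) auto

lemma finitely_supported_sum: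
  "(\<And>i. i \<in> I \<Longrightarrow> u i \<in> finitely_supported G) \<Longrightarrow> sum u I \<in> finitely_supported G"
  by (induction I rule: infinite_finite_induct) auto

lemma pairing_add_left:
  assumes "u \<in> finitely_supported G" "v \<in> finitely_supported G"
  shows "pairing (u + v) h = pairing u h + pairing v h"
proof -
  let ?A = "{x. u x \<noteq> 0} \<union> {x. v x \<noteq> 0}"
  have "finite ?A" using assms finite_support by auto
  then have "pairing w h = (\<Sum>x\<in>?A. w x * h x)" if "w = u \<or> w = v \<or> w = u + v" for w
    using that by (intro pairing_superset) auto
  then show ?thesis by (simp add: sum.distrib algebra_simps)
qed

lemma pairing_scaleR_left: "pairing (c *\<^sub>R u) h = c * pairing u h"
  by (cases "c = 0") (simp_all add: pairing_def sum_distrib_left mult.assoc)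

lemma pairing_diff_left:
  assumes "u \<in> finitely_supported G" "v \<in> finitely_supported G"
  shows "pairing (u - v) h = pairing u h - pairing v h"
  using pairing_add_left[OF finitely_supported_diff[OF assms] assms(2), of h] by simp

lemma pairing_zero_left [simp]: "pairing 0 h = 0"
  by (simp add: pairing_def)

lemma pairing_sum_left:
  assumes "\<And>i. i \<in> I \<Longrightarrow> u i \<in> finitely_supported G"
  shows "pairing (sum u I) h = (\<Sum>i\<in>I. pairing (u i) h)"
  using assms
proof (induction I rule: infinite_finite_induct)
  case (insert i I)
  have IH: "pairing (sum u I) h = (\<Sum>i\<in>I. pairing (u i) h)"
    using insert.IH insert.prems by blast
  have "sum u I \<in> finitely_supported G"
    using finitely_supported_sum insert.prems by blast
  then have "pairing (u i + sum u I) h = pairing (u i) h + pairing (sum u I) h"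
    using insert.prems by (intro pairing_add_left) auto
  then show ?case
    unfolding sum.insert[OF insert.hyps] IH .
qed auto

lemma pairing_add_right: "pairing u (h + k) = pairing u h + pairing u k"
  by (simp add: pairing_def sum.distrib algebra_simps)

lemma pairing_scaleR_right: "pairing u (c *\<^sub>R h) = c * pairing u h"
  by (simp add: pairing_def sum_distrib_left mult_ac)

lemma pairing_diff_right: "pairing u (h - k) = pairing u h - pairing u k"
  by (simp add: pairing_def sum_subtractf algebra_simps)

lemma pairing_sum_right: "pairing u (sum h I) = (\<Sum>i\<in>I. pairing u (h i))"
  unfolding pairing_def sum_fun_apply sum_distrib_left by (rule sum.swap)

lemma pairing_commute:
  assumes "u \<in> finitely_supported G" "v \<in> finitely_supported G"
  shows "pairing u v = pairing v u"
proof -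
  let ?A = "{x. u x \<noteq> 0} \<union> {x. v x \<noteq> 0}"
  have "finite ?A" using assms finite_support by auto
  then have "pairing u v = (\<Sum>x\<in>?A. u x * v x)" "pairing v u = (\<Sum>x\<in>?A. v x * u x)"
    by (intro pairing_superset; auto)+
  then show ?thesis by (simp add: mult.commute)
qed

lemma pairing_nonneg: "(\<And>x. 0 \<le> u x) \<Longrightarrow> (\<And>x. 0 \<le> h x) \<Longrightarrow> 0 \<le> pairing u h"
  unfolding pairing_def by (rule sum_nonneg) simp

lemma pairing_mono_right:
  assumes "\<And>x. 0 \<le> u x" "\<And>x. h x \<le> k x"
  shows "pairing u h \<le> pairing u k"
  unfolding pairing_def by (rule sum_mono) (simp add: assms mult_left_mono)

lemma pairing_mono_left:
  assumes "u \<in> finitely_supported G" "v \<in> finitely_supported G"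
    and "\<And>x. u x \<le> v x" "\<And>x. 0 \<le> h x"
  shows "pairing u h \<le> pairing v h"
proof -
  have "pairing v h - pairing u h = (\<Sum>x | (v - u) x \<noteq> 0. (v - u) x * h x)"
    using pairing_diff_left[OF assms(2,1), of h] by (simp add: pairing_def)
  also have "\<dots> \<ge> 0" by (rule sum_nonneg) (simp add: assms)
  finally show ?thesis by simp
qed

lemma abs_pairing_le: "\<bar>pairing u h\<bar> \<le> pairing (\<lambda>x. \<bar>u x\<bar>) (\<lambda>x. \<bar>h x\<bar>)"
  unfolding pairing_def by (rule order_trans[OF sum_abs]) (simp add: abs_mult)

text \<open>
  Weighted \<open>\<ell>\<^sup>1\<close> norms of finitely supported functions become finite sums that are bilinear in
  the weight and the function, and only these are used from here on.
\<close>
lemma l1_norm_eq_pairing: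
  assumes "u \<in> finitely_supported G"
  shows "l1_norm G (u * f) = pairing (\<lambda>x. \<bar>u x\<bar>) (\<lambda>x. \<bar>f x\<bar>)"
proof -
  have "l1_norm G (u * f) = (\<Sum>\<^sub>\<infinity>x\<in>{x. u x \<noteq> 0}. \<bar>u x\<bar> * \<bar>f x\<bar>)"
    unfolding l1_norm_def
    by (rule infsum_cong_neutral) (use support_subset[OF assms] in \<open>auto simp: abs_mult\<close>)
  then show ?thesis
    using finite_support[OF assms] by (simp add: pairing_def)
qed

lemma translate_apply: "x \<in> carrier G \<Longrightarrow> translate G g f x = f (inv\<^bsub>G\<^esub> g \<otimes>\<^bsub>G\<^esub> x)"
  by (simp add: translate_def)

lemma translate_functions_on [simp]: "translate G g f \<in> functions_on G"
  by (simp add: translate_def functions_on_def)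

lemma translate_add: "translate G g (u + v) = translate G g u + translate G g v"
  by (auto simp: translate_def fun_eq_iff)

lemma translate_diff: "translate G g (u - v) = translate G g u - translate G g v"
  by (auto simp: translate_def fun_eq_iff)

lemma translate_scaleR: "translate G g (c *\<^sub>R u) = c *\<^sub>R translate G g u"
  by (auto simp: translate_def fun_eq_iff)

lemma translate_sum: "translate G g (sum u I) = (\<Sum>i\<in>I. translate G g (u i))"
  by (auto simp: translate_def fun_eq_iff sum_fun_apply)

lemma translate_abs: "translate G g (\<lambda>x. \<bar>u x\<bar>) = (\<lambda>x. \<bar>translate G g u x\<bar>)"
  by (auto simp: translate_def fun_eq_iff)

lemma translate_mono: "u \<le> v \<Longrightarrow> translate G g u \<le> translate G g v"
  by (auto simp: translate_def le_fun_def)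

lemma translate_nonneg: "(\<And>x. 0 \<le> u x) \<Longrightarrow> 0 \<le> translate G g u x"
  by (simp add: translate_def)

context group
begin

lemma translate_translate:
  assumes "g \<in> carrier G" "h \<in> carrier G"
  shows "translate G g (translate G h f) = translate G (g \<otimes> h) f"
  using assms by (auto simp: translate_def fun_eq_iff inv_mult_group m_assoc)

lemma translate_one: "f \<in> functions_on G \<Longrightarrow> translate G \<one> f = f"
  by (auto simp: translate_def functions_on_def fun_eq_iff)

lemma support_translate:
  assumes "u \<in> finitely_supported G" "g \<in> carrier G"
  shows "{x. translate G g u x \<noteq> 0} = (\<otimes>) g ` {x. u x \<noteq> 0}"
proof
  show "{x. translate G g u x \<noteq> 0} \<subseteq> (\<otimes>) g ` {x. u x \<noteq> 0}"
  proof
    fix x assume "x \<in> {x. translate G g u x \<noteq> 0}"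
    then have "x \<in> carrier G" "u (inv g \<otimes> x) \<noteq> 0" by (auto simp: translate_def split: if_splits)
    moreover have "x = g \<otimes> (inv g \<otimes> x)" using calculation assms(2) by (simp add: m_assoc[symmetric])
    ultimately show "x \<in> (\<otimes>) g ` {x. u x \<noteq> 0}" by blast
  qed
  show "(\<otimes>) g ` {x. u x \<noteq> 0} \<subseteq> {x. translate G g u x \<noteq> 0}"
    using assms(2) support_subset[OF assms(1)] by (auto simp: translate_def m_assoc[symmetric])
qed

lemma inj_on_mult_support:
  assumes "u \<in> finitely_supported G" "g \<in> carrier G"
  shows "inj_on ((\<otimes>) g) {x. u x \<noteq> 0}"
  by (rule inj_on_subset[OF inj_on_cmult[OF assms(2)] support_subset[OF assms(1)]])

lemma finitely_supported_translate:
  assumes "u \<in> finitely_supported G" "g \<in> carrier G"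
  shows "translate G g u \<in> finitely_supported G"
  using support_translate[OF assms] finite_support[OF assms(1)]
  by (simp add: finitely_supported_def)

lemma pairing_translate:
  assumes u: "u \<in> finitely_supported G" and g: "g \<in> carrier G"
  shows "pairing (translate G g u) h = pairing u (translate G (inv g) h)"
proof -
  let ?A = "{x. u x \<noteq> 0}"
  have A: "finite ?A" "?A \<subseteq> carrier G" using finite_support[OF u] support_subset[OF u] by auto
  have "pairing (translate G g u) h = (\<Sum>x\<in>(\<otimes>) g ` ?A. translate G g u x * h x)"
    by (simp add: pairing_def support_translate[OF u g])
  also have "\<dots> = (\<Sum>x\<in>?A. translate G g u (g \<otimes> x) * h (g \<otimes> x))"
    by (simp add: sum.reindex[OF inj_on_mult_support[OF u g]])
  also have "\<dots> = pairing u (translate G (inv g) h)"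
    unfolding pairing_def
  proof (rule sum.cong)
    fix x assume "x \<in> ?A"
    then have "x \<in> carrier G" using A by blast
    then show "translate G g u (g \<otimes> x) * h (g \<otimes> x) = u x * translate G (inv g) h x"
      using g by (simp add: translate_def m_assoc[symmetric])
  qed simp
  finally show ?thesis .
qed

lemma pairing_translate_right:
  assumes u: "u \<in> finitely_supported G" and g: "g \<in> carrier G"
  shows "pairing u (translate G g h) = pairing (translate G (inv g) u) h"
  using pairing_translate[OF u, of "inv g" h] g by simp

end

section \<open>Amenability from the translate property\<close>

context group
begin

lemma translate_property_for_finite:
  assumes "translate_property_for G f" "finite B" "B \<subseteq> carrier G"
    and nonneg: "\<And>x. 0 \<le> (\<Sum>g\<in>B. t g * translate G g f x)"
  shows "0 \<le> (\<Sum>g\<in>B. t g)"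
proof -
  obtain h where h: "bij_betw h {..<card B} B"
    using ex_bij_betw_nat_finite[OF \<open>finite B\<close>] by (auto simp: lessThan_atLeast0)
  have "(\<Sum>i<card B. t (h i) * translate G (h i) f x) = (\<Sum>g\<in>B. t g * translate G g f x)" for x
    by (rule sum.reindex_bij_betw[OF h])
  then have "0 \<le> (\<Sum>i<card B. t (h i) *\<^sub>R translate G (h i) f)"
    unfolding le_fun_def sum_fun_apply scaleR_fun_apply real_scaleR_def zero_fun_apply
    using nonneg by metis
  moreover have "\<forall>i<card B. h i \<in> carrier G"
    using h assms(3) by (auto simp: bij_betw_def)
  ultimately have "0 \<le> (\<Sum>i<card B. t (h i))"
    using assms(1)[unfolded translate_property_for_def, rule_format, of "card B" h "\<lambda>i. t (h i)"]
    by simp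
  then show ?thesis by (simp add: sum.reindex_bij_betw[OF h])
qed

definition average :: "'a set \<Rightarrow> ('a \<Rightarrow> real) \<Rightarrow> 'a \<Rightarrow> real" where
  "average T p = (1 / card T) *\<^sub>R (\<Sum>s\<in>T. translate G s p)"

lemma pairing_translate_translate:
  assumes "p \<in> finitely_supported G" "s \<in> carrier G"
  shows "pairing (translate G s p) (translate G s h) = pairing p (translate G \<one> h)"
  using assms by (simp add: pairing_translate translate_translate)

lemma energy_translate:
  assumes "p \<in> finitely_supported G" "s \<in> carrier G"
  shows "pairing (translate G s p) (translate G s p) = pairing p p"
  using assms pairing_translate_translate[of p s p] translate_one[of p]
  by (simp add: finitely_supported_def)

lemma energy_add:
  assumes "p \<in> finitely_supported G" "q \<in> finitely_supported G"
  shows "pairing (p + q) (p + q) = pairing p p + 2 * pairing p q + pairing q q"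
  using pairing_add_left[OF assms] pairing_commute[OF assms] by (simp add: pairing_add_right del: plus_fun_apply)

lemma energy_diff:
  assumes "p \<in> finitely_supported G" "q \<in> finitely_supported G"
  shows "pairing (p - q) (p - q) = pairing p p - 2 * pairing p q + pairing q q"
  using pairing_diff_left[OF assms] pairing_commute[OF assms] by (simp add: pairing_diff_right)

lemma energy_nonneg: "0 \<le> pairing p p"
  unfolding pairing_def by (rule sum_nonneg) simp

lemma pairing_le_energy:
  assumes "p \<in> finitely_supported G" "q \<in> finitely_supported G"
  shows "2 * pairing p q \<le> pairing p p + pairing q q"
  using energy_diff[OF assms] energy_nonneg[of "p - q"] by simp

text \<open>
  Averaging over \<open>T\<close> keeps most of the squared \<open>\<ell>\<^sup>2\<close> norm of \<open>p\<close> only if the translates of \<open>p\<close>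
  by elements of \<open>T\<close> are nearly parallel. Indeed, all the defects \<open>d a b\<close> are nonnegative and they add
  up to at most \<open>\<eta>\<close> times the square of \<open>card T\<close> times the squared norm of \<open>p\<close>, so each single
  defect is that small.
\<close>
lemma displacement_energy:
  assumes p: "p \<in> finitely_supported G" and T: "finite T" "T \<subseteq> carrier G" "\<one> \<in> T" and s: "s \<in> T"
    and avg: "(1 - \<eta>) * pairing p p \<le> pairing (average T p) (average T p)"
  shows "pairing (translate G s p - p) (translate G s p - p) \<le> 2 * \<eta> * (real (card T))\<^sup>2 * pairing p p"
proof -
  let ?N = "pairing p p" and ?m = "real (card T)"
  have fin: "translate G t p \<in> finitely_supported G" if "t \<in> T" for t
    using finitely_supported_translate[OF p] that T by blast
  have one: "translate G \<one> p = p"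
    using p by (simp add: translate_one finitely_supported_def)
  have m: "0 < ?m" using T by (auto simp: card_gt_0_iff)
  define d where "d a b = ?N - pairing (translate G a p) (translate G b p)" for a b
  have d: "0 \<le> d a b" if "a \<in> T" "b \<in> T" for a b
    using pairing_le_energy[OF fin[OF that(1)] fin[OF that(2)]] energy_translate[OF p, of a]
      energy_translate[OF p, of b] that T(2) unfolding d_def by (auto simp: subset_iff)
  have sum_left: "pairing (\<Sum>a\<in>T. translate G a p) h = (\<Sum>a\<in>T. pairing (translate G a p) h)" for h
    by (rule pairing_sum_left[OF fin])
  have avg_eq: "pairing (average T p) (average T p)
      = (1 / ?m)\<^sup>2 * (\<Sum>a\<in>T. \<Sum>b\<in>T. pairing (translate G a p) (translate G b p))"
    unfolding average_def pairing_scaleR_left sum_left pairing_scaleR_right pairing_sum_right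
    by (subst sum.swap) (simp add: power2_eq_square sum_distrib_left)
  have "(\<Sum>a\<in>T. \<Sum>b\<in>T. d a b) = ?m\<^sup>2 * ?N - ?m\<^sup>2 * pairing (average T p) (average T p)"
    unfolding avg_eq d_def using m
    by (simp add: sum_subtractf power2_eq_square)
  also have "\<dots> \<le> ?m\<^sup>2 * (\<eta> * ?N)"
    using mult_left_mono[OF avg, of "?m\<^sup>2"] by (simp add: algebra_simps)
  finally have total: "(\<Sum>a\<in>T. \<Sum>b\<in>T. d a b) \<le> ?m\<^sup>2 * (\<eta> * ?N)" .
  have "d s \<one> \<le> (\<Sum>b\<in>T. d s b)"
    by (rule member_le_sum[of \<one>]) (use T s d in auto)
  also have "\<dots> \<le> (\<Sum>a\<in>T. \<Sum>b\<in>T. d a b)"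
    by (rule member_le_sum[of s T "\<lambda>a. \<Sum>b\<in>T. d a b"]) (use T s d in \<open>auto intro: sum_nonneg\<close>)
  also note total
  finally have "d s \<one> \<le> ?m\<^sup>2 * (\<eta> * ?N)" .
  moreover have "pairing (translate G s p - p) (translate G s p - p) = 2 * d s \<one>"
    using energy_diff[OF fin[OF s] p] energy_translate[OF p] s T by (auto simp: d_def one)
  ultimately show ?thesis by (simp add: algebra_simps)
qed

text \<open>
  The distribution after \<open>n\<close> steps of the random walk from the identity with uniformly
  distributed increments in \<open>T\<close>.
\<close>
definition walk :: "'a set \<Rightarrow> nat \<Rightarrow> 'a \<Rightarrow> real" where
  "walk T n = (average T ^^ n) (\<lambda>x. if x = \<one> then 1 else 0)"

lemma walk_0: "walk T 0 = (\<lambda>x. if x = \<one> then 1 else 0)"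
  by (simp add: walk_def)

lemma walk_Suc: "walk T (Suc n) = average T (walk T n)"
  by (simp add: walk_def)

lemma walk_finitely_supported:
  assumes "T \<subseteq> carrier G"
  shows "walk T n \<in> finitely_supported G"
proof (induction n)
  case 0
  show ?case by (rule finitely_supportedI[of "{\<one>}"]) (auto simp: walk_0)
next
  case (Suc n)
  then show ?case
    unfolding walk_Suc average_def using assms
    by (intro finitely_supported_scaleR finitely_supported_sum finitely_supported_translate) auto
qed

lemma walk_nonneg: "0 \<le> walk T n x"
proof (induction n arbitrary: x)
  case (Suc n)
  then show ?case
    unfolding walk_Suc average_def by (auto intro!: sum_nonneg divide_nonneg_nonneg translate_nonneg)
qed (simp add: walk_0)

lemma square_le_energy:
  assumes "p \<in> finitely_supported G"
  shows "(p x)\<^sup>2 \<le> pairing p p"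
proof (cases "p x = 0")
  case False
  then have "p x * p x \<le> (\<Sum>x | p x \<noteq> 0. p x * p x)"
    by (intro member_le_sum) (use finite_support[OF assms] in auto)
  then show ?thesis by (simp add: pairing_def power2_eq_square)
qed (simp add: energy_nonneg)

text \<open>
  Under geometric decay the Green function \<open>f = \<Sum>n. l ^ n * walk T n\<close> converges and is bounded
  for some \<open>l > 1\<close>, and \<open>f - l * average T f\<close> is the nonnegative function \<open>walk T 0\<close>. This is a combination of
  translates of \<open>f\<close> with negative coefficient sum \<open>1 - l\<close>.
\<close>
lemma walk_energy_not_geometric:
  assumes trans: "translate_property G" and T: "finite T" "T \<subseteq> carrier G" "\<one> \<in> T"
    and q: "0 \<le> q" "q < 1"
    and decay: "\<And>n. pairing (walk T (Suc n)) (walk T (Suc n)) \<le> q * pairing (walk T n) (walk T n)"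
  shows False
proof -
  let ?p = "walk T" and ?m = "real (card T)"
  have m: "0 < ?m" using T by (auto simp: card_gt_0_iff)
  note fin = walk_finitely_supported[OF T(2)]
  have energy: "pairing (?p n) (?p n) \<le> q ^ n" for n
  proof (induction n)
    case 0
    have "{x. ?p 0 x \<noteq> 0} = {\<one>}" by (auto simp: walk_0)
    then have "pairing (?p 0) (?p 0) = 1" unfolding pairing_def by (simp add: walk_0)
    then show ?case by simp
  next
    case (Suc n)
    then show ?case using decay[of n] mult_left_mono[OF Suc q(1)] by simp
  qed
  \<comment> \<open>Any \<open>l > 1\<close> with \<open>l\<^sup>2 q < 1\<close> would do; this choice makes \<open>l\<^sup>2 q = 2 q / (1 + q)\<close> and covers
    \<open>q = 0\<close>.\<close>
  define l where "l = sqrt (2 / (1 + q))"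
  define r where "r = l * sqrt q"
  have l: "1 < l" using q by (simp add: l_def)
  have "r\<^sup>2 = 2 * q / (1 + q)" using q by (simp add: r_def l_def power_mult_distrib)
  also have "\<dots> < 1\<^sup>2" using q by (simp add: field_simps)
  finally have r1: "r < 1" by (rule power_less_imp_less_base) simp
  have r0: "0 \<le> r" using q l by (simp add: r_def)
  have term_le: "l ^ n * ?p n x \<le> r ^ n" for n x
  proof -
    have "(?p n x)\<^sup>2 \<le> (sqrt q ^ n)\<^sup>2"
      using square_le_energy[OF fin, of n x] energy[of n] q
      by (simp add: power_mult[symmetric] mult.commute[of n]) (simp add: power_mult)
    then have "?p n x \<le> sqrt q ^ n" by (rule power2_le_imp_le) (use q in simp)
    then show ?thesis using l by (simp add: r_def power_mult_distrib mult_left_mono)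
  qed
  have term_nonneg: "0 \<le> l ^ n * ?p n x" for n x using l walk_nonneg by simp
  have summ: "summable (\<lambda>n. l ^ n * ?p n x)" for x
    by (rule summable_comparison_test'[OF summable_geometric[of r]])
      (use term_le term_nonneg r0 r1 in auto)
  have summ_Suc: "summable (\<lambda>n. l ^ Suc n * ?p (Suc n) x)" for x
    using summable_Suc_iff[of "\<lambda>n. l ^ n * ?p n x"] summ[of x] by blast
  define f where "f x = (\<Sum>n. l ^ n * ?p n x)" for x
  have f_nonneg: "0 \<le> f x" for x
    unfolding f_def by (rule suminf_nonneg[OF summ term_nonneg])
  have f_le: "f x \<le> 1 / (1 - r)" for x
  proof -
    have "f x \<le> (\<Sum>n. r ^ n)"
      unfolding f_def by (rule suminf_le[OF term_le summ summable_geometric]) (use r0 r1 in simp)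
    then show ?thesis using r0 r1 by (simp add: suminf_geometric)
  qed
  have split: "f x = ?p 0 x + (\<Sum>n. l ^ Suc n * ?p (Suc n) x)" for x
    using suminf_split_head[OF summ[of x]] by (simp add: f_def)
  have "f \<in> functions_on G"
    using fin by (auto simp: f_def functions_on_def finitely_supported_def)
  moreover have "bounded (f ` carrier G)"
    using f_nonneg f_le by (intro boundedI[of _ "1 / (1 - r)"]) auto
  moreover have "f \<noteq> 0"
  proof
    assume "f = 0"
    have "0 \<le> (\<Sum>n. l ^ Suc n * ?p (Suc n) \<one>)"
      by (rule suminf_nonneg[OF summ_Suc term_nonneg])
    then show False using split[of \<one>] \<open>f = 0\<close> by (simp add: walk_0)
  qed
  ultimately have for_f: "translate_property_for G f"
    using trans f_nonneg unfolding translate_property_def l_infty_def by (auto simp: le_fun_def)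
  define t where "t s = (if s = \<one> then 1 else 0) - l / ?m" for s
  have "0 \<le> (\<Sum>s\<in>T. t s)"
  proof (rule translate_property_for_finite[OF for_f T(1,2)])
    fix x
    show "0 \<le> (\<Sum>s\<in>T. t s * translate G s f x)"
    proof (cases "x \<in> carrier G")
      case True
      have "(\<Sum>s\<in>T. translate G s f x) = (\<Sum>s\<in>T. \<Sum>n. l ^ n * translate G s (?p n) x)"
        using True by (simp add: translate_apply f_def)
      also have "\<dots> = (\<Sum>n. \<Sum>s\<in>T. l ^ n * translate G s (?p n) x)"
        by (rule suminf_sum[symmetric]) (use True summ in \<open>simp add: translate_apply\<close>)
      also have "\<dots> = (\<Sum>n. ?m * (l ^ n * ?p (Suc n) x))"
        using m by (simp add: walk_Suc average_def sum_distrib_left)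
      finally have 1: "l / ?m * (\<Sum>s\<in>T. translate G s f x) = l / ?m * (\<Sum>n. ?m * (l ^ n * ?p (Suc n) x))"
        by simp
      have shifted: "summable (\<lambda>n. l ^ n * ?p (Suc n) x)"
      proof -
        have "summable (\<lambda>n. inverse l * (l ^ Suc n * ?p (Suc n) x))"
          by (rule summable_mult[OF summ_Suc])
        then show ?thesis using l by (simp add: field_simps)
      qed
      have "l / ?m * (\<Sum>n. ?m * (l ^ n * ?p (Suc n) x)) = (\<Sum>n. l ^ Suc n * ?p (Suc n) x)"
        using m suminf_mult[OF shifted, of ?m] suminf_mult[OF shifted, of l] by (simp add: mult.assoc)
      then have "f x - l / ?m * (\<Sum>s\<in>T. translate G s f x) = ?p 0 x"
        using split[of x] 1 by simp
      moreover have "(\<Sum>s\<in>T. t s * translate G s f x) = f x - l / ?m * (\<Sum>s\<in>T. translate G s f x)"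
      proof -
        have "(\<Sum>s\<in>T. t s * translate G s f x)
            = (\<Sum>s\<in>T. (if s = \<one> then translate G s f x else 0) - l / ?m * translate G s f x)"
          by (rule sum.cong) (auto simp: t_def algebra_simps)
        then show ?thesis
          using T True by (simp add: sum_subtractf sum_distrib_left translate_apply)
      qed
      ultimately show ?thesis using walk_nonneg[of T 0 x] by simp
    qed (simp add: translate_def)
  qed
  moreover have "(\<Sum>s\<in>T. t s) = 1 - l"
    using T m by (auto simp: t_def sum_subtractf)
  ultimately show False using l by simp
qed

text \<open>
  At a time \<open>n\<close> when the squared \<open>\<ell>\<^sup>2\<close> norm of the walk drops by a factor above \<open>1 - \<eta>\<close>, the walk
  \<open>p\<close> is almost invariant in \<open>\<ell>\<^sup>2\<close>. Its square \<open>v\<close> is then almost invariant in \<open>\<ell>\<^sup>1\<close>, because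
  \<open>a\<^sup>2 - b\<^sup>2 = (a - b) (a + b)\<close>.
\<close>
lemma Reiter_of_translate_property:
  assumes trans: "translate_property G" and S: "finite S" "S \<subseteq> carrier G" and "0 < \<epsilon>"
  obtains v where "v \<in> finitely_supported G" "\<And>x. 0 \<le> v x"
    "\<And>s. s \<in> S \<Longrightarrow> pairing (\<lambda>x. \<bar>translate G s v x - v x\<bar>) (\<lambda>_. 1) < \<epsilon> * pairing v (\<lambda>_. 1)"
proof -
  \<comment> \<open>With the identity among the increments, an element of \<open>S\<close> is compared with the identity by
    \<open>displacement_energy\<close>.\<close>
  define T where "T = insert \<one> S"
  have T: "finite T" "T \<subseteq> carrier G" "\<one> \<in> T" using S by (auto simp: T_def)
  define m where "m = real (card T)"
  have m: "0 < m" using T by (auto simp: m_def card_gt_0_iff)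
  define \<eta> where "\<eta> = \<epsilon>\<^sup>2 / (16 * m\<^sup>2)"
  have \<eta>: "0 < \<eta>" using m \<open>0 < \<epsilon>\<close> by (simp add: \<eta>_def)
  let ?N = "\<lambda>n. pairing (walk T n) (walk T n)"
  have "\<exists>n. max (1 - \<eta>) 0 * ?N n < ?N (Suc n)"
  proof (rule ccontr)
    assume "\<nexists>n. max (1 - \<eta>) 0 * ?N n < ?N (Suc n)"
    then have "?N (Suc n) \<le> max (1 - \<eta>) 0 * ?N n" for n by (meson not_less)
    then show False
      by (rule walk_energy_not_geometric[OF trans T, rotated 2]) (use \<eta> in auto)
  qed
  then obtain n where n: "max (1 - \<eta>) 0 * ?N n < ?N (Suc n)" by blast
  define p where "p = walk T n"
  have p: "p \<in> finitely_supported G" "0 \<le> p x" for x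
    unfolding p_def using walk_finitely_supported[OF T(2)] walk_nonneg by auto
  have avg: "(1 - \<eta>) * pairing p p \<le> pairing (average T p) (average T p)"
  proof -
    have "(1 - \<eta>) * pairing p p \<le> max (1 - \<eta>) 0 * pairing p p"
      by (rule mult_right_mono) (auto simp: energy_nonneg)
    then show ?thesis using n by (simp add: p_def walk_Suc)
  qed
  have pos: "0 < pairing p p"
  proof (rule ccontr)
    assume "\<not> 0 < pairing p p"
    then have "p = (\<lambda>x. 0)"
      using square_le_energy[OF p(1)] by (metis (no_types) less_le_trans linorder_not_less power2_less_0 zero_less_power2 ext)
    moreover have "average T (\<lambda>x. 0) = (\<lambda>x. 0)"
      by (simp add: average_def translate_def fun_eq_iff)
    ultimately have "average T p = (\<lambda>x. 0)" by simp
    then have "?N (Suc n) = 0" by (simp add: walk_Suc p_def[symmetric] pairing_def)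
    moreover have "?N n = 0" using \<open>p = (\<lambda>x. 0)\<close> by (simp add: p_def[symmetric] pairing_def)
    ultimately show False using n by simp
  qed
  define v where "v x = p x * p x" for x
  have v: "v \<in> finitely_supported G" "0 \<le> v x" for x
    using p finitely_supported_pointwise[OF p(1) p(1), of v] by (auto simp: v_def)
  have mass: "pairing v (\<lambda>_. 1) = pairing p p"
    by (simp add: pairing_def v_def)
  have "pairing (\<lambda>x. \<bar>translate G s v x - v x\<bar>) (\<lambda>_. 1) < \<epsilon> * pairing v (\<lambda>_. 1)" if s: "s \<in> S" for s
  proof -
    let ?q = "translate G s p"
    have sT: "s \<in> T" "s \<in> carrier G" using s S by (auto simp: T_def)
    have q: "?q \<in> finitely_supported G" by (rule finitely_supported_translate[OF p(1) sT(2)])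
    let ?A = "{x. ?q x \<noteq> 0} \<union> {x. p x \<noteq> 0}"
    have A: "finite ?A" using finite_support p(1) q by auto
    have trv: "translate G s v x = ?q x * ?q x" for x
      by (simp add: v_def translate_def)
    \<comment> \<open>The weighted mean inequality with weight \<open>\<epsilon> / 4\<close>. By the choice of \<open>\<eta>\<close> the first summand
      contributes \<open>\<epsilon> / 4\<close> and the second \<open>\<epsilon> / 2\<close> of the mass of \<open>v\<close>.\<close>
    have amgm: "\<bar>a * a - b * b\<bar> \<le> 2 / \<epsilon> * (a - b)\<^sup>2 + \<epsilon> / 8 * (a + b)\<^sup>2" for a b :: real
    proof -
      have "\<bar>a * a - b * b\<bar> = \<bar>a - b\<bar> * \<bar>a + b\<bar>"
        by (simp add: abs_mult[symmetric] algebra_simps)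
      moreover have "0 \<le> 2 / \<epsilon> * (\<bar>a - b\<bar> - \<epsilon> / 4 * \<bar>a + b\<bar>)\<^sup>2" using \<open>0 < \<epsilon>\<close> by simp
      moreover have "2 / \<epsilon> * (\<bar>a - b\<bar> - \<epsilon> / 4 * \<bar>a + b\<bar>)\<^sup>2
          = 2 / \<epsilon> * (a - b)\<^sup>2 + \<epsilon> / 8 * (a + b)\<^sup>2 - \<bar>a - b\<bar> * \<bar>a + b\<bar>"
      proof -
        have "2 / \<epsilon> * (x - \<epsilon> / 4 * y)\<^sup>2 = 2 / \<epsilon> * x\<^sup>2 + \<epsilon> / 8 * y\<^sup>2 - x * y" for x y
          using \<open>0 < \<epsilon>\<close> by (simp add: power2_eq_square field_simps)
        from this[of "\<bar>a - b\<bar>" "\<bar>a + b\<bar>"] show ?thesis by simp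
      qed
      ultimately show ?thesis by linarith
    qed
    have "pairing (\<lambda>x. \<bar>translate G s v x - v x\<bar>) (\<lambda>_. 1) = (\<Sum>x\<in>?A. \<bar>?q x * ?q x - p x * p x\<bar>)"
      by (subst pairing_superset[OF A]) (auto simp: trv v_def)
    also have "\<dots> \<le> (\<Sum>x\<in>?A. 2 / \<epsilon> * (?q x - p x)\<^sup>2 + \<epsilon> / 8 * (?q x + p x)\<^sup>2)"
      by (rule sum_mono) (rule amgm)
    also have "\<dots> = 2 / \<epsilon> * (\<Sum>x\<in>?A. (?q - p) x * (?q - p) x) + \<epsilon> / 8 * (\<Sum>x\<in>?A. (?q + p) x * (?q + p) x)"
      by (simp add: sum.distrib sum_distrib_left power2_eq_square)
    also have "(\<Sum>x\<in>?A. (?q - p) x * (?q - p) x) = pairing (?q - p) (?q - p)"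
      by (rule pairing_superset[OF A, symmetric]) auto
    also have "(\<Sum>x\<in>?A. (?q + p) x * (?q + p) x) = pairing (?q + p) (?q + p)"
      by (rule pairing_superset[OF A, symmetric]) auto
    also have "2 / \<epsilon> * pairing (?q - p) (?q - p) + \<epsilon> / 8 * pairing (?q + p) (?q + p)
        \<le> 2 / \<epsilon> * (2 * \<eta> * m\<^sup>2 * pairing p p) + \<epsilon> / 8 * (4 * pairing p p)"
    proof (intro add_mono mult_left_mono)
      show "pairing (?q - p) (?q - p) \<le> 2 * \<eta> * m\<^sup>2 * pairing p p"
        unfolding m_def by (rule displacement_energy[OF p(1) T sT(1) avg])
      show "pairing (?q + p) (?q + p) \<le> 4 * pairing p p"
        using energy_add[OF q p(1)] pairing_le_energy[OF q p(1)] energy_translate[OF p(1) sT(2)] by simp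
    qed (use \<open>0 < \<epsilon>\<close> in auto)
    also have "2 / \<epsilon> * (2 * \<eta> * m\<^sup>2 * pairing p p) + \<epsilon> / 8 * (4 * pairing p p) = 3 / 4 * \<epsilon> * pairing p p"
      using m \<open>0 < \<epsilon>\<close> by (simp add: \<eta>_def power2_eq_square field_simps)
    also have "\<dots> < \<epsilon> * pairing p p" using pos \<open>0 < \<epsilon>\<close> by simp
    finally show ?thesis using \<open>0 < \<epsilon>\<close> by (simp add: mass)
  qed
  then show ?thesis using v that by blast
qed

section \<open>The weighted Reiter property\<close>

text \<open>
  Duality for the cone of the families of pairings of finitely supported \<open>u \<ge> 0\<close> with the
  translates of \<open>f\<close>. Testing a coefficient vector \<open>t\<close> on the point masses \<open>u\<close> says that the
  combination \<open>\<Sum>g. t g g f\<close> is nonnegative everywhere, so the translate property for \<open>f\<close> is exactly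
  the hypothesis of \<open>cone_approximation\<close> for the constant family \<open>1\<close>.
\<close>
lemma almost_normalised_functional:
  assumes trans: "translate_property_for G f" and f: "\<And>x. 0 \<le> f x"
    and B: "finite B" "B \<subseteq> carrier G" and "0 < \<delta>"
  obtains u where "u \<in> finitely_supported G" "\<And>x. 0 \<le> u x"
    "\<And>g. g \<in> B \<Longrightarrow> \<bar>pairing u (translate G g f) - 1\<bar> < \<delta>"
proof -
  let ?U = "{u \<in> finitely_supported G. \<forall>x. 0 \<le> u x}"
  define K where "K = (\<lambda>u g. pairing u (translate G g f)) ` ?U"
  have "\<exists>k\<in>K. (\<Sum>g\<in>B. \<bar>k g - 1\<bar>) < \<delta>"
  proof (rule cone_approximation[OF \<open>finite B\<close>, of K "\<lambda>_. 1" \<delta>])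
    show "0 \<in> K" unfolding K_def by (rule image_eqI[of _ _ 0]) (auto simp: fun_eq_iff)
  next
    fix k k' assume "k \<in> K" "k' \<in> K"
    then obtain u u' where "u \<in> ?U" "u' \<in> ?U" "k = (\<lambda>g. pairing u (translate G g f))"
      "k' = (\<lambda>g. pairing u' (translate G g f))" by (auto simp: K_def)
    then show "k + k' \<in> K" unfolding K_def
      using pairing_add_left[of u G u'] by (intro image_eqI[of _ _ "u + u'"]) (auto simp: fun_eq_iff)
  next
    fix c :: real and k assume "0 \<le> c" "k \<in> K"
    then obtain u where "u \<in> ?U" "k = (\<lambda>g. pairing u (translate G g f))" by (auto simp: K_def)
    then show "c *\<^sub>R k \<in> K" unfolding K_def
      using \<open>0 \<le> c\<close> by (intro image_eqI[of _ _ "c *\<^sub>R u"]) (auto simp: fun_eq_iff pairing_scaleR_left)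
  next
    fix t assume t: "\<And>k. k \<in> K \<Longrightarrow> 0 \<le> (\<Sum>g\<in>B. t g * k g)"
    have "0 \<le> (\<Sum>g\<in>B. t g * translate G g f y)" for y
    proof (cases "y \<in> carrier G")
      case True
      let ?u = "\<lambda>x. if x = y then 1 else 0 :: real"
      have "?u \<in> ?U" using True by (auto intro!: finitely_supportedI[of "{y}"] split: if_splits)
      then have "(\<lambda>g. pairing ?u (translate G g f)) \<in> K" unfolding K_def by (rule imageI)
      moreover have "pairing ?u h = h y" for h
        by (subst pairing_superset[of "{y}"]) auto
      ultimately show ?thesis using t by fastforce
    qed (simp add: translate_def)
    then show "0 \<le> (\<Sum>g\<in>B. t g * 1)"
      using translate_property_for_finite[OF trans B] by simp
  qed (use \<open>0 < \<delta>\<close> in auto)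
  then obtain u where u: "u \<in> ?U" and sum: "(\<Sum>g\<in>B. \<bar>pairing u (translate G g f) - 1\<bar>) < \<delta>"
    by (auto simp: K_def)
  have "\<bar>pairing u (translate G g f) - 1\<bar> < \<delta>" if "g \<in> B" for g
    using member_le_sum[of g B "\<lambda>g. \<bar>pairing u (translate G g f) - 1\<bar>"] that B sum by simp
  then show ?thesis using u that by blast
qed

text \<open>
  Translating a convolution of \<open>v\<close> and \<open>u\<close> translates its left factor.
\<close>
lemma translate_convolution:
  assumes v: "v \<in> finitely_supported G" and s: "s \<in> carrier G" and A: "finite A" "A \<subseteq> carrier G"
    and supp: "{x. v x \<noteq> 0} \<subseteq> A" "{x. translate G s v x \<noteq> 0} \<subseteq> A"
  shows "translate G s (\<Sum>y\<in>A. v y *\<^sub>R translate G y u) = (\<Sum>y\<in>A. translate G s v y *\<^sub>R translate G y u)"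
proof -
  have "translate G s (\<Sum>y\<in>A. v y *\<^sub>R translate G y u) = (\<Sum>y\<in>A. v y *\<^sub>R translate G (s \<otimes> y) u)"
    unfolding translate_sum translate_scaleR
    by (rule sum.cong) (use A s translate_translate in auto)
  also have "\<dots> = (\<Sum>y | v y \<noteq> 0. v y *\<^sub>R translate G (s \<otimes> y) u)"
    by (rule sum.mono_neutral_right) (use A supp in auto)
  also have "\<dots> = (\<Sum>y | v y \<noteq> 0. translate G s v (s \<otimes> y) *\<^sub>R translate G (s \<otimes> y) u)"
    by (rule sum.cong) (use s support_subset[OF v] in \<open>auto simp: translate_def m_assoc[symmetric]\<close>)
  also have "\<dots> = (\<Sum>y | translate G s v y \<noteq> 0. translate G s v y *\<^sub>R translate G y u)"
    unfolding support_translate[OF v s] by (simp add: sum.reindex[OF inj_on_mult_support[OF v s]])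
  also have "\<dots> = (\<Sum>y\<in>A. translate G s v y *\<^sub>R translate G y u)"
    by (rule sum.mono_neutral_left) (use A supp in auto)
  finally show ?thesis .
qed

text \<open>
  The convolution \<open>w = \<Sum>y. v y y u\<close> of an almost invariant \<open>v\<close> with a \<open>u\<close> whose translates by
  the relevant \<open>y\<close> all pair with \<open>f\<close> to nearly \<open>1\<close>. Up to a constant factor, the norms weighted by
  \<open>f\<close> of \<open>w\<close> and of \<open>s w - w\<close> are then controlled by the plain \<open>\<ell>\<^sup>1\<close> norms of \<open>v\<close> and of \<open>s v - v\<close>.
\<close>
lemma weighted_Reiter_of_translate_property:
  assumes trans: "translate_property G" and f: "f \<in> l_infty G" "f \<noteq> 0" "\<And>x. 0 \<le> f x"
    and S: "finite S" "S \<subseteq> carrier G" and "0 < \<epsilon>"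
  obtains w where "w \<in> finitely_supported G"
    "\<And>s. s \<in> S \<Longrightarrow> pairing (\<lambda>x. \<bar>translate G s w x - w x\<bar>) f < \<epsilon> * pairing (\<lambda>x. \<bar>w x\<bar>) f"
proof -
  have for_f: "translate_property_for G f"
    using trans f unfolding translate_property_def by (auto simp: le_fun_def)
  obtain v where v: "v \<in> finitely_supported G" "\<And>x. 0 \<le> v x"
    and inv: "\<And>s. s \<in> S \<Longrightarrow> pairing (\<lambda>x. \<bar>translate G s v x - v x\<bar>) (\<lambda>_. 1) < \<epsilon> / 3 * pairing v (\<lambda>_. 1)"
    using Reiter_of_translate_property[OF trans S, of "\<epsilon> / 3"] \<open>0 < \<epsilon>\<close> by auto
  \<comment> \<open>One finite set carries \<open>v\<close> and all its translates by \<open>S\<close>.\<close>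
  define A where "A = {x. v x \<noteq> 0} \<union> (\<Union>s\<in>S. {x. translate G s v x \<noteq> 0})"
  have trv: "translate G s v \<in> finitely_supported G" if "s \<in> S" for s
    using finitely_supported_translate[OF v(1)] that S by blast
  have A: "finite A" "A \<subseteq> carrier G"
    unfolding A_def using S v(1) trv finite_support support_subset by blast+
  obtain u where u: "u \<in> finitely_supported G" "\<And>x. 0 \<le> u x"
    and norm: "\<And>g. g \<in> (\<lambda>y. inv y) ` A \<Longrightarrow> \<bar>pairing u (translate G g f) - 1\<bar> < 1 / 2"
    using almost_normalised_functional[OF for_f f(3), of "(\<lambda>y. inv y) ` A" "1 / 2"] A by auto
  have uf: "pairing (translate G y u) f < 3 / 2" "1 / 2 < pairing (translate G y u) f" if "y \<in> A" for y
  proof -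
    have "pairing (translate G y u) f = pairing u (translate G (inv y) f)"
      using pairing_translate[OF u(1)] that A by blast
    moreover have "\<bar>pairing u (translate G (inv y) f) - 1\<bar> < 1 / 2"
      using norm that by blast
    ultimately show "pairing (translate G y u) f < 3 / 2" "1 / 2 < pairing (translate G y u) f"
      by linarith+
  qed
  define w where "w = (\<Sum>y\<in>A. v y *\<^sub>R translate G y u)"
  have tru: "translate G y u \<in> finitely_supported G" if "y \<in> A" for y
    using finitely_supported_translate[OF u(1)] that A by blast
  have w: "w \<in> finitely_supported G"
    unfolding w_def using tru by (intro finitely_supported_sum finitely_supported_scaleR)
  have w_nonneg: "0 \<le> w x" for x
    unfolding w_def using v(2) u(2) by (auto intro!: sum_nonneg mult_nonneg_nonneg translate_nonneg)
  have wf: "pairing (\<lambda>x. \<bar>w x\<bar>) f = (\<Sum>y\<in>A. v y * pairing (translate G y u) f)"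
  proof -
    have "(\<lambda>x. \<bar>w x\<bar>) = w" using w_nonneg by auto
    then show ?thesis
      unfolding w_def by (simp only:) (subst pairing_sum_left[of _ _ G], use tru in \<open>auto simp: pairing_scaleR_left\<close>)
  qed
  have mass: "pairing v (\<lambda>_. 1) = (\<Sum>y\<in>A. v y)"
    by (subst pairing_superset[OF A(1)]) (auto simp: A_def)
  have lower: "1 / 2 * (\<Sum>y\<in>A. v y) \<le> pairing (\<lambda>x. \<bar>w x\<bar>) f"
    unfolding wf sum_distrib_left
  proof (rule sum_mono)
    fix y assume "y \<in> A"
    then show "1 / 2 * v y \<le> v y * pairing (translate G y u) f"
      using mult_left_mono[OF less_imp_le[OF uf(2)] v(2)] by (simp add: mult.commute)
  qed
  have "pairing (\<lambda>x. \<bar>translate G s w x - w x\<bar>) f < \<epsilon> * pairing (\<lambda>x. \<bar>w x\<bar>) f" if s: "s \<in> S" for s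
  proof -
    have sG: "s \<in> carrier G" using s S by blast
    let ?d = "\<lambda>y. translate G s v y - v y"
    have shift: "translate G s w = (\<Sum>y\<in>A. translate G s v y *\<^sub>R translate G y u)"
      unfolding w_def by (rule translate_convolution[OF v(1) sG A]) (use s in \<open>auto simp: A_def\<close>)
    have diff: "translate G s w x - w x = (\<Sum>y\<in>A. ?d y * translate G y u x)" for x
      unfolding shift by (simp add: w_def sum_subtractf left_diff_distrib)
    let ?W = "\<Sum>y\<in>A. \<bar>?d y\<bar> *\<^sub>R translate G y u"
    have "(\<lambda>x. \<bar>translate G s w x - w x\<bar>) \<in> finitely_supported G"
      using finitely_supported_abs[OF finitely_supported_diff[OF finitely_supported_translate[OF w sG] w]] by simp
    then have "pairing (\<lambda>x. \<bar>translate G s w x - w x\<bar>) f \<le> pairing ?W f"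
    proof (rule pairing_mono_left)
      show "?W \<in> finitely_supported G"
        using tru by (intro finitely_supported_sum finitely_supported_scaleR)
      show "\<bar>translate G s w x - w x\<bar> \<le> ?W x" for x
        unfolding diff by (rule order_trans[OF sum_abs])
          (auto simp: abs_mult translate_nonneg[OF u(2)])
    qed (rule f(3))
    also have "\<dots> = (\<Sum>y\<in>A. \<bar>?d y\<bar> * pairing (translate G y u) f)"
      by (subst pairing_sum_left[of _ _ G]) (use tru in \<open>auto simp: pairing_scaleR_left\<close>)
    also have "\<dots> \<le> (\<Sum>y\<in>A. \<bar>?d y\<bar> * (3 / 2))"
    proof (rule sum_mono, rule mult_left_mono)
      show "pairing (translate G y u) f \<le> 3 / 2" if "y \<in> A" for y
        using uf(1)[OF that] by simp
    qed simp
    also have "\<dots> = 3 / 2 * pairing (\<lambda>x. \<bar>?d x\<bar>) (\<lambda>_. 1)"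
    proof -
      have "pairing (\<lambda>x. \<bar>?d x\<bar>) (\<lambda>_. 1) = (\<Sum>y\<in>A. \<bar>?d y\<bar> * 1)"
        by (rule pairing_superset[OF A(1)]) (use s in \<open>auto simp: A_def\<close>)
      then show ?thesis by (simp add: sum_distrib_left mult.commute)
    qed
    also have "\<dots> < 3 / 2 * (\<epsilon> / 3 * pairing v (\<lambda>_. 1))"
      using inv[OF s] by simp
    also have "\<dots> = \<epsilon> * (1 / 2 * (\<Sum>y\<in>A. v y))" by (simp add: mass)
    also have "\<dots> \<le> \<epsilon> * pairing (\<lambda>x. \<bar>w x\<bar>) f"
      using lower \<open>0 < \<epsilon>\<close> by (intro mult_left_mono) auto
    finally show ?thesis .
  qed
  with w that show ?thesis by blast
qed

end

section \<open>Linear representations\<close>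

lemma linear_on_combination:
  assumes "subspace V" "linear_on V L" "\<And>i. i \<in> I \<Longrightarrow> x i \<in> V"
  shows "L (\<Sum>i\<in>I. t i *\<^sub>R x i) = (\<Sum>i\<in>I. t i *\<^sub>R L (x i))"
  using assms(3)
proof (induction I rule: infinite_finite_induct)
  case (insert i I)
  then have "(\<Sum>i\<in>I. t i *\<^sub>R x i) \<in> V" "t i *\<^sub>R x i \<in> V"
    using assms(1) by (auto intro: subspace_sum subspace_mul)
  then show ?case
    using insert assms(2) by (simp add: linear_on_def)
next
  case empty
  have "L (0 *\<^sub>R 0) = 0 *\<^sub>R L 0"
    using assms(1,2) subspace_0 unfolding linear_on_def by blast
  then show ?case by simp
next
  case (infinite I)
  have "L (0 *\<^sub>R 0) = 0 *\<^sub>R L 0"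
    using assms(1,2) subspace_0 unfolding linear_on_def by blast
  then show ?case using infinite by simp
qed

lemma linear_on_zero: "subspace V \<Longrightarrow> linear_on V L \<Longrightarrow> L 0 = 0"
  using linear_on_combination[of V L "{}"] by simp

lemma linear_on_scaleR: "linear_on V L \<Longrightarrow> x \<in> V \<Longrightarrow> L (c *\<^sub>R x) = c *\<^sub>R L x"
  by (simp add: linear_on_def)

lemma linear_on_add: "linear_on V L \<Longrightarrow> x \<in> V \<Longrightarrow> y \<in> V \<Longrightarrow> L (x + y) = L x + L y"
  by (simp add: linear_on_def)

lemma linear_on_uminus: "linear_on V L \<Longrightarrow> x \<in> V \<Longrightarrow> L (- x) = - L x"
  using linear_on_scaleR[of V L x "-1"] by simp

lemma linear_on_diff:
  "subspace V \<Longrightarrow> linear_on V L \<Longrightarrow> x \<in> V \<Longrightarrow> y \<in> V \<Longrightarrow> L (x - y) = L x - L y"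
  using linear_on_add[of V L x "- y"] linear_on_uminus[of V L y] by (simp add: subspace_neg)

lemma linear_rep_group_action: "linear_rep G V \<rho> \<Longrightarrow> group_action G V \<rho>"
  by (simp add: linear_rep_def)

lemma linear_rep_linear_on: "linear_rep G V \<rho> \<Longrightarrow> g \<in> carrier G \<Longrightarrow> linear_on V (\<rho> g)"
  by (simp add: linear_rep_def)

lemma linear_rep_closed: "linear_rep G V \<rho> \<Longrightarrow> g \<in> carrier G \<Longrightarrow> x \<in> V \<Longrightarrow> \<rho> g x \<in> V"
  by (metis group_action.element_image linear_rep_group_action)

lemma linear_rep_mult:
  "linear_rep G V \<rho> \<Longrightarrow> g \<in> carrier G \<Longrightarrow> h \<in> carrier G \<Longrightarrow> x \<in> V \<Longrightarrow> \<rho> (g \<otimes>\<^bsub>G\<^esub> h) x = \<rho> g (\<rho> h x)"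
  by (metis group_action.composition_rule linear_rep_group_action)

lemma linear_rep_one: "linear_rep G V \<rho> \<Longrightarrow> x \<in> V \<Longrightarrow> \<rho> \<one>\<^bsub>G\<^esub> x = x"
  using group_action.id_eq_one[OF linear_rep_group_action, of G V \<rho>] by (metis restrict_apply')

text \<open>
  Bijections of \<open>V\<close> are extensional functions in \<open>BijGroup\<close>, so a formula for an action has to be
  restricted to \<open>V\<close> before it is a group action.
\<close>
lemma (in group) linear_rep_restrict:
  assumes V: "subspace V"
    and closed: "\<And>g x. g \<in> carrier G \<Longrightarrow> x \<in> V \<Longrightarrow> A g x \<in> V"
    and one: "\<And>x. x \<in> V \<Longrightarrow> A \<one> x = x"
    and mult: "\<And>g h x. g \<in> carrier G \<Longrightarrow> h \<in> carrier G \<Longrightarrow> x \<in> V \<Longrightarrow> A (g \<otimes> h) x = A g (A h x)"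
    and lin: "\<And>g. g \<in> carrier G \<Longrightarrow> linear_on V (A g)"
  shows "linear_rep G V (\<lambda>g. restrict (A g) V)"
  unfolding linear_rep_def
proof (intro conjI ballI)
  have bij: "restrict (A g) V \<in> Bij V" if g: "g \<in> carrier G" for g
  proof -
    have "bij_betw (A g) V V"
    proof (rule bij_betw_byWitness[of V "A (inv g)"])
      show "\<forall>x\<in>V. A (inv g) (A g x) = x" "\<forall>x\<in>V. A g (A (inv g) x) = x"
        using g one mult[symmetric] by auto
    qed (use closed g in auto)
    then show ?thesis by (simp add: Bij_def)
  qed
  have "(\<lambda>g. restrict (A g) V) \<in> hom G (BijGroup V)"
  proof (rule homI)
    fix g h assume gh: "g \<in> carrier G" "h \<in> carrier G"
    show "restrict (A (g \<otimes> h)) V = restrict (A g) V \<otimes>\<^bsub>BijGroup V\<^esub> restrict (A h) V"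
      using gh bij closed mult by (auto simp: BijGroup_def compose_def fun_eq_iff)
  qed (use bij in \<open>simp add: BijGroup_def\<close>)
  then show "group_action G V (\<lambda>g. restrict (A g) V)"
    by (intro group_action.intro group_hom.intro group_hom_axioms.intro group_BijGroup) unfold_locales
next
  fix g assume g: "g \<in> carrier G"
  show "linear_on V (restrict (A g) V)"
    using lin[OF g] V by (simp add: linear_on_def subspace_add subspace_mul)
qed

lemma orbit_restrict: "x \<in> V \<Longrightarrow> orbit G (\<lambda>g. restrict (A g) V) x = (\<lambda>g. A g x) ` carrier G"
  by (auto simp: orbit_def)

lemma subspace_functions_on: "subspace (functions_on G)"
  by (auto simp: subspace_def functions_on_def)

section \<open>The abstract translate property\<close>

text \<open>
  On the space of all functions on \<open>G\<close>, evaluation at a point where \<open>f\<close> does not vanish is a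
  positive form that is bounded on the translates of \<open>f\<close>.
\<close>
lemma (in group) translate_property_of_abstract:
  assumes "abstract_translate_property TYPE('a \<Rightarrow> real) G"
  shows "translate_property G"
  unfolding translate_property_def
proof (intro ballI impI, elim conjE)
  fix f :: "'a \<Rightarrow> real" assume f: "f \<in> l_infty G" "f \<noteq> 0" "0 \<le> f"
  let ?V = "functions_on G" and ?\<rho> = "\<lambda>g. restrict (translate G g) (functions_on G)"
  have fV: "f \<in> ?V" using f by (simp add: l_infty_def)
  obtain x where x: "f x \<noteq> 0" using f(2) by (auto simp: fun_eq_iff)
  have order: "ordered_vector_space_on ?V (\<le>)"
    unfolding ordered_vector_space_on_def using subspace_functions_on
    by (auto simp: le_fun_def mult_left_mono fun_eq_iff intro: order_trans order_antisym)
  have "linear_rep G ?V ?\<rho>"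
    by (rule linear_rep_restrict[OF subspace_functions_on])
      (auto simp: translate_one translate_translate linear_on_def translate_add translate_scaleR)
  then have rep: "ordered_rep G ?V (\<le>) ?\<rho>"
    by (auto simp: ordered_rep_def translate_mono)
  have "linear_on ?V (\<lambda>h. h x) \<and> (\<forall>h\<in>?V. 0 \<le> h \<longrightarrow> 0 \<le> h x) \<and> f x \<noteq> 0 \<and>
      bounded ((\<lambda>h. h x) ` orbit G ?\<rho> f)"
  proof (intro conjI)
    have "(\<lambda>h. h x) ` orbit G ?\<rho> f \<subseteq> f ` carrier G \<union> {0}"
      unfolding orbit_restrict[OF fV] by (auto simp: translate_def)
    moreover have "bounded (f ` carrier G \<union> {0})" using f(1) by (simp add: l_infty_def)
    ultimately show "bounded ((\<lambda>h. h x) ` orbit G ?\<rho> f)" by (rule bounded_subset[rotated])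
  qed (use x in \<open>auto simp: linear_on_def le_fun_def\<close>)
  then have concl: "\<forall>(n::nat) t g. (\<forall>i<n. g i \<in> carrier G) \<and> 0 \<le> (\<Sum>i<n. t i *\<^sub>R ?\<rho> (g i) f) \<longrightarrow>
      0 \<le> (\<Sum>i<n. t i)"
    using assms order rep fV f(3) unfolding abstract_translate_property_def by blast
  show "translate_property_for G f"
    unfolding translate_property_for_def
  proof (intro allI impI, elim conjE)
    fix n :: nat and t g assume "\<forall>i<n. g i \<in> carrier G" "0 \<le> (\<Sum>i<n. t i *\<^sub>R translate G (g i) f)"
    moreover have "(\<Sum>i<n. t i *\<^sub>R ?\<rho> (g i) f) = (\<Sum>i<n. t i *\<^sub>R translate G (g i) f)"
      using fV by simp
    ultimately show "0 \<le> (\<Sum>i<n. t i)" by (intro concl[rule_format, of n g t] conjI) auto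
  qed
qed

text \<open>
  The function \<open>f x = \<delta> (\<rho> (inv x) v)\<close> is nonnegative, bounded and non-zero, and passing from
  vectors to such functions turns \<open>\<rho> g v\<close> into the translate of \<open>f\<close> by \<open>g\<close>.
\<close>
lemma (in group) abstract_of_translate_property:
  assumes trans: "translate_property G"
  shows "abstract_translate_property TYPE('v::real_vector) G"
  unfolding abstract_translate_property_def
proof (intro allI impI, elim conjE exE)
  fix V :: "'v set" and leq \<rho> v and n :: nat and t g \<delta>
  assume V: "ordered_vector_space_on V leq" and rep: "ordered_rep G V leq \<rho>"
    and v: "v \<in> V" "leq 0 v" and g: "\<forall>i<n. g i \<in> carrier G"
    and nonneg: "leq 0 (\<Sum>i<n. t i *\<^sub>R \<rho> (g i) v)"
    and \<delta>: "linear_on V \<delta>" "\<forall>x\<in>V. leq 0 x \<longrightarrow> 0 \<le> \<delta> x" "\<delta> v \<noteq> (0::real)"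
      "bounded (\<delta> ` orbit G \<rho> v)"
  have sub: "subspace V" using V by (simp add: ordered_vector_space_on_def)
  have lin: "linear_rep G V \<rho>" using rep by (simp add: ordered_rep_def)
  have pos: "0 \<le> \<delta> (\<rho> h x)" if "h \<in> carrier G" "x \<in> V" "leq 0 x" for h x
  proof -
    have "leq (\<rho> h 0) (\<rho> h x)"
      using rep that subspace_0[OF sub] by (simp add: ordered_rep_def)
    moreover have "\<rho> h 0 = 0"
      using linear_on_zero[OF sub linear_rep_linear_on[OF lin that(1)]] .
    ultimately show ?thesis using \<delta>(2) linear_rep_closed[OF lin that(1,2)] by simp
  qed
  define f where "f x = (if x \<in> carrier G then \<delta> (\<rho> (inv x) v) else 0)" for x
  have "f \<in> functions_on G" by (simp add: f_def functions_on_def)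
  moreover have "bounded (f ` carrier G)"
    by (rule bounded_subset[OF \<delta>(4)]) (auto simp: f_def orbit_def)
  moreover have "f \<one> \<noteq> 0"
    using \<delta>(3) linear_rep_one[OF lin v(1)] by (simp add: f_def)
  moreover have "0 \<le> f" using pos v by (simp add: le_fun_def f_def)
  ultimately have for_f: "translate_property_for G f"
    using trans by (auto simp: translate_property_def l_infty_def)
  have "0 \<le> (\<Sum>i<n. t i *\<^sub>R translate G (g i) f)"
    unfolding le_fun_def
  proof
    fix y
    show "0 y \<le> (\<Sum>i<n. t i *\<^sub>R translate G (g i) f) y"
    proof (cases "y \<in> carrier G")
      case True
      have in_V: "\<rho> (g i) v \<in> V" if "i \<in> {..<n}" for i
        using linear_rep_closed[OF lin] g that v(1) by simp
      have "translate G (g i) f y = \<delta> (\<rho> (inv y) (\<rho> (g i) v))" if "i < n" for i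
        using g that True v(1) linear_rep_mult[OF lin]
        by (simp add: translate_def f_def inv_mult_group)
      then have "(\<Sum>i<n. t i *\<^sub>R translate G (g i) f) y = (\<Sum>i<n. t i *\<^sub>R \<delta> (\<rho> (inv y) (\<rho> (g i) v)))"
        by simp
      also have "\<dots> = \<delta> (\<Sum>i<n. t i *\<^sub>R \<rho> (inv y) (\<rho> (g i) v))"
        by (rule linear_on_combination[OF sub \<delta>(1), symmetric])
          (use True in_V linear_rep_closed[OF lin] in auto)
      also have "(\<Sum>i<n. t i *\<^sub>R \<rho> (inv y) (\<rho> (g i) v)) = \<rho> (inv y) (\<Sum>i<n. t i *\<^sub>R \<rho> (g i) v)"
        by (rule linear_on_combination[OF sub linear_rep_linear_on[OF lin] in_V, symmetric])
          (use True in auto)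
      also have "0 \<le> \<delta> \<dots>"
        using True nonneg in_V by (intro pos) (auto intro!: subspace_sum subspace_mul sub)
      finally show ?thesis by simp
    qed (simp add: translate_def)
  qed
  with g show "0 \<le> (\<Sum>i<n. t i)"
    by (intro for_f[unfolded translate_property_for_def, rule_format, of n g t] conjI)
qed

section \<open>Domination and integrals\<close>

text \<open>
  Lists of group elements are closed under concatenation, which makes sums and integer multiples
  of dominated elements easy to handle.
\<close>
lemma G_dominates_dual_le_iff:
  "G_dominates G (dual_le C) act \<phi> \<psi> \<longleftrightarrow>
     (\<exists>gs. set gs \<subseteq> carrier G \<and> (\<forall>c\<in>C. \<bar>\<psi> c\<bar> \<le> (\<Sum>g\<leftarrow>gs. act g \<phi> c)))"
    (is "?L \<longleftrightarrow> ?R")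
proof
  assume ?L
  then obtain n :: nat and g where g: "\<forall>i<n. g i \<in> carrier G"
    and le: "dual_le C \<psi> (\<Sum>i<n. act (g i) \<phi>)" "dual_le C (- \<psi>) (\<Sum>i<n. act (g i) \<phi>)"
    unfolding G_dominates_def by blast
  have "(\<Sum>h\<leftarrow>map g [0..<n]. act h \<phi> c) = (\<Sum>i<n. act (g i) \<phi> c)" for c
    by (simp add: interv_sum_list_conv_sum_set_nat lessThan_atLeast0 comp_def)
  then show ?R
    using g le by (intro exI[of _ "map g [0..<n]"]) (auto simp: dual_le_def abs_le_iff)
next
  assume ?R
  then obtain gs where gs: "set gs \<subseteq> carrier G" "\<forall>c\<in>C. \<bar>\<psi> c\<bar> \<le> (\<Sum>g\<leftarrow>gs. act g \<phi> c)" by blast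
  have "(\<Sum>g\<leftarrow>gs. act g \<phi> c) = (\<Sum>i<length gs. act (gs ! i) \<phi> c)" for c
    by (simp add: sum_list_sum_nth lessThan_atLeast0)
  moreover have "\<forall>i<length gs. gs ! i \<in> carrier G" using gs(1) nth_mem by blast
  ultimately show ?L
    unfolding G_dominates_def using gs(2)
    by (intro exI[of _ "length gs"] exI[of _ "(!) gs"]) (auto simp: dual_le_def abs_le_iff)
qed

text \<open>
  The pointwise order is the dual order for the cone of all points.
\<close>
lemma G_dominates_le_iff:
  fixes f h :: "'a \<Rightarrow> real"
  shows "G_dominates G (\<le>) act f h \<longleftrightarrow>
     (\<exists>gs. set gs \<subseteq> carrier G \<and> (\<forall>x. \<bar>h x\<bar> \<le> (\<Sum>g\<leftarrow>gs. act g f x)))"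
proof -
  have eq: "(\<le>) = dual_le (UNIV :: 'a set)" by (auto simp: dual_le_def le_fun_def fun_eq_iff)
  show ?thesis unfolding eq G_dominates_dual_le_iff by simp
qed

text \<open>
  An element bounded by a multiple of a finite sum of dominated elements is dominated: concatenate
  the dominating lists and repeat the result more than \<open>M\<close> times. This gives the linear structure of
  the dominated functions and is also how arbitrary continuous functionals are dominated in a weak
  topology.
\<close>
lemma dominated_of_bound:
  assumes J: "finite J"
    and dom: "\<And>j. j \<in> J \<Longrightarrow> \<exists>gs. set gs \<subseteq> A \<and> (\<forall>c\<in>C. \<bar>\<psi>' j c\<bar> \<le> (\<Sum>g\<leftarrow>gs. (F g c :: real)))"
    and bound: "\<And>c. c \<in> C \<Longrightarrow> \<bar>\<psi> c\<bar> \<le> M * (\<Sum>j\<in>J. \<bar>\<psi>' j c\<bar>)"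
  shows "\<exists>gs. set gs \<subseteq> A \<and> (\<forall>c\<in>C. \<bar>\<psi> c\<bar> \<le> (\<Sum>g\<leftarrow>gs. F g c))"
proof -
  have "\<exists>gs. set gs \<subseteq> A \<and> (\<forall>c\<in>C. (\<Sum>j\<in>J. \<bar>\<psi>' j c\<bar>) \<le> (\<Sum>g\<leftarrow>gs. F g c))"
    using J dom
  proof (induction J rule: finite_induct)
    case (insert j J)
    obtain gs where gs: "set gs \<subseteq> A" "\<forall>c\<in>C. (\<Sum>j\<in>J. \<bar>\<psi>' j c\<bar>) \<le> (\<Sum>g\<leftarrow>gs. F g c)"
      using insert by blast
    obtain hs where hs: "set hs \<subseteq> A" "\<forall>c\<in>C. \<bar>\<psi>' j c\<bar> \<le> (\<Sum>g\<leftarrow>hs. F g c)"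
      using insert by blast
    show ?case
      using gs hs insert.hyps by (intro exI[of _ "hs @ gs"]) (auto intro: add_mono)
  qed (auto intro: exI[of _ "[]"])
  then obtain gs where gs: "set gs \<subseteq> A" "\<forall>c\<in>C. (\<Sum>j\<in>J. \<bar>\<psi>' j c\<bar>) \<le> (\<Sum>g\<leftarrow>gs. F g c)" by blast
  obtain k :: nat where k: "M \<le> real k" using real_arch_simple by blast
  have mult: "(\<Sum>g\<leftarrow>concat (replicate k gs). F g c) = real k * (\<Sum>g\<leftarrow>gs. F g c)" for c
    by (induction k) (simp_all add: algebra_simps)
  show ?thesis
  proof (intro exI[of _ "concat (replicate k gs)"] conjI ballI)
    fix c assume c: "c \<in> C"
    have "\<bar>\<psi> c\<bar> \<le> real k * (\<Sum>j\<in>J. \<bar>\<psi>' j c\<bar>)"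
      by (rule order_trans[OF bound[OF c] mult_right_mono[OF k]]) (simp add: sum_nonneg)
    also have "\<dots> \<le> real k * (\<Sum>g\<leftarrow>gs. F g c)"
      using gs(2) c by (intro mult_left_mono) auto
    finally show "\<bar>\<psi> c\<bar> \<le> (\<Sum>g\<leftarrow>concat (replicate k gs). F g c)" by (simp add: mult)
  qed (use gs(1) in auto)
qed

lemma l_infty_dominated_iff:
  "h \<in> l_infty_dominated G f \<longleftrightarrow> h \<in> functions_on G \<and>
     (\<exists>gs. set gs \<subseteq> carrier G \<and> (\<forall>x. \<bar>h x\<bar> \<le> (\<Sum>g\<leftarrow>gs. translate G g f x)))"
  by (simp add: l_infty_dominated_def G_dominates_le_iff)

lemma subspace_l_infty_dominated: "subspace (l_infty_dominated G f)"
proof (rule subspaceI)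
  show "0 \<in> l_infty_dominated G f"
    unfolding l_infty_dominated_iff by (auto simp: functions_on_def intro: exI[of _ "[]"])
next
  fix h k assume hk: "h \<in> l_infty_dominated G f" "k \<in> l_infty_dominated G f"
  have "\<exists>gs. set gs \<subseteq> carrier G \<and> (\<forall>x\<in>UNIV. \<bar>(h + k) x\<bar> \<le> (\<Sum>g\<leftarrow>gs. translate G g f x))"
    by (rule dominated_of_bound[where J = "UNIV :: bool set" and \<psi>' = "\<lambda>b. if b then h else k" and M = 1])
      (use hk in \<open>auto simp: l_infty_dominated_iff UNIV_bool\<close>)
  then show "h + k \<in> l_infty_dominated G f"
    using hk by (auto simp: l_infty_dominated_iff functions_on_def)
next
  fix c :: real and h assume h: "h \<in> l_infty_dominated G f"
  have "\<exists>gs. set gs \<subseteq> carrier G \<and> (\<forall>x\<in>UNIV. \<bar>(c *\<^sub>R h) x\<bar> \<le> (\<Sum>g\<leftarrow>gs. translate G g f x))"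
    by (rule dominated_of_bound[where J = "UNIV :: unit set" and \<psi>' = "\<lambda>_. h" and M = "\<bar>c\<bar>"])
      (use h in \<open>auto simp: l_infty_dominated_iff abs_mult\<close>)
  then show "c *\<^sub>R h \<in> l_infty_dominated G f"
    using h by (auto simp: l_infty_dominated_iff functions_on_def)
qed

lemma l_infty_dominated_bounded:
  assumes "h \<in> l_infty_dominated G f" "f \<in> l_infty G"
  obtains M where "\<And>x. \<bar>h x\<bar> \<le> M"
proof -
  obtain gs where gs: "\<And>x. \<bar>h x\<bar> \<le> (\<Sum>g\<leftarrow>gs. translate G g f x)"
    using assms(1) by (auto simp: l_infty_dominated_iff)
  obtain M where M: "\<And>y. y \<in> carrier G \<Longrightarrow> \<bar>f y\<bar> \<le> M"
    using assms(2) by (auto simp: l_infty_def bounded_iff)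
  have "f y \<le> max M 0" for y
    using M[of y] assms(2) by (cases "y \<in> carrier G") (auto simp: l_infty_def functions_on_def)
  then have "translate G g f x \<le> max M 0" for g x
    by (simp add: translate_def)
  then have "(\<Sum>g\<leftarrow>gs. translate G g f x) \<le> (\<Sum>g\<leftarrow>gs. max M 0)" for x
    by (intro sum_list_mono)
  then show ?thesis using gs that order_trans by blast
qed

context group
begin

lemma translate_mem_l_infty_dominated:
  assumes "h \<in> l_infty_dominated G f" "g \<in> carrier G"
  shows "translate G g h \<in> l_infty_dominated G f"
proof -
  obtain gs where gs: "set gs \<subseteq> carrier G" "\<And>x. \<bar>h x\<bar> \<le> (\<Sum>g\<leftarrow>gs. translate G g f x)"
    using assms(1) by (auto simp: l_infty_dominated_iff)
  have "\<bar>translate G g h x\<bar> \<le> (\<Sum>k\<leftarrow>map ((\<otimes>) g) gs. translate G k f x)" for x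
  proof (cases "x \<in> carrier G")
    case True
    have "translate G (g \<otimes> k) f x = translate G k f (inv g \<otimes> x)" if "k \<in> set gs" for k
      using that gs(1) assms(2) True translate_translate[of g k f, symmetric] by (simp add: translate_apply subset_iff)
    then have "(\<Sum>k\<leftarrow>map ((\<otimes>) g) gs. translate G k f x) = (\<Sum>k\<leftarrow>gs. translate G k f (inv g \<otimes> x))"
      by (simp add: comp_def cong: map_cong)
    then show ?thesis using True gs(2)[of "inv g \<otimes> x"] by (simp add: translate_apply)
  next
    case False
    then have "(\<Sum>k\<leftarrow>ks. translate G k f x) = 0" for ks by (induction ks) (auto simp: translate_def)
    then show ?thesis using False by (simp add: translate_def)
  qed
  moreover have "set (map ((\<otimes>) g) gs) \<subseteq> carrier G" using gs(1) assms(2) by auto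
  ultimately show ?thesis unfolding l_infty_dominated_iff by (metis translate_functions_on)
qed

lemma self_mem_l_infty_dominated:
  assumes "f \<in> functions_on G" "0 \<le> f"
  shows "f \<in> l_infty_dominated G f"
  unfolding l_infty_dominated_iff
  using assms by (auto intro!: exI[of _ "[\<one>]"] simp: translate_one le_fun_def)

text \<open>
  A normalised integral has the value \<open>1\<close> at every translate of \<open>f\<close>, so a combination of the
  translates is sent to the sum of its coefficients.
\<close>
lemma translate_property_of_integrals:
  assumes int: "\<forall>f\<in>l_infty G. f \<noteq> 0 \<and> 0 \<le> f \<longrightarrow> (\<exists>\<mu>. normalised_integral G f \<mu>)"
  shows "translate_property G"
  unfolding translate_property_def translate_property_for_def
proof (intro ballI impI allI, elim conjE)
  fix f n t g
  assume f: "f \<in> l_infty G" "f \<noteq> 0" "0 \<le> f" and g: "\<forall>i<(n::nat). g i \<in> carrier G"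
    and nonneg: "0 \<le> (\<Sum>i<n. t i *\<^sub>R translate G (g i) f)"
  let ?V = "l_infty_dominated G f"
  obtain \<mu> where \<mu>: "normalised_integral G f \<mu>" using int f by blast
  have fV: "f \<in> ?V" using f by (intro self_mem_l_infty_dominated) (auto simp: l_infty_def)
  have tr: "translate G (g i) f \<in> ?V" if "i \<in> {..<n}" for i
    using translate_mem_l_infty_dominated[OF fV] g that by simp
  have "0 \<le> \<mu> (\<Sum>i<n. t i *\<^sub>R translate G (g i) f)"
    using \<mu> nonneg tr by (auto simp: normalised_integral_def intro!: subspace_sum subspace_mul subspace_l_infty_dominated)
  also have "\<dots> = (\<Sum>i<n. t i *\<^sub>R \<mu> (translate G (g i) f))"
    by (rule linear_on_combination[OF subspace_l_infty_dominated _ tr]) (use \<mu> in \<open>auto simp: normalised_integral_def\<close>)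
  also have "\<dots> = (\<Sum>i<n. t i)"
    using \<mu> g fV by (simp add: normalised_integral_def)
  finally show "0 \<le> (\<Sum>i<n. t i)" .
qed

end

section \<open>Weak topologies and separation by functionals\<close>

lemma topspace_weak_topology: "topspace (weak_topology E T) = E"
proof -
  have "(\<lambda>_. 0) \<in> top_dual E T" by (simp add: top_dual_def linear_on_def)
  then have "E \<in> {{x \<in> E. \<phi> x \<in> U} |\<phi> U. \<phi> \<in> top_dual E T \<and> open U}"
    by (auto intro!: exI[of _ "\<lambda>_. 0"] exI[of _ UNIV])
  then show ?thesis
    unfolding weak_topology_def topology_generated_by_topspace by auto
qed

lemma limitin_weak_topologyI:
  assumes l: "l \<in> E" and E: "eventually (\<lambda>x. g x \<in> E) F"
    and lim: "\<And>\<phi>. \<phi> \<in> top_dual E T \<Longrightarrow> ((\<lambda>x. \<phi> (g x)) \<longlongrightarrow> \<phi> l) F"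
  shows "limitin (weak_topology E T) g l F"
  unfolding limitin_def topspace_weak_topology
proof (intro conjI allI impI l, elim conjE)
  fix W assume "openin (weak_topology E T) W" "l \<in> W"
  then have "generate_topology_on {{x \<in> E. \<phi> x \<in> U} |\<phi> U. \<phi> \<in> top_dual E T \<and> open U} W"
    by (simp add: weak_topology_def openin_topology_generated_by_iff)
  then show "eventually (\<lambda>x. g x \<in> W) F" using \<open>l \<in> W\<close>
  proof (induction W rule: generate_topology_on.induct)
    case (UN K)
    then obtain W where "W \<in> K" "l \<in> W" by blast
    then show ?case using UN.IH[of W] by (auto elim: eventually_mono)
  next
    case (Basis W)
    then obtain \<phi> U where W: "W = {x \<in> E. \<phi> x \<in> U}" "\<phi> \<in> top_dual E T" "open U" by blast
    then have "eventually (\<lambda>x. \<phi> (g x) \<in> U) F"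
      using lim[of \<phi>] Basis.prems by (intro topological_tendstoD) auto
    then show ?case using E by eventually_elim (simp add: W(1))
  qed (auto simp: eventually_conj_iff)
qed

lemma limitin_weak_topologyD:
  assumes "limitin (weak_topology E T) g l F" "\<phi> \<in> top_dual E T"
  shows "((\<lambda>x. \<phi> (g x)) \<longlongrightarrow> \<phi> l) F"
proof (rule topological_tendstoI)
  fix U assume U: "open U" "\<phi> l \<in> U"
  have "openin (weak_topology E T) {x \<in> E. \<phi> x \<in> U}"
    unfolding weak_topology_def using assms(2) U
    by (intro topology_generated_by_Basis) blast
  moreover have "l \<in> E" using limitin_topspace[OF assms(1)] by (simp add: topspace_weak_topology)
  ultimately have "eventually (\<lambda>x. g x \<in> {x \<in> E. \<phi> x \<in> U}) F"
    using limitinD[OF assms(1)] U by blast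
  then show "eventually (\<lambda>x. \<phi> (g x) \<in> U) F" by eventually_elim simp
qed

lemma continuous_map_affine:
  assumes T: "lc_tvs_on E T" and z: "z \<in> E"
  shows "continuous_map T T (\<lambda>y. c *\<^sub>R y + z)"
proof -
  have top: "topspace T = E"
    and add: "continuous_map (prod_topology T T) T (\<lambda>(x, y). x + y)"
    and mult: "continuous_map (prod_topology euclideanreal T) T (\<lambda>(c, x). c *\<^sub>R x)"
    using T by (auto simp: lc_tvs_on_def)
  have "continuous_map T (prod_topology euclideanreal T) (\<lambda>y. (c, y))"
    by (intro continuous_map_pairedI) auto
  from continuous_map_compose[OF this mult]
  have "continuous_map T T (\<lambda>y. c *\<^sub>R y)" by (simp add: comp_def)
  then have "continuous_map T (prod_topology T T) (\<lambda>y. (c *\<^sub>R y, z))"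
    by (intro continuous_map_pairedI) (auto simp: top z)
  from continuous_map_compose[OF this add] show ?thesis by (simp add: comp_def)
qed

lemma continuous_map_scaleR_left:
  assumes T: "lc_tvs_on E T" and z: "z \<in> E"
  shows "continuous_map euclideanreal T (\<lambda>c. c *\<^sub>R z)"
proof -
  have top: "topspace T = E"
    and mult: "continuous_map (prod_topology euclideanreal T) T (\<lambda>(c, x). c *\<^sub>R x)"
    using T by (auto simp: lc_tvs_on_def)
  have "continuous_map euclideanreal (prod_topology euclideanreal T) (\<lambda>c. (c, z))"
    by (intro continuous_map_pairedI) (auto simp: top z)
  from continuous_map_compose[OF this mult] show ?thesis by (simp add: comp_def)
qed

text \<open>
  The gauge \<open>p\<close> of a convex neighbourhood \<open>V\<close> of the origin that misses \<open>z\<close> is sublinear with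
  \<open>p z \<ge> 1\<close>. A linear functional below \<open>p\<close> is at most \<open>1\<close> on \<open>V\<close>, hence
  continuous, and Hahn-Banach gives one that agrees with \<open>p\<close> at \<open>z\<close>.
\<close>
lemma top_dual_separates:
  fixes T :: "'e::real_vector topology"
  assumes T: "lc_tvs_on E T" and z: "z \<in> E" "z \<noteq> 0"
  obtains \<phi> where "\<phi> \<in> top_dual E T" "\<phi> z \<noteq> 0"
proof -
  have sub: "subspace E" and top: "topspace T = E" and haus: "Hausdorff_space T"
    and nbhd: "neighbourhood_base_of convex T"
    using T by (auto simp: lc_tvs_on_def)
  have zero: "0 \<in> E" by (rule subspace_0[OF sub])
  obtain U1 W1 where UW: "openin T U1" "openin T W1" "0 \<in> U1" "z \<in> W1" "disjnt U1 W1"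
    using haus zero z unfolding Hausdorff_space_def top by metis
  then have "z \<notin> U1" by (auto simp: disjnt_def)
  obtain N V where N: "openin T N" "0 \<in> N" "N \<subseteq> V" and V: "convex V" "V \<subseteq> U1"
    using nbhd UW(1,3) unfolding neighbourhood_base_of by meson
  have zV: "z \<notin> V" and VE: "V \<subseteq> E" and V0: "0 \<in> V"
    using V N \<open>z \<notin> U1\<close> openin_subset[OF UW(1)] by (auto simp: top)
  have absorb: "\<exists>t>0. (1 / t) *\<^sub>R x \<in> V" if x: "x \<in> E" for x
  proof -
    have "open {c. c *\<^sub>R x \<in> N}"
      using openin_continuous_map_preimage[OF continuous_map_scaleR_left[OF T x] N(1)] by simp
    moreover have "0 \<in> {c. c *\<^sub>R x \<in> N}" using N by simp
    ultimately obtain e where e: "0 < e" "\<forall>c. dist c 0 < e \<longrightarrow> c \<in> {c. c *\<^sub>R x \<in> N}"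
      unfolding open_dist by blast
    have "e / 2 \<in> {c. c *\<^sub>R x \<in> N}"
      using e by (intro e(2)[rule_format]) (simp add: dist_real_def)
    then have "(e / 2) *\<^sub>R x \<in> V" using N by blast
    then show ?thesis using e(1) by (intro exI[of _ "2 / e"]) simp
  qed
  \<comment> \<open>A linear projection onto \<open>E\<close> extends the gauge to the whole ambient type.\<close>
  have "linear (id :: 'e \<Rightarrow> 'e)" by (rule linear_id)
  then obtain \<pi> :: "'e \<Rightarrow> 'e" where \<pi>: "\<pi> ` UNIV \<subseteq> E" "linear \<pi>" "\<And>x. x \<in> E \<Longrightarrow> \<pi> x = x"
    using linear_exists_left_inverse_on[of id E] sub by auto
  define p where "p x = Inf {t. 0 < t \<and> (1 / t) *\<^sub>R \<pi> x \<in> V}" for x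
  have lower: "p x \<le> t" if "0 < t" "(1 / t) *\<^sub>R \<pi> x \<in> V" for t x
    unfolding p_def by (rule cInf_lower) (use that in \<open>auto intro!: bdd_belowI[of _ 0]\<close>)
  have greatest: "d \<le> p x" if "\<And>t. 0 < t \<Longrightarrow> (1 / t) *\<^sub>R \<pi> x \<in> V \<Longrightarrow> d \<le> t" for d x
    unfolding p_def using absorb[of "\<pi> x"] \<pi>(1) by (intro cInf_greatest) (use that in auto)
  have "sublinear p"
    unfolding sublinear_def
  proof (intro conjI allI impI)
    fix x y
    have "p (x + y) - p y \<le> p x"
    proof (rule greatest)
      fix s :: real assume s: "0 < s" "(1 / s) *\<^sub>R \<pi> x \<in> V"
      have "p (x + y) - s \<le> p y"
      proof (rule greatest)
        fix t :: real assume t: "0 < t" "(1 / t) *\<^sub>R \<pi> y \<in> V"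
        have "(s / (s + t)) *\<^sub>R ((1 / s) *\<^sub>R \<pi> x) + (t / (s + t)) *\<^sub>R ((1 / t) *\<^sub>R \<pi> y) \<in> V"
          by (rule convexD[OF V(1) s(2) t(2)]) (use s(1) t(1) in \<open>auto simp flip: add_divide_distrib\<close>)
        then have "(1 / (s + t)) *\<^sub>R \<pi> (x + y) \<in> V"
          using s(1) t(1) by (simp add: linear_add[OF \<pi>(2)] scaleR_add_right)
        then have "p (x + y) \<le> s + t" by (rule lower[rotated]) (use s(1) t(1) in simp)
        then show "p (x + y) - s \<le> t" by simp
      qed
      then show "p (x + y) - p y \<le> s" by simp
    qed
    then show "p (x + y) \<le> p x + p y" by simp
  next
    fix c :: real and x assume c: "0 \<le> c"
    show "p (c *\<^sub>R x) \<le> c * p x"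
    proof (cases "c = 0")
      case True
      have "p 0 \<le> 0"
      proof (rule field_le_epsilon)
        fix e :: real assume "0 < e"
        then show "p 0 \<le> 0 + e" using lower[of e 0] V0 by (simp add: linear_0[OF \<pi>(2)])
      qed
      then show ?thesis using True by simp
    next
      case False
      have "p (c *\<^sub>R x) / c \<le> p x"
      proof (rule greatest)
        fix t :: real assume t: "0 < t" "(1 / t) *\<^sub>R \<pi> x \<in> V"
        have "p (c *\<^sub>R x) \<le> c * t"
          by (rule lower) (use t c False in \<open>auto simp: linear_cmul[OF \<pi>(2)]\<close>)
        then show "p (c *\<^sub>R x) / c \<le> t" using c False by (simp add: field_simps)
      qed
      then show ?thesis using c False by (simp add: field_simps)
    qed
  qed
  then obtain l where l: "linear l" "\<And>x. l x \<le> p x" "l z = p z"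
    using Hahn_Banach by blast
  have "1 \<le> p z"
  proof (rule greatest)
    fix t :: real assume t: "0 < t" "(1 / t) *\<^sub>R \<pi> z \<in> V"
    show "1 \<le> t"
    proof (rule ccontr)
      assume "\<not> 1 \<le> t"
      then have "t *\<^sub>R ((1 / t) *\<^sub>R \<pi> z) + (1 - t) *\<^sub>R 0 \<in> V"
        by (intro convexD[OF V(1) t(2) V0]) (use t(1) in auto)
      then show False using t(1) zV z by (simp add: \<pi>(3))
    qed
  qed
  then have "l z \<noteq> 0" using l(3) by simp
  moreover have "l \<in> top_dual E T"
    unfolding top_dual_def
  proof (intro CollectI conjI)
    show "linear_on E l" by (simp add: linear_on_def linear_add[OF l(1)] linear_cmul[OF l(1)])
    show "continuous_map T euclideanreal l"
      unfolding continuous_map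
    proof (intro conjI allI impI)
      fix S :: "real set" assume "openin euclideanreal S"
      then have S: "open S" by simp
      show "openin T {x \<in> topspace T. l x \<in> S}"
      proof (subst openin_subopen, intro ballI)
        fix x assume x: "x \<in> {x \<in> topspace T. l x \<in> S}"
        then have xE: "x \<in> E" by (simp add: top)
        obtain e where e: "0 < e" "\<And>r. \<bar>r - l x\<bar> < e \<Longrightarrow> r \<in> S"
          using x S unfolding open_dist by (auto simp: dist_real_def)
        define k where "k = 2 / e"
        have k: "0 < k" "1 / k < e" using e by (auto simp: k_def)
        define M where "M = {y \<in> E. k *\<^sub>R y + (- k) *\<^sub>R x \<in> N} \<inter> {y \<in> E. (- k) *\<^sub>R y + k *\<^sub>R x \<in> N}"
        have op: "openin T {y \<in> E. c *\<^sub>R y + w \<in> N}" if "w \<in> E" for c w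
          using openin_continuous_map_preimage[OF continuous_map_affine[OF T that] N(1)] by (simp add: top)
        have "openin T M"
          unfolding M_def by (intro openin_Int op subspace_mul[OF sub xE])
        moreover have "x \<in> M" using xE N by (simp add: M_def)
        moreover have "M \<subseteq> {x \<in> topspace T. l x \<in> S}"
        proof
          fix y assume y: "y \<in> M"
          have yE: "y \<in> E" and V12: "k *\<^sub>R (y - x) \<in> V" "k *\<^sub>R (x - y) \<in> V"
            using y N by (auto simp: M_def scaleR_diff_right)
          have "\<pi> (y - x) = y - x" "\<pi> (x - y) = x - y"
            using xE yE sub by (auto intro!: \<pi>(3) subspace_diff)
          then have "p (y - x) \<le> 1 / k" "p (x - y) \<le> 1 / k"
            using lower[of "1 / k" "y - x"] lower[of "1 / k" "x - y"] V12 k by auto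
          then have "l (y - x) \<le> 1 / k" "l (x - y) \<le> 1 / k"
            using l(2)[of "y - x"] l(2)[of "x - y"] by linarith+
          then have "\<bar>l y - l x\<bar> < e" using k(2) by (simp add: linear_diff[OF l(1)] abs_le_iff)
          then show "y \<in> {x \<in> topspace T. l x \<in> S}" using e(2) yE by (simp add: top)
        qed
        ultimately show "\<exists>M. openin T M \<and> x \<in> M \<and> M \<subseteq> {x \<in> topspace T. l x \<in> S}" by blast
      qed
    qed simp
  qed
  ultimately show ?thesis by (rule that[rotated])
qed

section \<open>The filter of almost invariant functions\<close>

definition displacement :: "('g, 'm) monoid_scheme \<Rightarrow> ('g \<Rightarrow> real) \<Rightarrow> 'g \<Rightarrow> ('g \<Rightarrow> real) \<Rightarrow> real" where
  "displacement G f s u = pairing (\<lambda>x. \<bar>translate G s u x - u x\<bar>) f"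

definition almost_invariant :: "('g, 'm) monoid_scheme \<Rightarrow> ('g \<Rightarrow> real) \<Rightarrow> 'g \<Rightarrow> real \<Rightarrow> ('g \<Rightarrow> real) set" where
  "almost_invariant G f s \<epsilon> =
     {u \<in> finitely_supported G. (\<forall>x. 0 \<le> u x) \<and> 0 < pairing u f \<and> displacement G f s u < \<epsilon> * pairing u f}"

text \<open>
  The filter on finitely supported functions along which all limits are taken: a property holds
  eventually if it holds for all nonnegative functions of positive weight that are sufficiently
  invariant under finitely many group elements.
\<close>
definition Reiter_filter :: "('g, 'm) monoid_scheme \<Rightarrow> ('g \<Rightarrow> real) \<Rightarrow> ('g \<Rightarrow> real) filter" where
  "Reiter_filter G f = (INF (s, \<epsilon>)\<in>carrier G \<times> {0<..}. principal (almost_invariant G f s \<epsilon>))"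

lemma eventually_Reiter_filter:
  "s \<in> carrier G \<Longrightarrow> 0 < \<epsilon> \<Longrightarrow> eventually (\<lambda>u. u \<in> almost_invariant G f s \<epsilon>) (Reiter_filter G f)"
  unfolding Reiter_filter_def
  by (rule eventually_INF1[of "(s, \<epsilon>)"]) (auto simp: eventually_principal)

context group
begin

text \<open>
  Passing from \<open>u\<close> to its absolute value keeps the weighted norm and does not increase
  displacements, so the functions given by the Reiter property may be taken nonnegative.
\<close>
lemma Reiter_filter_neq_bot:
  assumes R: "reiter_property G f" and f: "\<And>x. 0 \<le> f x"
  shows "Reiter_filter G f \<noteq> bot"
  unfolding Reiter_filter_def
proof (rule INF_filter_not_bot)
  fix X assume X: "X \<subseteq> carrier G \<times> {0<..}" "finite (X :: ('a \<times> real) set)"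
  \<comment> \<open>The identity makes \<open>S\<close> nonempty; the strict inequality for it then yields positive mass even
    when \<open>X\<close> is empty.\<close>
  define S where "S = insert \<one> (fst ` X)"
  define \<epsilon> where "\<epsilon> = Min (insert 1 (snd ` X))"
  have S: "finite S" "S \<subseteq> carrier G" using X by (auto simp: S_def)
  have \<epsilon>: "0 < \<epsilon>" unfolding \<epsilon>_def using X by (subst Min_gr_iff) auto
  obtain u where u: "u \<in> functions_on G" "finite {x. u x \<noteq> 0}"
    and norm: "\<And>s. s \<in> S \<Longrightarrow> l1_norm G ((translate G s u - u) * f) < \<epsilon> * l1_norm G (u * f)"
    using R S \<epsilon> unfolding reiter_property_def by metis
  have fin: "u \<in> finitely_supported G" using u by (simp add: finitely_supported_def)
  let ?v = "\<lambda>x. \<bar>u x\<bar>"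
  have v: "?v \<in> finitely_supported G" by (rule finitely_supported_abs[OF fin])
  have mass: "l1_norm G (u * f) = pairing ?v f"
    using l1_norm_eq_pairing[OF fin, of f] f by simp
  have disp: "displacement G f s ?v < \<epsilon> * pairing ?v f" if s: "s \<in> S" for s
  proof -
    have sG: "s \<in> carrier G" using s S by blast
    have d: "translate G s u - u \<in> finitely_supported G"
      using finitely_supported_diff[OF finitely_supported_translate[OF fin sG] fin] .
    have dv: "translate G s ?v - ?v \<in> finitely_supported G"
      using finitely_supported_diff[OF finitely_supported_translate[OF v sG] v] .
    have "displacement G f s ?v \<le> pairing (\<lambda>x. \<bar>(translate G s u - u) x\<bar>) f"
      unfolding displacement_def
    proof (rule pairing_mono_left)
      show "(\<lambda>x. \<bar>translate G s ?v x - \<bar>u x\<bar>\<bar>) \<in> finitely_supported G"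
        using finitely_supported_abs[OF dv] by simp
      show "(\<lambda>x. \<bar>(translate G s u - u) x\<bar>) \<in> finitely_supported G"
        by (rule finitely_supported_abs[OF d])
    qed (auto simp: translate_abs f)
    also have "\<dots> = l1_norm G ((translate G s u - u) * f)"
      using l1_norm_eq_pairing[OF d, of f] f by simp
    also have "\<dots> < \<epsilon> * pairing ?v f" using norm[OF s] by (simp add: mass)
    finally show ?thesis .
  qed
  have "0 \<le> displacement G f \<one> ?v"
    unfolding displacement_def by (rule pairing_nonneg) (auto simp: f)
  then have pos: "0 < pairing ?v f"
    using disp[of \<one>] \<epsilon> by (metis S_def insertI1 le_less_trans zero_less_mult_pos)
  have "?v \<in> almost_invariant G f s e" if "(s, e) \<in> X" for s e
  proof -
    have "\<epsilon> \<le> e" unfolding \<epsilon>_def using X that by (intro Min_le) force+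
    then have "\<epsilon> * pairing ?v f \<le> e * pairing ?v f" using pos by simp
    moreover have "s \<in> S" using that by (force simp: S_def)
    ultimately have "displacement G f s ?v < e * pairing ?v f"
      using disp[of s] by (meson less_le_trans)
    then show ?thesis using v pos by (auto simp: almost_invariant_def)
  qed
  then have "?v \<in> (\<Inter>(s, e)\<in>X. almost_invariant G f s e)" by auto
  moreover have "(INF (s, \<epsilon>)\<in>X. principal (almost_invariant G f s \<epsilon>)) = principal (\<Inter>(s, e)\<in>X. almost_invariant G f s e)"
    using INF_principal_finite[OF X(2), of "\<lambda>(s, e). almost_invariant G f s e"] by (simp add: case_prod_unfold)
  ultimately show "(INF (s, \<epsilon>)\<in>X. principal (almost_invariant G f s \<epsilon>)) \<noteq> bot"
    by (metis empty_iff principal_eq_bot_iff)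
qed

text \<open>
  Translating the weight by \<open>k\<close> amounts to translating the function by \<open>inv k\<close>, and the result is
  compared with \<open>u\<close> by the triangle inequality. Hence almost invariance for the weight \<open>f\<close> passes to
  the translates of \<open>f\<close>, and so to everything dominated by \<open>f\<close>.
\<close>
lemma displacement_translate_le:
  assumes u: "u \<in> finitely_supported G" and g: "g \<in> carrier G" "k \<in> carrier G" and f: "\<And>x. 0 \<le> f x"
  shows "pairing (\<lambda>x. \<bar>translate G g u x - u x\<bar>) (translate G k f)
    \<le> displacement G f (inv k \<otimes> g) u + displacement G f (inv k) u"
proof -
  note tr = finitely_supported_translate[OF u]
  let ?d = "\<lambda>s. (\<lambda>x. \<bar>(translate G s u - u) x\<bar>)"
  have fin: "?d s \<in> finitely_supported G" if "s \<in> carrier G" for s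
    by (rule finitely_supported_abs[OF finitely_supported_diff[OF tr[OF that] u]])
  have "pairing (?d g) (translate G k f) = pairing (translate G (inv k) (?d g)) f"
    by (rule pairing_translate_right[OF fin[OF g(1)] g(2)])
  also have "translate G (inv k) (?d g) = (\<lambda>x. \<bar>translate G (inv k \<otimes> g) u x - translate G (inv k) u x\<bar>)"
    unfolding translate_abs translate_diff using g by (simp add: translate_translate)
  also have "pairing \<dots> f \<le> pairing (?d (inv k \<otimes> g) + ?d (inv k)) f"
  proof (rule pairing_mono_left)
    have "translate G (inv k \<otimes> g) u - translate G (inv k) u \<in> finitely_supported G"
      using g by (intro finitely_supported_diff tr) auto
    from finitely_supported_abs[OF this]
    show "(\<lambda>x. \<bar>translate G (inv k \<otimes> g) u x - translate G (inv k) u x\<bar>) \<in> finitely_supported G" by simp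
    show "?d (inv k \<otimes> g) + ?d (inv k) \<in> finitely_supported G"
      using g by (intro finitely_supported_add fin) auto
  qed (auto simp: f)
  also have "\<dots> = pairing (?d (inv k \<otimes> g)) f + pairing (?d (inv k)) f"
    using g by (intro pairing_add_left[of _ G] fin) auto
  finally show ?thesis by (simp add: displacement_def)
qed

lemma pairing_translate_le:
  assumes u: "u \<in> finitely_supported G" and k: "k \<in> carrier G" and f: "\<And>x. 0 \<le> f x"
  shows "pairing u (translate G k f) \<le> pairing u f + displacement G f (inv k) u"
proof -
  let ?t = "translate G (inv k) u"
  have t: "?t \<in> finitely_supported G" using finitely_supported_translate[OF u] k by simp
  have d: "(\<lambda>x. \<bar>(?t - u) x\<bar>) \<in> finitely_supported G"
    by (rule finitely_supported_abs[OF finitely_supported_diff[OF t u]])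
  have "pairing u (translate G k f) = pairing ?t f" by (rule pairing_translate_right[OF u k])
  also have "\<dots> \<le> pairing (u + (\<lambda>x. \<bar>(?t - u) x\<bar>)) f"
    by (rule pairing_mono_left[OF t finitely_supported_add[OF u d]]) (auto simp: f)
  also have "\<dots> = pairing u f + displacement G f (inv k) u"
    using pairing_add_left[OF u d] by (simp add: displacement_def)
  finally show ?thesis .
qed

lemma pairing_sum_list_right: "pairing u (\<lambda>x. \<Sum>k\<leftarrow>ks. h k x) = (\<Sum>k\<leftarrow>ks. pairing u (h k))"
proof (induction ks)
  case (Cons k ks)
  have "(\<lambda>x. \<Sum>j\<leftarrow>k # ks. h j x) = h k + (\<lambda>x. \<Sum>j\<leftarrow>ks. h j x)" by (simp add: fun_eq_iff)
  then show ?case using Cons by (simp only: pairing_add_right) simp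
qed (simp add: pairing_def)

text \<open>
  Almost invariance bounds the pairing with a translate of \<open>f\<close> by twice the pairing with \<open>f\<close>.
\<close>
lemma eventually_dominated_bounded:
  assumes f: "\<And>x. 0 \<le> f x" and h: "h \<in> l_infty_dominated G f"
  obtains M where "eventually (\<lambda>u. \<bar>pairing u h\<bar> \<le> M * pairing u f) (Reiter_filter G f)"
proof -
  obtain ks where ks: "set ks \<subseteq> carrier G" "\<And>x. \<bar>h x\<bar> \<le> (\<Sum>k\<leftarrow>ks. translate G k f x)"
    using h by (auto simp: l_infty_dominated_iff)
  have "eventually (\<lambda>u. \<forall>k\<in>set ks. u \<in> almost_invariant G f (inv k) 1) (Reiter_filter G f)"
    by (rule eventually_ball_finite) (use ks(1) in \<open>auto simp: subset_iff intro!: eventually_Reiter_filter\<close>)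
  moreover have "eventually (\<lambda>u. u \<in> almost_invariant G f \<one> 1) (Reiter_filter G f)"
    by (rule eventually_Reiter_filter) auto
  ultimately have "eventually (\<lambda>u. \<bar>pairing u h\<bar> \<le> (2 * length ks) * pairing u f) (Reiter_filter G f)"
  proof eventually_elim
    case (elim u)
    then have u: "u \<in> finitely_supported G" "\<And>x. 0 \<le> u x" by (auto simp: almost_invariant_def)
    have "\<bar>pairing u h\<bar> \<le> pairing (\<lambda>x. \<bar>u x\<bar>) (\<lambda>x. \<bar>h x\<bar>)" by (rule abs_pairing_le)
    also have "\<dots> \<le> pairing u (\<lambda>x. \<Sum>k\<leftarrow>ks. translate G k f x)"
      using u(2) ks(2) by (simp add: pairing_mono_right)
    also have "\<dots> = (\<Sum>k\<leftarrow>ks. pairing u (translate G k f))" by (rule pairing_sum_list_right)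
    also have "\<dots> \<le> (\<Sum>k\<leftarrow>ks. 2 * pairing u f)"
    proof (rule sum_list_mono)
      fix k assume k: "k \<in> set ks"
      then have "displacement G f (inv k) u < pairing u f" using elim by (auto simp: almost_invariant_def)
      then show "pairing u (translate G k f) \<le> 2 * pairing u f"
        using pairing_translate_le[OF u(1) subsetD[OF ks(1) k], of f, OF f] by simp
    qed
    finally show ?case by (simp add: sum_list_triv)
  qed
  then show ?thesis by (rule that)
qed

text \<open>
  Relative to the pairing with \<open>f\<close>, the pairing with a dominated function becomes translation
  invariant along the filter.
\<close>
lemma eventually_dominated_invariant:
  assumes f: "\<And>x. 0 \<le> f x" and h: "h \<in> l_infty_dominated G f" and g: "g \<in> carrier G" and "0 < \<eta>"
  shows "eventually (\<lambda>u. \<bar>pairing (translate G g u) h - pairing u h\<bar> \<le> \<eta> * pairing u f) (Reiter_filter G f)"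
proof -
  obtain ks where ks: "set ks \<subseteq> carrier G" "\<And>x. \<bar>h x\<bar> \<le> (\<Sum>k\<leftarrow>ks. translate G k f x)"
    using h by (auto simp: l_infty_dominated_iff)
  define \<epsilon> where "\<epsilon> = \<eta> / (2 * (real (length ks) + 1))"
  have \<epsilon>: "0 < \<epsilon>" using \<open>0 < \<eta>\<close> by (simp add: \<epsilon>_def)
  have "eventually (\<lambda>u. \<forall>k\<in>set ks. u \<in> almost_invariant G f (inv k) \<epsilon> \<inter> almost_invariant G f (inv k \<otimes> g) \<epsilon>) (Reiter_filter G f)"
    by (rule eventually_ball_finite)
      (use ks g \<epsilon> in \<open>auto simp: subset_iff intro!: eventually_conj eventually_Reiter_filter\<close>)
  moreover have "eventually (\<lambda>u. u \<in> almost_invariant G f \<one> 1) (Reiter_filter G f)"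
    by (rule eventually_Reiter_filter) auto
  ultimately show ?thesis
  proof eventually_elim
    case (elim u)
    then have u: "u \<in> finitely_supported G" "\<And>x. 0 \<le> u x" and pos: "0 < pairing u f"
      by (auto simp: almost_invariant_def)
    note tr = finitely_supported_translate[OF u(1) g]
    let ?d = "\<lambda>x. \<bar>(translate G g u - u) x\<bar>"
    have "\<bar>pairing (translate G g u) h - pairing u h\<bar> = \<bar>pairing (translate G g u - u) h\<bar>"
      by (simp only: pairing_diff_left[OF tr u(1)])
    also have "\<dots> \<le> pairing ?d (\<lambda>x. \<bar>h x\<bar>)" by (rule abs_pairing_le)
    also have "\<dots> \<le> pairing ?d (\<lambda>x. \<Sum>k\<leftarrow>ks. translate G k f x)"
      using ks(2) by (intro pairing_mono_right) auto
    also have "\<dots> = (\<Sum>k\<leftarrow>ks. pairing ?d (translate G k f))" by (rule pairing_sum_list_right)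
    also have "\<dots> \<le> (\<Sum>k\<leftarrow>ks. 2 * \<epsilon> * pairing u f)"
    proof (rule sum_list_mono)
      fix k assume k: "k \<in> set ks"
      then have "displacement G f (inv k) u < \<epsilon> * pairing u f" "displacement G f (inv k \<otimes> g) u < \<epsilon> * pairing u f"
        using elim by (auto simp: almost_invariant_def)
      then show "pairing ?d (translate G k f) \<le> 2 * \<epsilon> * pairing u f"
        using displacement_translate_le[OF u(1) g subsetD[OF ks(1) k], of f, OF f] by simp
    qed
    also have "\<dots> = (2 * \<epsilon> * length ks) * pairing u f" by (simp add: sum_list_triv)
    also have "\<dots> \<le> \<eta> * pairing u f"
    proof (rule mult_right_mono)
      show "2 * \<epsilon> * length ks \<le> \<eta>" using \<open>0 < \<eta>\<close> by (simp add: \<epsilon>_def field_simps)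
    qed (use pos in simp)
    finally show ?case .
  qed
qed

end

section \<open>Fixed points from the Reiter property\<close>

lemma top_dual_linear_on: "\<phi> \<in> top_dual E T \<Longrightarrow> linear_on E \<phi>"
  by (simp add: top_dual_def)

lemma top_dual_add:
  assumes "\<phi> \<in> top_dual E T" "\<psi> \<in> top_dual E T"
  shows "(\<lambda>x. \<phi> x + \<psi> x) \<in> top_dual E T"
  using assms by (auto simp: top_dual_def linear_on_def algebra_simps intro: continuous_map_add)

lemma top_dual_sum_list:
  assumes "\<And>k. k \<in> set ks \<Longrightarrow> \<phi> k \<in> top_dual E T"
  shows "(\<lambda>x. \<Sum>k\<leftarrow>ks. \<phi> k x) \<in> top_dual E T"
  using assms
proof (induction ks)
  case Nil
  then show ?case by (simp add: top_dual_def linear_on_def)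
next
  case (Cons k ks)
  then show ?case using top_dual_add[of "\<phi> k" E T "\<lambda>x. \<Sum>k\<leftarrow>ks. \<phi> k x"] by simp
qed

lemma top_dual_rep:
  assumes T: "lc_tvs_on E T" and rep: "cone_rep G E T C \<rho>" and \<phi>: "\<phi> \<in> top_dual E T" and g: "g \<in> carrier G"
  shows "(\<lambda>x. \<phi> (\<rho> g x)) \<in> top_dual E T"
proof -
  have lin: "linear_rep G E \<rho>" and cont: "continuous_map T T (\<rho> g)"
    using rep g by (auto simp: cone_rep_def)
  have "linear_on E (\<lambda>x. \<phi> (\<rho> g x))"
    using linear_rep_linear_on[OF lin g] top_dual_linear_on[OF \<phi>] linear_rep_closed[OF lin g]
    by (simp add: linear_on_def)
  moreover have "continuous_map T euclideanreal (\<lambda>x. \<phi> (\<rho> g x))"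
    using continuous_map_compose[OF cont, of euclideanreal \<phi>] \<phi> by (simp add: top_dual_def comp_def)
  ultimately show ?thesis by (simp add: top_dual_def)
qed

text \<open>
  The coefficient of the representation at \<open>x\<close> and \<open>\<psi>\<close>. Acting on \<open>\<psi>\<close> by the dual
  representation translates this function.
\<close>
definition orbit_function :: "('g, 'm) monoid_scheme \<Rightarrow> ('g \<Rightarrow> 'e \<Rightarrow> 'e) \<Rightarrow> 'e \<Rightarrow> ('e \<Rightarrow> real) \<Rightarrow> 'g \<Rightarrow> real" where
  "orbit_function G \<rho> x \<psi> g = (if g \<in> carrier G then \<psi> (\<rho> g x) else 0)"

lemma convex_cone_sum:
  assumes "convex_cone C" "\<And>i. i \<in> I \<Longrightarrow> 0 \<le> t i" "\<And>i. i \<in> I \<Longrightarrow> x i \<in> C"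
  shows "(\<Sum>i\<in>I. t i *\<^sub>R x i) \<in> C"
  using assms(2,3)
proof (induction I rule: infinite_finite_induct)
  case (insert i I)
  then show ?case using assms(1) by (auto intro: convex_cone_add convex_cone_scaleR)
qed (use convex_cone_contains_0[OF assms(1)] in auto)

text \<open>
  A family on which every functional converges is weakly Cauchy, so completeness turns the
  pointwise limits into a point of \<open>C\<close>.
\<close>
lemma tvs_complete_limit:
  assumes E: "subspace E" and C: "C \<subseteq> E" "weakly_complete E T C"
    and F: "F \<noteq> bot" "eventually (\<lambda>u. c u \<in> C) F"
    and conv: "\<And>\<psi>. \<psi> \<in> top_dual E T \<Longrightarrow> \<exists>L. ((\<lambda>u. \<psi> (c u)) \<longlongrightarrow> L) F"
  obtains x where "x \<in> C" "\<And>\<psi>. \<psi> \<in> top_dual E T \<Longrightarrow> ((\<lambda>u. \<psi> (c u)) \<longlongrightarrow> \<psi> x) F"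
proof -
  let ?F = "filtermap c F"
  have bot: "?F \<noteq> bot" using F(1) by (simp add: filtermap_bot_iff)
  have le: "?F \<le> principal C" using F(2) by (simp add: le_principal eventually_filtermap)
  have inE: "eventually (\<lambda>x. x \<in> E) ?F"
    using F(2) C(1) by (auto simp: eventually_filtermap elim: eventually_mono)
  have fst: "filterlim fst ?F (?F \<times>\<^sub>F ?F)" and snd: "filterlim snd ?F (?F \<times>\<^sub>F ?F)"
    by (simp_all add: filterlim_def filtermap_fst_prod_filter filtermap_snd_prod_filter)
  have pairE: "eventually (\<lambda>p. fst p \<in> E \<and> snd p \<in> E) (?F \<times>\<^sub>F ?F)"
    using inE fst snd by (intro eventually_conj) (auto intro: eventually_compose_filterlim)
  have "limitin (weak_topology E T) (\<lambda>p. snd p - fst p) 0 (?F \<times>\<^sub>F ?F)"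
  proof (rule limitin_weak_topologyI)
    show "0 \<in> E" by (rule subspace_0[OF E])
    show "eventually (\<lambda>p. snd p - fst p \<in> E) (?F \<times>\<^sub>F ?F)"
      using pairE by eventually_elim (simp add: E subspace_diff)
    fix \<psi> assume \<psi>: "\<psi> \<in> top_dual E T"
    note lin = top_dual_linear_on[OF \<psi>]
    obtain L where "((\<lambda>u. \<psi> (c u)) \<longlongrightarrow> L) F" using conv[OF \<psi>] by blast
    then have L: "(\<psi> \<longlongrightarrow> L) ?F" by (simp add: filterlim_filtermap)
    have "((\<lambda>p. \<psi> (snd p) - \<psi> (fst p)) \<longlongrightarrow> L - L) (?F \<times>\<^sub>F ?F)"
      by (intro tendsto_diff filterlim_compose[OF L] fst snd)
    moreover have "eventually (\<lambda>p. \<psi> (snd p) - \<psi> (fst p) = \<psi> (snd p - fst p)) (?F \<times>\<^sub>F ?F)"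
      using pairE by eventually_elim (simp add: linear_on_diff[OF E lin])
    ultimately have "((\<lambda>p. \<psi> (snd p - fst p)) \<longlongrightarrow> L - L) (?F \<times>\<^sub>F ?F)"
      by (rule Lim_transform_eventually)
    then show "((\<lambda>p. \<psi> (snd p - fst p)) \<longlongrightarrow> \<psi> 0) (?F \<times>\<^sub>F ?F)"
      by (simp add: linear_on_zero[OF E lin])
  qed
  then have "?F \<times>\<^sub>F ?F \<le> tvs_uniformity (weak_topology E T)"
    unfolding tvs_uniformity_def filtermap_le_iff_le_filtercomap[symmetric]
    by (auto simp: le_filter_def eventually_filtermap eventually_nhdsin limitin_def case_prod_unfold
        intro: eventually_mono)
  then obtain x where x: "x \<in> C" "limitin (weak_topology E T) (\<lambda>y. y) x ?F"
    using C(2) bot le unfolding weakly_complete_def tvs_complete_def by blast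
  have "((\<lambda>u. \<psi> (c u)) \<longlongrightarrow> \<psi> x) F" if "\<psi> \<in> top_dual E T" for \<psi>
    using limitin_weak_topologyD[OF x(2) that] by (simp add: filterlim_filtermap)
  then show ?thesis using x(1) that by blast
qed

text \<open>
  The points \<open>c u\<close> are the weighted averages of the orbit of \<open>x0\<close>, normalised by \<open>\<phi> (c u) = 1\<close>. The
  value of a functional at \<open>c u\<close> is a quotient of pairings with \<open>u\<close>, and the orbit function of the
  functional is dominated by that of \<open>\<phi>\<close>. So these values are bounded and asymptotically
  invariant along the filter of almost invariant functions.
\<close>
lemma (in group) fixed_point_of_Reiter:
  assumes R: "\<forall>f\<in>l_infty G. f \<noteq> 0 \<longrightarrow> reiter_property G f"
  shows "fixed_point_property_for_cones TYPE('e::real_vector) G"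
  unfolding fixed_point_property_for_cones_def
proof (intro allI impI, elim conjE)
  fix E :: "'e set" and T C \<rho>
  assume T: "lc_tvs_on E T" and C: "C \<subseteq> E" "proper_convex_cone C" "weakly_complete E T C"
    and rep: "cone_rep G E T C \<rho>" and lb: "locally_bounded_type G T C \<rho>" and cb: "cobounded_type G E T C \<rho>"
  have E: "subspace E" and top: "topspace T = E" using T by (auto simp: lc_tvs_on_def)
  have cone: "convex_cone C" using C(2) by (simp add: proper_convex_cone_def)
  have lin: "linear_rep G E \<rho>" using rep by (simp add: cone_rep_def)
  have \<rho>C: "\<rho> g c \<in> C" if "g \<in> carrier G" "c \<in> C" for g c
    using rep that by (auto simp: cone_rep_def)
  obtain x0 where x0: "x0 \<in> C" "x0 \<noteq> 0" and bdd: "tvs_bounded T (orbit G \<rho> x0)"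
    using lb by (auto simp: locally_bounded_type_def)
  have x0E: "x0 \<in> E" using x0 C by blast
  obtain \<phi>0 where \<phi>0: "\<phi>0 \<in> top_dual E T"
    and dom0: "\<And>\<psi>. \<psi> \<in> top_dual E T \<Longrightarrow> G_dominates G (dual_le C) (dual_act G \<rho>) \<phi>0 \<psi>"
    using cb unfolding cobounded_type_def by blast
  obtain ks where ks: "set ks \<subseteq> carrier G" "\<And>c. c \<in> C \<Longrightarrow> \<bar>\<phi>0 c\<bar> \<le> (\<Sum>k\<leftarrow>ks. \<phi>0 (\<rho> (inv k) c))"
    using dom0[OF \<phi>0] by (auto simp: G_dominates_dual_le_iff dual_act_def)
  \<comment> \<open>The dominating functional \<open>\<phi>0\<close> may be negative on \<open>C\<close>. Since it dominates itself, a sum \<open>\<phi>\<close> of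
    its translates majorises its absolute value on \<open>C\<close>, and \<open>\<phi>\<close> dominates whatever \<open>\<phi>0\<close> does.\<close>
  define \<phi> where "\<phi> c = (\<Sum>k\<leftarrow>ks. \<phi>0 (\<rho> (inv k) c))" for c
  have \<phi>: "\<phi> \<in> top_dual E T"
    unfolding \<phi>_def using ks(1) by (intro top_dual_sum_list top_dual_rep[OF T rep \<phi>0]) auto
  have \<phi>_ge: "\<bar>\<phi>0 c\<bar> \<le> \<phi> c" if "c \<in> C" for c using ks(2)[OF that] by (simp add: \<phi>_def)
  define f where "f = orbit_function G \<rho> x0 \<phi>"
  have f_nonneg: "0 \<le> f x" for x
    using \<phi>_ge[OF \<rho>C[OF _ x0(1)], of x] by (auto simp: f_def orbit_function_def)
  have dominated: "orbit_function G \<rho> x0 \<psi> \<in> l_infty_dominated G f" if \<psi>: "\<psi> \<in> top_dual E T" for \<psi>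
  proof -
    obtain hs where hs: "set hs \<subseteq> carrier G" "\<And>c. c \<in> C \<Longrightarrow> \<bar>\<psi> c\<bar> \<le> (\<Sum>h\<leftarrow>hs. \<phi>0 (\<rho> (inv h) c))"
      using dom0[OF \<psi>] by (auto simp: G_dominates_dual_le_iff dual_act_def)
    have "\<bar>orbit_function G \<rho> x0 \<psi> x\<bar> \<le> (\<Sum>h\<leftarrow>hs. translate G h f x)" for x
    proof (cases "x \<in> carrier G")
      case True
      have "\<bar>\<psi> (\<rho> x x0)\<bar> \<le> (\<Sum>h\<leftarrow>hs. \<phi>0 (\<rho> (inv h) (\<rho> x x0)))"
        by (rule hs(2)[OF \<rho>C[OF True x0(1)]])
      also have "\<dots> \<le> (\<Sum>h\<leftarrow>hs. translate G h f x)"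
      proof (rule sum_list_mono)
        fix h assume "h \<in> set hs"
        then have h: "h \<in> carrier G" using hs(1) by blast
        have "\<phi>0 (\<rho> (inv h) (\<rho> x x0)) \<le> \<phi> (\<rho> (inv h) (\<rho> x x0))"
          using \<phi>_ge[of "\<rho> (inv h) (\<rho> x x0)"] \<rho>C h True x0(1) by simp
        also have "\<dots> = translate G h f x"
          using h True x0E linear_rep_mult[OF lin] by (simp add: translate_apply f_def orbit_function_def)
        finally show "\<phi>0 (\<rho> (inv h) (\<rho> x x0)) \<le> translate G h f x" .
      qed
      finally show ?thesis using True by (simp add: orbit_function_def)
    next
      case False
      then show ?thesis
        by (auto simp: orbit_function_def translate_nonneg[OF f_nonneg] intro!: sum_list_nonneg)
    qed
    moreover have "orbit_function G \<rho> x0 \<psi> \<in> functions_on G"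
      by (simp add: functions_on_def orbit_function_def)
    ultimately show ?thesis using hs(1) unfolding l_infty_dominated_iff by blast
  qed
  have "f \<in> l_infty G"
  proof -
    let ?U = "{x \<in> E. \<phi> x \<in> {-1<..<1}}"
    have "openin T ?U"
      using \<phi> openin_continuous_map_preimage[of T euclideanreal \<phi> "{-1<..<1}"]
      by (simp add: top_dual_def top)
    moreover have "0 \<in> ?U" using E linear_on_zero[OF E top_dual_linear_on[OF \<phi>]] by (simp add: subspace_0)
    ultimately obtain r where r: "0 < r" "\<And>c. r \<le> \<bar>c\<bar> \<Longrightarrow> orbit G \<rho> x0 \<subseteq> (\<lambda>x. c *\<^sub>R x) ` ?U"
      using bdd unfolding tvs_bounded_def by meson
    have "\<bar>f x\<bar> \<le> r" if x: "x \<in> carrier G" for x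
    proof -
      have "\<rho> x x0 \<in> (\<lambda>x. r *\<^sub>R x) ` ?U" using r(2)[of r] r(1) x by (auto simp: orbit_def)
      then obtain y where y: "y \<in> E" "\<bar>\<phi> y\<bar> < 1" "\<rho> x x0 = r *\<^sub>R y" by auto
      have "f x = r * \<phi> y"
        using x y linear_on_scaleR[OF top_dual_linear_on[OF \<phi>] y(1)] by (simp add: f_def orbit_function_def)
      then show ?thesis using y(2) r(1) by (simp add: abs_mult mult_left_le)
    qed
    then have "bounded (f ` carrier G)" by (auto simp: bounded_iff)
    then show ?thesis by (simp add: l_infty_def functions_on_def f_def orbit_function_def)
  qed
  moreover have "f \<noteq> 0"
  proof
    assume f0: "f = 0"
    obtain \<psi> where \<psi>: "\<psi> \<in> top_dual E T" "\<psi> x0 \<noteq> 0" by (rule top_dual_separates[OF T x0E x0(2)])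
    obtain gs where "\<bar>orbit_function G \<rho> x0 \<psi> \<one>\<bar> \<le> (\<Sum>g\<leftarrow>gs. translate G g f \<one>)"
      using dominated[OF \<psi>(1)] unfolding l_infty_dominated_iff by blast
    moreover have "translate G g f \<one> = 0" for g by (simp add: translate_def f0)
    ultimately show False using \<psi>(2) linear_rep_one[OF lin x0E] by (simp add: orbit_function_def)
  qed
  ultimately have "reiter_property G f" using R by blast
  then have "Reiter_filter G f \<noteq> bot" by (rule Reiter_filter_neq_bot) (rule f_nonneg)
  then obtain U where U: "U \<le> Reiter_filter G f" "U \<noteq> bot"
    and ultra: "\<And>P. eventually P U \<or> eventually (\<lambda>u. \<not> P u) U"
    using ultrafilter_below[of "Reiter_filter G f"] by blast
  have good: "eventually (\<lambda>u. u \<in> almost_invariant G f \<one> 1) U"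
    by (rule filter_leD[OF U(1) eventually_Reiter_filter]) auto
  define c where "c u = (1 / pairing u f) *\<^sub>R (\<Sum>x | u x \<noteq> 0. u x *\<^sub>R \<rho> x x0)" for u
  have support: "\<rho> x x0 \<in> C" "\<rho> x x0 \<in> E" "x \<in> carrier G"
    if "u \<in> almost_invariant G f \<one> 1" "u x \<noteq> 0" for u x
    using that support_subset[of u G] \<rho>C[OF _ x0(1)] C(1) by (auto simp: almost_invariant_def)
  have cC: "c u \<in> C" if "u \<in> almost_invariant G f \<one> 1" for u
    unfolding c_def using that support[OF that]
    by (intro convex_cone_scaleR[OF cone] convex_cone_sum[OF cone]) (auto simp: almost_invariant_def)
  have barycentre: "\<psi> (c u) = pairing u (orbit_function G \<rho> x0 \<psi>) / pairing u f"
    if \<psi>: "\<psi> \<in> top_dual E T" and u: "u \<in> almost_invariant G f \<one> 1" for \<psi> u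
  proof -
    note lin\<psi> = top_dual_linear_on[OF \<psi>]
    have "(\<Sum>x | u x \<noteq> 0. u x *\<^sub>R \<rho> x x0) \<in> E"
      using support[OF u] E by (intro subspace_sum subspace_mul) auto
    then have "\<psi> (c u) = (1 / pairing u f) * \<psi> (\<Sum>x | u x \<noteq> 0. u x *\<^sub>R \<rho> x x0)"
      unfolding c_def using linear_on_scaleR[OF lin\<psi>] by simp
    also have "\<psi> (\<Sum>x | u x \<noteq> 0. u x *\<^sub>R \<rho> x x0) = (\<Sum>x | u x \<noteq> 0. u x *\<^sub>R \<psi> (\<rho> x x0))"
      by (rule linear_on_combination[OF E lin\<psi>]) (use support[OF u] in auto)
    also have "\<dots> = pairing u (orbit_function G \<rho> x0 \<psi>)"
      unfolding pairing_def by (rule sum.cong) (use support(3)[OF u] in \<open>auto simp: orbit_function_def\<close>)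
    finally show ?thesis by simp
  qed
  obtain x where x: "x \<in> C" and lim: "\<And>\<psi>. \<psi> \<in> top_dual E T \<Longrightarrow> ((\<lambda>u. \<psi> (c u)) \<longlongrightarrow> \<psi> x) U"
  proof (rule tvs_complete_limit[OF E C(1,3) U(2), of c])
    show "eventually (\<lambda>u. c u \<in> C) U" using good by eventually_elim (rule cC)
    fix \<psi> assume \<psi>: "\<psi> \<in> top_dual E T"
    obtain M where "eventually (\<lambda>u. \<bar>pairing u (orbit_function G \<rho> x0 \<psi>)\<bar> \<le> M * pairing u f) (Reiter_filter G f)"
      by (rule eventually_dominated_bounded[OF f_nonneg dominated[OF \<psi>]])
    from filter_leD[OF U(1) this] good
    have "eventually (\<lambda>u. \<bar>\<psi> (c u)\<bar> \<le> M) U"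
      by eventually_elim (auto simp: barycentre[OF \<psi>] almost_invariant_def field_simps)
    then show "\<exists>L. ((\<lambda>u. \<psi> (c u)) \<longlongrightarrow> L) U"
      using ultrafilter_bounded_convergent[OF U(2) ultra] by metis
  qed blast
  have xE: "x \<in> E" using x C by blast
  have "\<rho> g x = x" if g: "g \<in> carrier G" for g
  proof (rule ccontr)
    assume "\<rho> g x \<noteq> x"
    moreover have gx: "\<rho> g x \<in> E" by (rule linear_rep_closed[OF lin g xE])
    ultimately obtain \<psi> where \<psi>: "\<psi> \<in> top_dual E T" "\<psi> (\<rho> g x - x) \<noteq> 0"
      using top_dual_separates[OF T, of "\<rho> g x - x"] xE E by (auto intro: subspace_diff)
    let ?h = "orbit_function G \<rho> x0 \<psi>" and ?\<psi> = "\<lambda>x. \<psi> (\<rho> g x)"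
    have \<psi>g: "?\<psi> \<in> top_dual E T" by (rule top_dual_rep[OF T rep \<psi>(1) g])
    have shift: "orbit_function G \<rho> x0 ?\<psi> = translate G (inv g) ?h"
      using g x0E linear_rep_mult[OF lin] by (auto simp: orbit_function_def translate_def fun_eq_iff)
    have diff: "((\<lambda>u. ?\<psi> (c u) - \<psi> (c u)) \<longlongrightarrow> ?\<psi> x - \<psi> x) U"
      by (intro tendsto_diff lim \<psi>g \<psi>(1))
    have "\<bar>?\<psi> x - \<psi> x\<bar> \<le> 0"
    proof (rule field_le_epsilon)
      fix \<eta> :: real assume \<eta>: "0 < \<eta>"
      have "eventually (\<lambda>u. \<bar>?\<psi> (c u) - \<psi> (c u)\<bar> \<le> \<eta>) U"
        using filter_leD[OF U(1) eventually_dominated_invariant[OF f_nonneg dominated[OF \<psi>(1)] g \<eta>]] good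
      proof eventually_elim
        case (elim u)
        have "?\<psi> (c u) - \<psi> (c u) = (pairing (translate G g u) ?h - pairing u ?h) / pairing u f"
          using barycentre[OF \<psi>g elim(2)] barycentre[OF \<psi>(1) elim(2)] pairing_translate[of u g ?h] elim(2) g
          by (simp add: shift almost_invariant_def diff_divide_distrib)
        moreover have "0 < pairing u f" using elim(2) by (simp add: almost_invariant_def)
        ultimately have "\<bar>?\<psi> (c u) - \<psi> (c u)\<bar> = \<bar>pairing (translate G g u) ?h - pairing u ?h\<bar> / pairing u f"
          by (simp only: abs_divide abs_of_pos)
        then show ?case using elim(1) \<open>0 < pairing u f\<close> by (simp only: pos_divide_le_eq)
      qed
      then show "\<bar>?\<psi> x - \<psi> x\<bar> \<le> 0 + \<eta>"
        using tendsto_upperbound[OF tendsto_rabs[OF diff] _ U(2)] by simp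
    qed
    then show False using \<psi>(2) linear_on_diff[OF E top_dual_linear_on[OF \<psi>(1)] gx xE] by simp
  qed
  moreover have "x \<noteq> 0"
  proof
    assume "x = 0"
    have "eventually (\<lambda>u. \<phi> (c u) = 1) U"
      using good by eventually_elim (auto simp: barycentre[OF \<phi>] f_def[symmetric] almost_invariant_def)
    then have "((\<lambda>u. \<phi> (c u)) \<longlongrightarrow> 1) U" by (simp add: tendsto_eventually)
    then have "\<phi> x = 1" using tendsto_unique[OF U(2) lim[OF \<phi>]] by simp
    then show False using linear_on_zero[OF E top_dual_linear_on[OF \<phi>]] \<open>x = 0\<close> by simp
  qed
  ultimately show "\<exists>x\<in>C. x \<noteq> 0 \<and> (\<forall>g\<in>carrier G. \<rho> g x = x)" using x by blast
qed

section \<open>Spaces of linear forms with the topology of pointwise convergence\<close>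

lemma open_fun_coordinates:
  fixes x :: "'b \<Rightarrow> real"
  assumes "open W" "x \<in> W"
  obtains J e where "finite J" "0 < e" "\<And>y. (\<And>j. j \<in> J \<Longrightarrow> \<bar>y j - x j\<bar> < e) \<Longrightarrow> y \<in> W"
proof -
  obtain X where X: "x \<in> (\<Pi>\<^sub>E i\<in>UNIV. X i)" "\<And>i. open (X i)" "finite {i. X i \<noteq> UNIV}"
    and sub: "(\<Pi>\<^sub>E i\<in>UNIV. X i) \<subseteq> W"
    using product_topology_open_contains_basis[of "\<lambda>_. euclidean" UNIV W x] assms
    by (auto simp: euclidean_product_topology)
  have "\<exists>d>0. \<forall>r. \<bar>r - x i\<bar> < d \<longrightarrow> r \<in> X i" for i
    using X(1,2) unfolding open_dist dist_real_def by (auto simp: PiE_iff)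
  then obtain d where d: "\<And>i. 0 < d i" "\<And>i r. \<bar>r - x i\<bar> < d i \<Longrightarrow> r \<in> X i" by metis
  define J where "J = {i. X i \<noteq> UNIV}"
  define e where "e = Min (insert 1 (d ` J))"
  have J: "finite J" using X(3) by (simp add: J_def)
  have "0 < e" unfolding e_def using J d(1) by (subst Min_gr_iff) auto
  moreover have "y \<in> W" if y: "\<And>j. j \<in> J \<Longrightarrow> \<bar>y j - x j\<bar> < e" for y
  proof -
    have "y i \<in> X i" for i
    proof (cases "i \<in> J")
      case True
      then have "e \<le> d i" unfolding e_def using J by (intro Min_le) auto
      then show ?thesis using y[OF True] d(2) by (meson less_le_trans)
    qed (simp add: J_def)
    then show ?thesis using sub by auto
  qed
  ultimately show ?thesis using J that by blast
qed

lemma open_coordinates: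
  fixes x :: "'b \<Rightarrow> real"
  assumes "finite J"
  shows "open {y. \<forall>j\<in>J. \<bar>y j - x j\<bar> < e}"
proof -
  have "open {y. \<forall>j\<in>J. y j \<in> ball (x j) e}"
    using product_topology_basis'[of J "\<lambda>j. ball (x j) e" "\<lambda>j. j"] assms by simp
  then show ?thesis by (simp add: dist_real_def abs_minus_commute)
qed

text \<open>
  Linear forms on \<open>V\<close> are made to vanish off \<open>V\<close>, so that equality of functions is equality of
  linear forms.
\<close>
definition linear_forms :: "'b::real_vector set \<Rightarrow> ('b \<Rightarrow> real) set" where
  "linear_forms V = {\<mu>. linear_on V \<mu> \<and> (\<forall>h. h \<notin> V \<longrightarrow> \<mu> h = 0)}"

definition dual_cone :: "'b::real_vector set \<Rightarrow> 'b set \<Rightarrow> ('b \<Rightarrow> real) set" where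
  "dual_cone V P = {\<mu> \<in> linear_forms V. \<forall>h\<in>P. 0 \<le> \<mu> h}"

abbreviation weak_star :: "'b::real_vector set \<Rightarrow> ('b \<Rightarrow> real) topology" where
  "weak_star V \<equiv> top_of_set (linear_forms V)"

lemma subspace_linear_forms: "subspace (linear_forms V)"
  by (auto simp: subspace_def linear_forms_def linear_on_def algebra_simps)

text \<open>
  The topology is induced from the product topology, where everything is checked in one coordinate
  at a time. The convex neighbourhoods are those that bound finitely many coordinates.
\<close>
lemma lc_tvs_linear_forms: "lc_tvs_on (linear_forms V) (weak_star V)"
  unfolding lc_tvs_on_def
proof (intro conjI subspace_linear_forms)
  let ?E = "linear_forms V"
  show "topspace (weak_star V) = ?E" by simp
  have fst: "continuous_on S (\<lambda>p. fst p i)" for S :: "(('a \<Rightarrow> real) \<times> ('a \<Rightarrow> real)) set" and i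
    by (rule continuous_on_product_then_coordinatewise[OF continuous_on_fst[OF continuous_on_id]])
  have snd: "continuous_on S (\<lambda>p. snd p i)" for S :: "('c::topological_space \<times> ('a \<Rightarrow> real)) set" and i
    by (rule continuous_on_product_then_coordinatewise[OF continuous_on_snd[OF continuous_on_id]])
  have "continuous_on (?E \<times> ?E) (\<lambda>p. fst p + snd p)"
    by (rule continuous_on_coordinatewise_then_product, unfold plus_fun_apply)
      (rule continuous_on_add[OF fst snd])
  then show "continuous_map (prod_topology (weak_star V) (weak_star V)) (weak_star V) (\<lambda>(x, y). x + y)"
    unfolding prod_topology_subtopology_eu continuous_map_subtopology_eu case_prod_unfold
    using subspace_add[OF subspace_linear_forms, of _ V] by auto
  have "continuous_on (UNIV \<times> ?E) (\<lambda>p. fst p *\<^sub>R snd p)"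
    by (rule continuous_on_coordinatewise_then_product, unfold scaleR_fun_apply)
      (rule continuous_on_scaleR[OF continuous_on_fst[OF continuous_on_id] snd])
  then have "continuous_map (prod_topology (top_of_set UNIV) (weak_star V)) (weak_star V) (\<lambda>(c, x). c *\<^sub>R x)"
    unfolding prod_topology_subtopology_eu continuous_map_subtopology_eu case_prod_unfold
    using subspace_mul[OF subspace_linear_forms, of _ V] by auto
  then show "continuous_map (prod_topology euclideanreal (weak_star V)) (weak_star V) (\<lambda>(c, x). c *\<^sub>R x)"
    by simp
  show "neighbourhood_base_of convex (weak_star V)"
    unfolding neighbourhood_base_of
  proof (intro allI impI, elim conjE)
    fix W and x :: "'a \<Rightarrow> real" assume W: "openin (weak_star V) W" "x \<in> W"
    then obtain O' where O': "open O'" "W = ?E \<inter> O'" by (auto simp: openin_open)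
    obtain J e where J: "finite J" "0 < e" "\<And>y. (\<And>j. j \<in> J \<Longrightarrow> \<bar>y j - x j\<bar> < e) \<Longrightarrow> y \<in> O'"
      using open_fun_coordinates[OF O'(1), of x] W O' by auto
    let ?N = "?E \<inter> {y. \<forall>j\<in>J. \<bar>y j - x j\<bar> < e}"
    have "openin (weak_star V) ?N" using open_coordinates[OF J(1)] by (rule openin_open_Int)
    moreover have "convex ?N"
    proof (rule convex_Int)
      show "convex ?E" by (rule subspace_imp_convex[OF subspace_linear_forms])
      have "convex {y :: 'a \<Rightarrow> real. \<bar>y j - x j\<bar> < e}" for j
      proof (rule convexI)
        fix y z :: "'a \<Rightarrow> real" and s t :: real
        assume yz: "y \<in> {y. \<bar>y j - x j\<bar> < e}" "z \<in> {y. \<bar>y j - x j\<bar> < e}" and st: "0 \<le> s" "0 \<le> t" "s + t = 1"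
        have "s * y j + t * z j \<in> ball (x j) e"
          using convexD[OF convex_ball, of "y j" "x j" e "z j" s t] yz st
          by (simp add: dist_real_def abs_minus_commute)
        then show "s *\<^sub>R y + t *\<^sub>R z \<in> {y. \<bar>y j - x j\<bar> < e}"
          by (simp add: dist_real_def abs_minus_commute)
      qed
      then have "convex (\<Inter>j\<in>J. {y :: 'a \<Rightarrow> real. \<bar>y j - x j\<bar> < e})" by (rule convex_INT)
      then show "convex {y. \<forall>j\<in>J. \<bar>y j - x j\<bar> < e}" by (simp add: INTER_eq)
    qed
    moreover have "x \<in> ?N" "?N \<subseteq> W" using J W O' by auto
    ultimately show "\<exists>U Va. openin (weak_star V) U \<and> convex Va \<and> x \<in> U \<and> U \<subseteq> Va \<and> Va \<subseteq> W"
      by blast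
  qed
  have "Hausdorff_space (euclidean :: ('a \<Rightarrow> real) topology)"
    unfolding euclidean_product_topology[symmetric] Hausdorff_space_product_topology by simp
  then show "Hausdorff_space (weak_star V)" by (rule Hausdorff_space_subtopology)
qed

lemma evaluation_in_top_dual: "(\<lambda>\<mu>. \<mu> h) \<in> top_dual (linear_forms V) (weak_star V)"
  using continuous_on_subset[OF continuous_on_product_coordinates subset_UNIV, of "linear_forms V" h]
  by (simp add: top_dual_def linear_on_def)

lemma Cauchy_filter_real_convergent:
  fixes F :: "real filter"
  assumes "F \<noteq> bot" "\<And>e. 0 < e \<Longrightarrow> eventually (\<lambda>p. \<bar>snd p - fst p\<bar> < e) (F \<times>\<^sub>F F)"
  obtains l where "F \<le> nhds l"
proof -
  have "cauchy_filter F"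
    unfolding cauchy_filter_def
  proof (rule filter_leI)
    fix P :: "real \<times> real \<Rightarrow> bool" assume "eventually P uniformity"
    then obtain e where "0 < e" "\<And>x y. dist x y < e \<Longrightarrow> P (x, y)"
      by (auto simp: eventually_uniformity_metric)
    then show "eventually P (F \<times>\<^sub>F F)"
      using assms(2)[of e] by (auto elim!: eventually_mono simp: dist_real_def abs_minus_commute)
  qed
  moreover have "complete (UNIV :: real set)" by (rule complete_UNIV)
  ultimately show ?thesis
    using assms(1) that unfolding complete_uniform by auto
qed

text \<open>
  Evaluations are continuous functionals, so a weakly Cauchy filter converges pointwise. The
  limit is a linear form in the dual cone, and pointwise convergence to it implies convergence of
  every continuous functional.
\<close>
lemma weakly_complete_dual_cone: "weakly_complete (linear_forms V) (weak_star V) (dual_cone V P)"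
  unfolding weakly_complete_def tvs_complete_def
proof (intro allI impI)
  let ?E = "linear_forms V" and ?T = "weak_star V"
  fix F assume F: "F \<noteq> bot" "F \<le> principal (dual_cone V P)"
    and cauchy: "F \<times>\<^sub>F F \<le> tvs_uniformity (weak_topology ?E ?T)"
  have inC: "eventually (\<lambda>\<mu>. \<mu> \<in> dual_cone V P) F" using F(2) by (simp add: le_principal)
  have "\<exists>l. ((\<lambda>\<mu>. \<mu> h) \<longlongrightarrow> l) F" for h
  proof -
    let ?F = "filtermap (\<lambda>\<mu>. \<mu> h) F"
    have "eventually (\<lambda>p. \<bar>snd p - fst p\<bar> < e) (?F \<times>\<^sub>F ?F)" if e: "0 < e" for e
    proof -
      let ?W = "{\<mu> \<in> ?E. \<mu> h \<in> {-e<..<e}}"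
      have "openin (weak_topology ?E ?T) ?W"
        unfolding weak_topology_def
        by (rule topology_generated_by_Basis, intro CollectI exI[of _ "\<lambda>\<mu>. \<mu> h"] exI[of _ "{-e<..<e}"])
          (simp add: evaluation_in_top_dual)
      moreover have "0 \<in> ?W" using e subspace_0[OF subspace_linear_forms] by simp
      ultimately have "eventually (\<lambda>\<mu>. \<mu> \<in> ?W) (nhdsin (weak_topology ?E ?T) 0)"
        unfolding eventually_nhdsin by blast
      then have "eventually (\<lambda>p. snd p - fst p \<in> ?W) (tvs_uniformity (weak_topology ?E ?T))"
        unfolding tvs_uniformity_def eventually_filtercomap by (auto intro!: exI[of _ "\<lambda>\<mu>. \<mu> \<in> ?W"])
      then have "eventually (\<lambda>p. snd p - fst p \<in> ?W) (F \<times>\<^sub>F F)" by (rule filter_leD[OF cauchy])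
      then have "eventually (\<lambda>p. \<bar>(snd p) h - (fst p) h\<bar> < e) (F \<times>\<^sub>F F)"
        by (rule eventually_mono) auto
      then show ?thesis
        by (simp add: filtermap_prod_filter[symmetric] eventually_filtermap case_prod_unfold)
    qed
    then obtain l where "?F \<le> nhds l"
      using Cauchy_filter_real_convergent[of ?F] F(1) by (auto simp: filtermap_bot_iff)
    then show ?thesis by (auto simp: filterlim_def)
  qed
  then obtain m where m: "\<And>h. ((\<lambda>\<mu>. \<mu> h) \<longlongrightarrow> m h) F" by metis
  have eq: "a = b" if "((\<lambda>\<mu>. q \<mu> :: real) \<longlongrightarrow> a) F" "((\<lambda>\<mu>. r \<mu>) \<longlongrightarrow> b) F"
    "\<And>\<mu>. \<mu> \<in> dual_cone V P \<Longrightarrow> q \<mu> = r \<mu>" for q r a b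
  proof -
    have "((\<lambda>\<mu>. r \<mu>) \<longlongrightarrow> a) F"
      by (rule Lim_transform_eventually[OF that(1)]) (use inC that(3) in \<open>auto elim: eventually_mono\<close>)
    then show ?thesis using tendsto_unique[OF F(1)] that(2) by blast
  qed
  have mE: "m \<in> ?E"
    unfolding linear_forms_def linear_on_def
  proof (intro CollectI conjI ballI allI impI)
    fix h k assume "h \<in> V" "k \<in> V"
    then show "m (h + k) = m h + m k"
      by (intro eq[OF m tendsto_add[OF m m]]) (simp add: dual_cone_def linear_forms_def linear_on_def)
  next
    fix c h assume "h \<in> V"
    then show "m (c *\<^sub>R h) = c *\<^sub>R m h"
      by (intro eq[OF m tendsto_scaleR[OF tendsto_const m]]) (simp add: dual_cone_def linear_forms_def linear_on_def)
  next
    fix h assume "h \<notin> V"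
    then show "m h = 0"
      by (intro eq[OF m tendsto_const]) (simp add: dual_cone_def linear_forms_def)
  qed
  have "0 \<le> m h" if "h \<in> P" for h
    by (rule tendsto_lowerbound[OF m _ F(1)]) (use inC that in \<open>auto simp: dual_cone_def elim: eventually_mono\<close>)
  then have "m \<in> dual_cone V P" using mE by (simp add: dual_cone_def)
  moreover have "limitin (weak_topology ?E ?T) (\<lambda>\<mu>. \<mu>) m F"
  proof (rule limitin_weak_topologyI[OF mE])
    show inE: "eventually (\<lambda>\<mu>. \<mu> \<in> ?E) F"
      using inC by (rule eventually_mono) (simp add: dual_cone_def)
    have "((\<lambda>\<mu>. \<mu>) \<longlongrightarrow> m) F"
    proof (rule topological_tendstoI)
      fix W assume "open W" "m \<in> W"
      then obtain J e where J: "finite J" "0 < e" "\<And>y. (\<And>j. j \<in> J \<Longrightarrow> \<bar>y j - m j\<bar> < e) \<Longrightarrow> y \<in> W"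
        by (rule open_fun_coordinates) blast
      have "eventually (\<lambda>\<mu>. \<forall>j\<in>J. \<bar>\<mu> j - m j\<bar> < e) F"
        using J(1,2) m by (intro eventually_ball_finite) (auto simp: tendsto_iff dist_real_def)
      then show "eventually (\<lambda>\<mu>. \<mu> \<in> W) F" by (rule eventually_mono) (simp add: J(3))
    qed
    then have lim: "limitin ?T (\<lambda>\<mu>. \<mu>) m F"
      using inE mE by (simp add: limitin_subtopology)
    fix \<psi> assume "\<psi> \<in> top_dual ?E ?T"
    then show "((\<lambda>\<mu>. \<psi> \<mu>) \<longlongrightarrow> \<psi> m) F"
      using continuous_map_limit[OF _ lim, of euclideanreal \<psi>] by (simp add: top_dual_def comp_def)
  qed
  ultimately show "\<exists>x\<in>dual_cone V P. limitin (weak_topology ?E ?T) (\<lambda>y. y) x F" by blast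
qed

lemma weak_star_nbhd_zero:
  assumes "openin (weak_star V) U" "0 \<in> U"
  obtains J e where "finite J" "0 < e"
    "\<And>y. y \<in> linear_forms V \<Longrightarrow> (\<And>j. j \<in> J \<Longrightarrow> \<bar>y j\<bar> < e) \<Longrightarrow> y \<in> U"
proof -
  obtain O' where O': "open O'" "U = linear_forms V \<inter> O'" using assms(1) by (auto simp: openin_open)
  obtain J e where J: "finite J" "0 < e" "\<And>y. (\<And>j. j \<in> J \<Longrightarrow> \<bar>y j - 0 j\<bar> < e) \<Longrightarrow> y \<in> O'"
    using open_fun_coordinates[OF O'(1), of 0] assms(2) O'(2) by auto
  show ?thesis by (rule that[OF J(1,2)]) (use J(3) O'(2) in auto)
qed

text \<open>
  A continuous functional depends on finitely many coordinates only. This bound stands in for the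
  fact that it is an evaluation, and suffices for domination.
\<close>
lemma weak_star_functional_bound:
  assumes \<psi>: "\<psi> \<in> top_dual (linear_forms V) (weak_star V)"
  obtains J M where "finite J" "\<And>\<mu>. \<mu> \<in> linear_forms V \<Longrightarrow> \<bar>\<psi> \<mu>\<bar> \<le> M * (\<Sum>j\<in>J. \<bar>\<mu> j\<bar>)"
proof -
  let ?E = "linear_forms V"
  have lin: "linear_on ?E \<psi>" using \<psi> by (simp add: top_dual_def)
  let ?U = "{\<mu> \<in> ?E. \<psi> \<mu> \<in> {-1<..<1}}"
  have "openin (weak_star V) ?U"
    using \<psi> openin_continuous_map_preimage[of "weak_star V" euclideanreal \<psi> "{-1<..<1}"]
    by (simp add: top_dual_def)
  moreover have "0 \<in> ?U"
    using subspace_0[OF subspace_linear_forms] linear_on_zero[OF subspace_linear_forms lin] by simp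
  ultimately obtain J e where J: "finite J" "0 < e"
    and small: "\<And>\<mu>. \<mu> \<in> ?E \<Longrightarrow> (\<And>j. j \<in> J \<Longrightarrow> \<bar>\<mu> j\<bar> < e) \<Longrightarrow> \<mu> \<in> ?U"
    by (rule weak_star_nbhd_zero) blast
  have "\<bar>\<psi> \<mu>\<bar> \<le> 1 / e * (\<Sum>j\<in>J. \<bar>\<mu> j\<bar>)" if \<mu>: "\<mu> \<in> ?E" for \<mu>
  proof -
    let ?s = "\<Sum>j\<in>J. \<bar>\<mu> j\<bar>"
    have s: "0 \<le> ?s" by (rule sum_nonneg) simp
    have "e * \<bar>\<psi> \<mu>\<bar> \<le> ?s"
    proof (rule field_le_epsilon)
      fix \<eta> :: real assume \<eta>: "0 < \<eta>"
      let ?c = "e / (?s + \<eta>)"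
      have c: "0 < ?c" using J(2) s \<eta> by (intro divide_pos_pos) linarith+
      have "?c *\<^sub>R \<mu> \<in> ?U"
      proof (rule small)
        show "?c *\<^sub>R \<mu> \<in> ?E" by (rule subspace_mul[OF subspace_linear_forms \<mu>])
        fix j assume "j \<in> J"
        then have "\<bar>\<mu> j\<bar> \<le> ?s" using J(1) by (intro member_le_sum) auto
        then have "\<bar>\<mu> j\<bar> < ?s + \<eta>" using \<eta> by simp
        then have "?c * \<bar>\<mu> j\<bar> < ?c * (?s + \<eta>)" using c by (rule mult_strict_left_mono)
        also have "?c * (?s + \<eta>) = e" using add_nonneg_pos[OF s \<eta>] by simp
        finally show "\<bar>(?c *\<^sub>R \<mu>) j\<bar> < e" using c by (simp only: scaleR_fun_apply real_scaleR_def abs_mult abs_of_pos)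
      qed
      then have "?c * \<psi> \<mu> \<in> {-1<..<1}" using linear_on_scaleR[OF lin \<mu>, of ?c] by simp
      moreover have "\<bar>a\<bar> < 1" if "a \<in> {-1<..<1}" for a :: real using that by auto
      ultimately have "\<bar>?c * \<psi> \<mu>\<bar> < 1" by blast
      then have "?c * \<bar>\<psi> \<mu>\<bar> < 1" using c by (simp only: abs_mult abs_of_pos)
      then show "e * \<bar>\<psi> \<mu>\<bar> \<le> ?s + \<eta>" using s \<eta> by (simp add: divide_less_eq)
    qed
    then show ?thesis using J(2) by (simp add: field_simps)
  qed
  then show ?thesis using J(1) that by blast
qed

section \<open>Integrals from fixed points\<close>

definition positive_forms :: "('g, 'm) monoid_scheme \<Rightarrow> ('g \<Rightarrow> real) \<Rightarrow> (('g \<Rightarrow> real) \<Rightarrow> real) set" where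
  "positive_forms G f = dual_cone (l_infty_dominated G f) {h \<in> l_infty_dominated G f. 0 \<le> h}"

lemma positive_forms_mono:
  assumes "\<mu> \<in> positive_forms G f" "h \<in> l_infty_dominated G f" "k \<in> l_infty_dominated G f" "h \<le> k"
  shows "\<mu> h \<le> \<mu> k"
proof -
  have "0 \<le> \<mu> (k - h)"
    using assms by (auto simp: positive_forms_def dual_cone_def le_fun_def
        intro: subspace_diff[OF subspace_l_infty_dominated])
  then show ?thesis
    using assms linear_on_diff[OF subspace_l_infty_dominated, of G f \<mu> k h]
    by (simp add: positive_forms_def dual_cone_def linear_forms_def)
qed

context group
begin

text \<open>
  A positive form turns domination of functions into domination of its values.
\<close>
lemma positive_forms_dominated:
  assumes \<mu>: "\<mu> \<in> positive_forms G f" and f: "f \<in> l_infty G" "0 \<le> f" and h: "h \<in> l_infty_dominated G f"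
    and ks: "set ks \<subseteq> carrier G" "\<And>x. \<bar>h x\<bar> \<le> (\<Sum>k\<leftarrow>ks. translate G k f x)"
  shows "\<bar>\<mu> h\<bar> \<le> (\<Sum>k\<leftarrow>ks. \<mu> (translate G k f))"
proof -
  let ?V = "l_infty_dominated G f"
  have lin: "linear_on ?V \<mu>" using \<mu> by (simp add: positive_forms_def dual_cone_def linear_forms_def)
  have fV: "f \<in> ?V" using f by (intro self_mem_l_infty_dominated) (auto simp: l_infty_def)
  have sum: "(\<lambda>x. \<Sum>k\<leftarrow>ks. translate G k f x) \<in> ?V \<and>
      \<mu> (\<lambda>x. \<Sum>k\<leftarrow>ks. translate G k f x) = (\<Sum>k\<leftarrow>ks. \<mu> (translate G k f))"
    using ks(1)
  proof (induction ks)
    case Nil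
    have "(\<lambda>x. 0) = (0 :: 'a \<Rightarrow> real)" by (simp add: fun_eq_iff)
    then show ?case
      using subspace_0[OF subspace_l_infty_dominated] linear_on_zero[OF subspace_l_infty_dominated lin] by simp
  next
    case (Cons k ks)
    have split: "(\<lambda>x. \<Sum>j\<leftarrow>k # ks. translate G j f x) = translate G k f + (\<lambda>x. \<Sum>j\<leftarrow>ks. translate G j f x)"
      by (simp add: fun_eq_iff)
    have k: "translate G k f \<in> ?V"
      using translate_mem_l_infty_dominated[OF fV, of k] Cons.prems by simp
    have IH: "(\<lambda>x. \<Sum>j\<leftarrow>ks. translate G j f x) \<in> ?V"
        "\<mu> (\<lambda>x. \<Sum>j\<leftarrow>ks. translate G j f x) = (\<Sum>j\<leftarrow>ks. \<mu> (translate G j f))"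
      using Cons by auto
    show ?case
      unfolding split linear_on_add[OF lin k IH(1)] IH(2)
      using subspace_add[OF subspace_l_infty_dominated k IH(1)] by (simp del: plus_fun_apply)
  qed
  have neg: "- h \<in> ?V" by (rule subspace_neg[OF subspace_l_infty_dominated h])
  have "h \<le> (\<lambda>x. \<Sum>k\<leftarrow>ks. translate G k f x)" "- h \<le> (\<lambda>x. \<Sum>k\<leftarrow>ks. translate G k f x)"
    using ks(2) by (auto simp: le_fun_def abs_le_iff)
  then have "\<mu> h \<le> \<mu> (\<lambda>x. \<Sum>k\<leftarrow>ks. translate G k f x)" "\<mu> (- h) \<le> \<mu> (\<lambda>x. \<Sum>k\<leftarrow>ks. translate G k f x)"
    using sum h neg by (blast intro: positive_forms_mono[OF \<mu>])+
  then show ?thesis using sum linear_on_uminus[OF lin h] by (simp add: abs_le_iff)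
qed

text \<open>
  The group acts on the positive linear forms on the functions dominated by \<open>f\<close>. Evaluation at a
  point has a bounded orbit because dominated functions are bounded, and evaluation at \<open>f\<close> dominates
  every continuous functional. A non-zero invariant positive form cannot vanish at \<open>f\<close>, which
  dominates everything, so it can be normalised.
\<close>
lemma integral_of_fixed_point_property:
  assumes fpp: "fixed_point_property_for_cones TYPE(('a \<Rightarrow> real) \<Rightarrow> real) G"
    and f: "f \<in> l_infty G" "f \<noteq> 0" "0 \<le> f"
  shows "\<exists>\<mu>. normalised_integral G f \<mu>"
proof -
  let ?V = "l_infty_dominated G f"
  let ?E = "linear_forms ?V" and ?T = "weak_star ?V" and ?C = "positive_forms G f"
  define A where "A g \<mu> h = (if h \<in> ?V then \<mu> (translate G (inv g) h) else 0)" for g and \<mu> :: "('a \<Rightarrow> real) \<Rightarrow> real" and h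
  let ?\<rho> = "\<lambda>g. restrict (A g) ?E"
  note V = subspace_l_infty_dominated[of G f]
  note trV = translate_mem_l_infty_dominated[of _ f]
  have fV: "f \<in> ?V" using f by (intro self_mem_l_infty_dominated) (auto simp: l_infty_def)
  have VF: "h \<in> functions_on G" if "h \<in> ?V" for h using that by (simp add: l_infty_dominated_def)
  have C_def: "?C = {\<mu> \<in> ?E. \<forall>h\<in>?V. 0 \<le> h \<longrightarrow> 0 \<le> \<mu> h}" by (auto simp: positive_forms_def dual_cone_def)
  have linE: "linear_on ?V \<mu>" "h \<notin> ?V \<Longrightarrow> \<mu> h = 0" if "\<mu> \<in> ?E" for \<mu> h
    using that by (auto simp: linear_forms_def)
  have AE: "A g \<mu> \<in> ?E" if g: "g \<in> carrier G" and \<mu>: "\<mu> \<in> ?E" for g \<mu>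
    using linE(1)[OF \<mu>] trV[OF _ inv_closed[OF g]] subspace_add[OF V] subspace_mul[OF V]
    by (auto simp: linear_forms_def A_def linear_on_def translate_add translate_scaleR)
  have lin: "linear_rep G ?E ?\<rho>"
  proof (rule linear_rep_restrict[OF subspace_linear_forms])
    fix \<mu> assume "\<mu> \<in> ?E"
    then show "A \<one> \<mu> = \<mu>" using linE(2) VF by (auto simp: A_def fun_eq_iff translate_one)
  next
    fix g h \<mu> assume "g \<in> carrier G" "h \<in> carrier G" "\<mu> \<in> ?E"
    then show "A (g \<otimes> h) \<mu> = A g (A h \<mu>)"
      using trV by (auto simp: A_def fun_eq_iff translate_translate inv_mult_group)
  next
    fix g assume "g \<in> carrier G"
    show "linear_on ?E (A g)" by (auto simp: linear_on_def A_def fun_eq_iff)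
  qed (rule AE)
  have cone: "cone_rep G ?E ?T ?C ?\<rho>"
    unfolding cone_rep_def
  proof (intro conjI lin ballI)
    fix g assume g: "g \<in> carrier G"
    have "continuous_on ?E (A g)"
    proof (rule continuous_on_coordinatewise_then_product)
      fix h
      show "continuous_on ?E (\<lambda>\<mu>. A g \<mu> h)"
        unfolding A_def by (cases "h \<in> ?V") (auto intro: continuous_on_subset[OF continuous_on_product_coordinates])
    qed
    then have "continuous_on ?E (?\<rho> g)" by (rule continuous_on_eq) simp
    then show "continuous_map ?T ?T (?\<rho> g)" using AE[OF g] by auto
    show "?\<rho> g ` ?C \<subseteq> ?C"
    proof (rule image_subsetI)
      fix \<mu> assume \<mu>: "\<mu> \<in> ?C"
      then have "0 \<le> A g \<mu> h" if "h \<in> ?V" "0 \<le> h" for h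
        using that trV[OF that(1) inv_closed[OF g]] translate_nonneg[of h G "inv g"]
        by (auto simp: C_def A_def le_fun_def)
      then show "?\<rho> g \<mu> \<in> ?C" using \<mu> AE[OF g] by (simp add: C_def)
    qed
  qed
  have proper: "proper_convex_cone ?C"
    unfolding proper_convex_cone_def
  proof
    show "convex_cone ?C"
      unfolding convex_cone_iff C_def using subspace_linear_forms[of ?V]
      by (auto simp: subspace_0 subspace_add subspace_mul)
    have "\<mu> = 0" if \<mu>: "\<mu> \<in> ?C" "- \<mu> \<in> ?C" for \<mu>
    proof
      fix h
      have zero: "\<mu> k = 0" if "k \<in> ?V" "0 \<le> k" for k
        using \<mu> that by (force simp: C_def)
      show "\<mu> h = 0 h"
      proof (cases "h \<in> ?V")
        case True
        obtain ks where ks: "set ks \<subseteq> carrier G" "\<And>x. \<bar>h x\<bar> \<le> (\<Sum>k\<leftarrow>ks. translate G k f x)"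
          using True by (auto simp: l_infty_dominated_iff)
        have "\<mu> (translate G k f) = 0" if "k \<in> set ks" for k
          using that ks(1) trV[OF fV] f(3) by (intro zero) (auto simp: le_fun_def translate_nonneg)
        then have "(\<Sum>k\<leftarrow>ks. \<mu> (translate G k f)) = 0" by (simp cong: map_cong)
        then show ?thesis using positive_forms_dominated[OF \<mu>(1) f(1,3) True ks] by simp
      qed (use \<mu> linE(2) in \<open>auto simp: C_def\<close>)
    qed
    moreover have "0 \<in> ?C" by (simp add: C_def subspace_0[OF subspace_linear_forms])
    ultimately show "?C \<inter> uminus ` ?C = {0}" by force
  qed
  have lb: "locally_bounded_type G ?T ?C ?\<rho>"
  proof -
    obtain x where x: "f x \<noteq> 0" using f(2) by (auto simp: fun_eq_iff)
    define \<delta> where "\<delta> h = (if h \<in> ?V then h x else 0)" for h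
    have \<delta>E: "\<delta> \<in> ?E" using subspace_add[OF V] subspace_mul[OF V] by (auto simp: linear_forms_def linear_on_def \<delta>_def)
    then have "\<delta> \<in> ?C" by (auto simp: C_def \<delta>_def le_fun_def)
    moreover have "\<delta> f \<noteq> 0" using x fV by (simp add: \<delta>_def)
    then have "\<delta> \<noteq> 0" by auto
    moreover have "tvs_bounded ?T (orbit G ?\<rho> \<delta>)"
      unfolding tvs_bounded_def
    proof (intro allI impI, elim conjE)
      fix U assume "openin ?T U" "0 \<in> U"
      then obtain J e where J: "finite J" "0 < e"
        and small: "\<And>y. y \<in> ?E \<Longrightarrow> (\<And>j. j \<in> J \<Longrightarrow> \<bar>y j\<bar> < e) \<Longrightarrow> y \<in> U"
        by (rule weak_star_nbhd_zero) blast
      have "\<exists>M. \<forall>x. h \<in> ?V \<longrightarrow> \<bar>h x\<bar> \<le> M" for h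
        using l_infty_dominated_bounded[OF _ f(1), of h] by metis
      then obtain M where M: "\<And>h x. h \<in> ?V \<Longrightarrow> \<bar>h x\<bar> \<le> M h" by metis
      define r where "r = ((\<Sum>j\<in>J. \<bar>M j\<bar>) + 1) / e"
      have s: "0 \<le> (\<Sum>j\<in>J. \<bar>M j\<bar>)" by (rule sum_nonneg) simp
      have r: "0 < r" unfolding r_def using s J(2) by (intro divide_pos_pos) linarith+
      have "orbit G ?\<rho> \<delta> \<subseteq> (\<lambda>x. c *\<^sub>R x) ` U" if c: "r \<le> \<bar>c\<bar>" for c
      proof
        fix y assume "y \<in> orbit G ?\<rho> \<delta>"
        then obtain g where g: "g \<in> carrier G" "y = A g \<delta>" using \<delta>E by (auto simp: orbit_def)
        have yE: "y \<in> ?E" using AE[OF g(1) \<delta>E] g(2) by simp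
        have c0: "0 < \<bar>c\<bar>" using r c by linarith
        have "(1 / c) *\<^sub>R y \<in> U"
        proof (rule small)
          show "(1 / c) *\<^sub>R y \<in> ?E" by (rule subspace_mul[OF subspace_linear_forms yE])
          fix j assume j: "j \<in> J"
          have "\<bar>y j\<bar> \<le> \<bar>M j\<bar>"
          proof (cases "j \<in> ?V")
            case True
            then have "\<bar>translate G (inv g) j x\<bar> \<le> \<bar>M j\<bar>"
              using M[OF True, of "inv (inv g) \<otimes> x"] by (auto simp: translate_def)
            then show ?thesis using True trV[OF True inv_closed[OF g(1)]] by (simp add: g(2) A_def \<delta>_def)
          qed (simp add: g(2) A_def)
          also have "\<dots> \<le> (\<Sum>j\<in>J. \<bar>M j\<bar>)" using j J(1) by (intro member_le_sum) auto
          also have "\<dots> < e * r" using J(2) by (simp add: r_def)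
          also have "\<dots> \<le> e * \<bar>c\<bar>" using c J(2) by simp
          finally show "\<bar>((1 / c) *\<^sub>R y) j\<bar> < e" using c0 by (simp add: abs_mult field_simps)
        qed
        moreover have "y = c *\<^sub>R ((1 / c) *\<^sub>R y)" using c0 by simp
        ultimately show "y \<in> (\<lambda>x. c *\<^sub>R x) ` U" by (metis image_eqI)
      qed
      then show "\<exists>r>0. \<forall>c. r \<le> \<bar>c\<bar> \<longrightarrow> orbit G ?\<rho> \<delta> \<subseteq> (\<lambda>x. c *\<^sub>R x) ` U" using r by blast
    qed
    ultimately show ?thesis unfolding locally_bounded_type_def by blast
  qed
  have cb: "cobounded_type G ?E ?T ?C ?\<rho>"
    unfolding cobounded_type_def
  proof (intro bexI ballI)
    show "(\<lambda>\<mu>. \<mu> f) \<in> top_dual ?E ?T" by (rule evaluation_in_top_dual)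
    fix \<psi> assume "\<psi> \<in> top_dual ?E ?T"
    then obtain J M where J: "finite J" "\<And>\<mu>. \<mu> \<in> ?E \<Longrightarrow> \<bar>\<psi> \<mu>\<bar> \<le> M * (\<Sum>j\<in>J. \<bar>\<mu> j\<bar>)"
      by (rule weak_star_functional_bound) blast
    have act: "dual_act G ?\<rho> g (\<lambda>\<mu>. \<mu> f) \<mu> = \<mu> (translate G g f)" if "g \<in> carrier G" "\<mu> \<in> ?C" for g \<mu>
      using that fV by (simp add: dual_act_def A_def C_def)
    show "G_dominates G (dual_le ?C) (dual_act G ?\<rho>) (\<lambda>\<mu>. \<mu> f) \<psi>"
      unfolding G_dominates_dual_le_iff
    proof (rule dominated_of_bound[OF J(1), where \<psi>' = "\<lambda>j \<mu>. \<mu> j"])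
      fix j
      show "\<exists>gs. set gs \<subseteq> carrier G \<and> (\<forall>\<mu>\<in>?C. \<bar>\<mu> j\<bar> \<le> (\<Sum>g\<leftarrow>gs. dual_act G ?\<rho> g (\<lambda>\<mu>. \<mu> f) \<mu>))"
      proof (cases "j \<in> ?V")
        case True
        then obtain ks where ks: "set ks \<subseteq> carrier G" "\<And>x. \<bar>j x\<bar> \<le> (\<Sum>k\<leftarrow>ks. translate G k f x)"
          by (auto simp: l_infty_dominated_iff)
        have "(\<Sum>g\<leftarrow>ks. dual_act G ?\<rho> g (\<lambda>\<mu>. \<mu> f) \<mu>) = (\<Sum>k\<leftarrow>ks. \<mu> (translate G k f))" if "\<mu> \<in> ?C" for \<mu>
          using ks(1) act that by (intro arg_cong[where f = sum_list] map_cong) auto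
        then show ?thesis
          using positive_forms_dominated[OF _ f(1,3) True ks] ks(1) by (intro exI[of _ ks]) simp
      next
        case False
        then show ?thesis using linE(2) by (intro exI[of _ "[]"]) (auto simp: C_def)
      qed
    qed (use J(2) in \<open>auto simp: C_def\<close>)
  qed
  have complete: "weakly_complete ?E ?T ?C"
    unfolding positive_forms_def by (rule weakly_complete_dual_cone)
  have CE: "?C \<subseteq> ?E" by (auto simp: C_def)
  have "\<exists>\<mu>\<in>?C. \<mu> \<noteq> 0 \<and> (\<forall>g\<in>carrier G. ?\<rho> g \<mu> = \<mu>)"
    by (rule fpp[unfolded fixed_point_property_for_cones_def, rule_format], intro conjI)
      (fact lc_tvs_linear_forms CE proper complete cone lb cb)+
  then obtain \<mu> where \<mu>: "\<mu> \<in> ?C" "\<mu> \<noteq> 0" "\<And>g. g \<in> carrier G \<Longrightarrow> ?\<rho> g \<mu> = \<mu>"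
    by blast
  have \<mu>E: "\<mu> \<in> ?E" using \<mu>(1) by (simp add: C_def)
  have inv: "\<mu> (translate G g h) = \<mu> h" if "g \<in> carrier G" "h \<in> ?V" for g h
    using fun_cong[OF \<mu>(3)[of "inv g"], of h] that \<mu>E by (simp add: A_def)
  have "\<mu> f \<noteq> 0"
  proof
    assume "\<mu> f = 0"
    obtain h where h: "\<mu> h \<noteq> 0" using \<mu>(2) by (auto simp: fun_eq_iff)
    then have hV: "h \<in> ?V" using linE(2)[OF \<mu>E] by blast
    then obtain ks where ks: "set ks \<subseteq> carrier G" "\<And>x. \<bar>h x\<bar> \<le> (\<Sum>k\<leftarrow>ks. translate G k f x)"
      by (auto simp: l_infty_dominated_iff)
    have "(\<Sum>k\<leftarrow>ks. \<mu> (translate G k f)) = (\<Sum>k\<leftarrow>ks. 0)"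
      using ks(1) inv[OF _ fV] \<open>\<mu> f = 0\<close> by (intro arg_cong[where f = sum_list] map_cong) auto
    then show False using positive_forms_dominated[OF \<mu>(1) f(1,3) hV ks] h by simp
  qed
  moreover have "0 \<le> \<mu> f" using \<mu>(1) fV f(3) by (simp add: C_def)
  ultimately have "normalised_integral G f (\<lambda>h. \<mu> h / \<mu> f)"
    using linE(1)[OF \<mu>E] \<mu>(1) inv
    by (auto simp: normalised_integral_def linear_on_def C_def add_divide_distrib)
  then show ?thesis by blast
qed

end

section \<open>The equivalence\<close>

text \<open>
  The Reiter property involves only the absolute value of \<open>f\<close>.
\<close>
lemma (in group) reiter_property_of_translate_property:
  assumes trans: "translate_property G" and f: "f \<in> l_infty G" "f \<noteq> 0"
  shows "reiter_property G f"
  unfolding reiter_property_def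
proof (intro allI impI, elim conjE)
  fix S and \<epsilon> :: real assume S: "finite S" "S \<subseteq> carrier G" "0 < \<epsilon>"
  let ?f = "\<lambda>x. \<bar>f x\<bar>"
  have "?f \<in> l_infty G" using f(1) by (auto simp: l_infty_def functions_on_def bounded_iff)
  moreover have "?f \<noteq> 0" using f(2) by (auto simp: fun_eq_iff)
  ultimately obtain w where w: "w \<in> finitely_supported G"
    and inv: "\<And>s. s \<in> S \<Longrightarrow> pairing (\<lambda>x. \<bar>translate G s w x - w x\<bar>) ?f < \<epsilon> * pairing (\<lambda>x. \<bar>w x\<bar>) ?f"
    using weighted_Reiter_of_translate_property[OF trans, of ?f S \<epsilon>] S by auto
  have "l1_norm G ((translate G s w - w) * f) < \<epsilon> * l1_norm G (w * f)" if s: "s \<in> S" for s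
  proof -
    have "translate G s w - w \<in> finitely_supported G"
      using finitely_supported_translate[OF w] w s S(2) by blast
    then show ?thesis using inv[OF s] l1_norm_eq_pairing[OF w, of f] l1_norm_eq_pairing[of "translate G s w - w" G f]
      by simp
  qed
  then show "\<exists>u\<in>functions_on G. finite {x. u x \<noteq> 0} \<and>
      (\<forall>s\<in>S. l1_norm G ((translate G s u - u) * f) < \<epsilon> * l1_norm G (u * f))"
    using w by (auto simp: finitely_supported_def)
qed

theorem theorem7:
  fixes G :: "('g, 'm) monoid_scheme"
  assumes "group G"
  shows
    "(fixed_point_property_for_cones TYPE(('g \<Rightarrow> real) \<Rightarrow> real) G \<longleftrightarrow> translate_property G) \<and>
     (abstract_translate_property TYPE('g \<Rightarrow> real) G \<longleftrightarrow> translate_property G) \<and>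
     ((\<forall>f\<in>l_infty G. f \<noteq> 0 \<and> 0 \<le> f \<longrightarrow> (\<exists>\<mu>. normalised_integral G f \<mu>))
        \<longleftrightarrow> translate_property G) \<and>
     ((\<forall>f\<in>l_infty G. f \<noteq> 0 \<longrightarrow> reiter_property G f) \<longleftrightarrow> translate_property G) \<and>
     (translate_property G \<longrightarrow>
        fixed_point_property_for_cones TYPE('e::real_vector) G \<and>
        abstract_translate_property TYPE('v::real_vector) G)"
proof -
  interpret group G by fact
  let ?int = "\<forall>f\<in>l_infty G. f \<noteq> 0 \<and> 0 \<le> f \<longrightarrow> (\<exists>\<mu>. normalised_integral G f \<mu>)"
  let ?Reiter = "\<forall>f\<in>l_infty G. f \<noteq> 0 \<longrightarrow> reiter_property G f"
  have 1: "fixed_point_property_for_cones TYPE(('g \<Rightarrow> real) \<Rightarrow> real) G \<Longrightarrow> ?int"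
    using integral_of_fixed_point_property by blast
  have 2: "?int \<Longrightarrow> translate_property G" by (rule translate_property_of_integrals)
  have 3: "translate_property G \<Longrightarrow> ?Reiter" using reiter_property_of_translate_property by blast
  have 4: "?Reiter \<Longrightarrow> fixed_point_property_for_cones TYPE(('g \<Rightarrow> real) \<Rightarrow> real) G"
    by (rule fixed_point_of_Reiter)
  have 5: "?Reiter \<Longrightarrow> fixed_point_property_for_cones TYPE('e) G" by (rule fixed_point_of_Reiter)
  have 6: "abstract_translate_property TYPE('g \<Rightarrow> real) G \<longleftrightarrow> translate_property G"
    using translate_property_of_abstract abstract_of_translate_property by blast
  have 7: "translate_property G \<Longrightarrow> abstract_translate_property TYPE('v) G"
    by (rule abstract_of_translate_property)
  show ?thesis using 1 2 3 4 5 6 7 by blast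
qed

end
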